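(* Let a group $G$ act without inversion on a CAT(0) cube complex $X$, and suppose $g\in G$ is hyperbolic. Then $M^{\mathrm{ess}}_g=X^{\mathrm{ess}}_g$ if and only if $\langle g\rangle$ acts non-transversely on $X^{\mathrm{ess}}_g$.
   Context: A half-space $H$ of $X$ is the closure of a component of the complement of a hyperplane, $\overline H$ the complementary half-space, and $\mathcal H(X)$ is ordered by inclusion. $H,H'$ are transverse if $H\cap H'$, $H\cap\overline{H'}$, $\overline H\cap H'$, $\overline H\cap\overline{H'}$ are all nonempty. An action is without inversion if $gH\neq\overline H$ for all $g\in G$, $H\in\mathcal H(X)$. Distances between vertices are combinatorial. $g$ is hyperbolic if $\ell_g=\min_x d(x,gx)>0$ ($x$ ranging over vertices); then it has combinatorial axes (bi-infinite combinatorial geodesics preserved by $g$, on which $g$ translates by $\ell_g$, oriented forward). $A_g^+$ is the set of half-spaces dual to positively oriented edges of a combinatorial axis (independent of the axis; the half-space dual to an oriented edge $(x,y)$ contains $y$ but not $x$), and $A_g=A_g^+\sqcup\{\overline H:H\in A_g^+\}$. For a set $\mathcal A$ of half-spaces closed under $H\mapsto\overline H$, $X(\mathcal A)$ denotes the Sageev construction: vertices are subsets of $\mathcal A$ containing exactly one of each pair $\{H,\overline H\}$, no two elements disjoint, satisfying the descending chain condition; vertices differing on exactly one pair span an edge; cubes are attached whenever their $1$-skeleta are present. The essential characteristic set is $X^{\mathrm{ess}}_g=X(A_g)$, a CAT(0) cube complex whose half-spaces are identified with $A_g$. $M_g$ is the full subcomplex of $X$ spanned by the vertices realizing $\ell_g$,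 and $X_g$ is its convex hull. Let $T_g$ be the set of half-spaces not in $A_g$ whose bounding hyperplane separates two combinatorial axes of $g$, and $X^{\mathrm{ell}}_g=X(T_g)$. There is a $\langle g\rangle$-equivariant isomorphism $X_g\cong X^{\mathrm{ess}}_g\times X^{\mathrm{ell}}_g$ (send a vertex $v$, regarded as the set of half-spaces containing it, to its intersections with $A_g$ and $T_g$). The essential minimal set $M^{\mathrm{ess}}_g\subseteq X^{\mathrm{ess}}_g$ is the image of $M_g$ under projection to the first factor. $\langle g\rangle$ acts non-transversely on $X^{\mathrm{ess}}_g$ if for every $H\in A_g$, $H$ and $gH$ are not transverse in $X^{\mathrm{ess}}_g$ (equivalently, in $X$). *)

theory Defs
  imports "HOL-Algebra.Group_Action"
begin

section \<open>Cube complexes\<close>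

text \<open>
  A cube complex is given by the family \<open>X\<close> of the vertex sets of its cubes; its vertices are
  the elements of \<open>\<Union>X\<close>. The vertices of an \<open>n\<close>-cube are labelled by the subsets of
  \<open>{..<n}\<close>, and its faces are then the Boolean intervals \<open>{P..Q}\<close>. The two conditions are those of
  a cubical complex in the sense of Bridson and Haefliger: cubes are embedded, and two cubes that
  meet do so in a common face. Every CAT(0) cube complex has both properties.
\<close>

definition cube_complex :: "'v set set \<Rightarrow> bool" where
  "cube_complex X \<longleftrightarrow>
     (\<forall>c\<in>X. \<exists>(n::nat) f. bij_betw f (Pow {..<n}) c \<and>
        {d \<in> X. d \<subseteq> c} = {f ` {P..Q} | P Q. P \<subseteq> Q \<and> Q \<subseteq> {..<n}}) \<and>
     (\<forall>c\<in>X. \<forall>d\<in>X. c \<inter> d \<noteq> {} \<longrightarrow> c \<inter> d \<in> X)"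

definition adjacent :: "'v set set \<Rightarrow> 'v \<Rightarrow> 'v \<Rightarrow> bool" where
  "adjacent X x y \<longleftrightarrow> x \<noteq> y \<and> {x, y} \<in> X"

text \<open>The link of \<open>v\<close>: a cube \<open>c\<close> containing \<open>v\<close> contributes the simplex whose vertices are the
  edges of \<open>c\<close> at \<open>v\<close>, each edge being represented by its other endpoint. The empty simplex
  (from the cube \<open>{v}\<close>) is included.\<close>

definition link :: "'v set set \<Rightarrow> 'v \<Rightarrow> 'v set set" where
  "link X v = {{w \<in> c. adjacent X v w} | c. c \<in> X \<and> v \<in> c}"

definition flag :: "'w set set \<Rightarrow> bool" where
  "flag K \<longleftrightarrow> (\<forall>S. finite S \<and> S \<subseteq> \<Union>K \<and> (\<forall>a\<in>S. \<forall>b\<in>S. {a, b} \<in> K) \<longrightarrow> S \<in> K)"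

definition edge_path :: "'v set set \<Rightarrow> 'v list \<Rightarrow> bool" where
  "edge_path X p \<longleftrightarrow> p \<noteq> [] \<and> set p \<subseteq> \<Union>X \<and> successively (adjacent X) p"

text \<open>Elementary homotopies of edge paths: removing a backtrack, and pushing a path across a
  square. The equivalence relation they generate is homotopy relative to the endpoints, so the
  following definition says that the edge-path group, i.e. the fundamental group, is trivial.\<close>

inductive elementary_homotopy :: "'v set set \<Rightarrow> 'v list \<Rightarrow> 'v list \<Rightarrow> bool" for X where
  backtrack: "adjacent X x y \<Longrightarrow> elementary_homotopy X (p @ [x, y, x] @ q) (p @ [x] @ q)"
| square: "\<lbrakk>adjacent X x y; adjacent X y z; adjacent X x w; adjacent X w z;
     {x, y, z, w} \<in> X; x \<noteq> z; y \<noteq> w\<rbrakk> \<Longrightarrow>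
     elementary_homotopy X (p @ [x, y, z] @ q) (p @ [x, w, z] @ q)"

definition simply_connected_complex :: "'v set set \<Rightarrow> bool" where
  "simply_connected_complex X \<longleftrightarrow>
     \<Union>X \<noteq> {} \<and>
     (\<forall>x\<in>\<Union>X. \<forall>y\<in>\<Union>X. \<exists>p. edge_path X p \<and> hd p = x \<and> last p = y) \<and>
     (\<forall>p. edge_path X p \<and> hd p = last p \<longrightarrow> equivclp (elementary_homotopy X) p [hd p])"

definition cat0_cube_complex :: "'v set set \<Rightarrow> bool" where
  "cat0_cube_complex X \<longleftrightarrow>
     cube_complex X \<and> simply_connected_complex X \<and> (\<forall>v\<in>\<Union>X. flag (link X v))"

definition comb_dist :: "'v set set \<Rightarrow> 'v \<Rightarrow> 'v \<Rightarrow> nat" where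
  "comb_dist X x y =
     (LEAST n. \<exists>p. edge_path X p \<and> hd p = x \<and> last p = y \<and> length p = Suc n)"


section \<open>Hyperplanes and half-spaces\<close>

text \<open>A hyperplane is represented by the set of edges it crosses, i.e. by a class of the
  equivalence relation generated by being opposite edges of a square (two disjoint edges whose
  union is a cube).\<close>

definition edges :: "'v set set \<Rightarrow> 'v set set" where
  "edges X = {e \<in> X. card e = 2}"

definition opposite :: "'v set set \<Rightarrow> 'v set \<Rightarrow> 'v set \<Rightarrow> bool" where
  "opposite X e f \<longleftrightarrow> e \<in> edges X \<and> f \<in> edges X \<and> e \<inter> f = {} \<and> e \<union> f \<in> X"

definition hyperplanes :: "'v set set \<Rightarrow> 'v set set set" where
  "hyperplanes X = {{f. equivclp (opposite X) e f} | e. e \<in> edges X}"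

text \<open>Half-spaces are represented by their vertex sets. Thus the half-space complementary to
  \<open>H\<close> is \<open>\<Union>X - H\<close>, and a half-space and its complement are disjoint.\<close>

definition halfspaces :: "'v set set \<Rightarrow> 'v set set" where
  "halfspaces X =
     {{y. (x, y) \<in> {(a, b). {a, b} \<in> edges X - h}\<^sup>*} | x h. x \<in> \<Union>X \<and> h \<in> hyperplanes X}"

definition transverse :: "'v set \<Rightarrow> 'v set \<Rightarrow> 'v set \<Rightarrow> bool" where
  "transverse V H K \<longleftrightarrow>
     H \<inter> K \<noteq> {} \<and> H \<inter> (V - K) \<noteq> {} \<and> (V - H) \<inter> K \<noteq> {} \<and> (V - H) \<inter> (V - K) \<noteq> {}"


section \<open>The Sageev construction\<close>

definition descending_chain_condition :: "'v set set \<Rightarrow> bool" where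
  "descending_chain_condition U \<longleftrightarrow>
     \<not> (\<exists>h :: nat \<Rightarrow> 'v set. \<forall>n. h n \<in> U \<and> h (Suc n) \<subset> h n)"

text \<open>\<open>V\<close> is the vertex set of the ambient complex, so that \<open>V - H\<close> is the complementary
  half-space of \<open>H\<close>.\<close>

definition sageev_vertices :: "'v set \<Rightarrow> 'v set set \<Rightarrow> 'v set set set" where
  "sageev_vertices V A =
     {U. U \<subseteq> A \<and> (\<forall>H\<in>A. (H \<in> U) \<noteq> (V - H \<in> U)) \<and> (\<forall>H\<in>U. \<forall>K\<in>U. H \<inter> K \<noteq> {}) \<and>
         descending_chain_condition U}"

definition differ_on_one_pair :: "'v set \<Rightarrow> 'v set set \<Rightarrow> 'v set set \<Rightarrow> bool" where
  "differ_on_one_pair V U W \<longleftrightarrow> (\<exists>H. U - W = {H} \<and> W - U = {V - H})"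

text \<open>A cube is attached to every copy of the \<open>1\<close>-skeleton of an \<open>n\<close>-cube in the graph of
  vertices and edges; \<open>n = 0\<close> and \<open>n = 1\<close> give the vertices and the edges.\<close>

definition sageev_complex :: "'v set \<Rightarrow> 'v set set \<Rightarrow> 'v set set set set" where
  "sageev_complex V A =
     {f ` Pow {..<n} | (n::nat) f.
        inj_on f (Pow {..<n}) \<and> f ` Pow {..<n} \<subseteq> sageev_vertices V A \<and>
        (\<forall>S i. S \<subseteq> {..<n} \<and> i \<in> {..<n} - S \<longrightarrow> differ_on_one_pair V (f S) (f (insert i S)))}"


section \<open>Group actions and hyperbolic automorphisms\<close>

definition cubical_action :: "('g, 'm) monoid_scheme \<Rightarrow> ('g \<Rightarrow> 'v \<Rightarrow> 'v) \<Rightarrow> 'v set set \<Rightarrow> bool" where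
  "cubical_action G \<phi> X \<longleftrightarrow>
     group_action G (\<Union>X) \<phi> \<and> (\<forall>g\<in>carrier G. \<forall>c\<in>X. \<phi> g ` c \<in> X)"

definition without_inversion :: "('g, 'm) monoid_scheme \<Rightarrow> ('g \<Rightarrow> 'v \<Rightarrow> 'v) \<Rightarrow> 'v set set \<Rightarrow> bool" where
  "without_inversion G \<phi> X \<longleftrightarrow>
     (\<forall>g\<in>carrier G. \<forall>H\<in>halfspaces X. \<phi> g ` H \<noteq> \<Union>X - H)"

text \<open>In the following, \<open>t\<close> is the automorphism of \<open>X\<close> by which the group element acts.\<close>

definition translation_length :: "'v set set \<Rightarrow> ('v \<Rightarrow> 'v) \<Rightarrow> nat" where
  "translation_length X t = (LEAST n. \<exists>x\<in>\<Union>X. comb_dist X x (t x) = n)"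

definition hyperbolic :: "'v set set \<Rightarrow> ('v \<Rightarrow> 'v) \<Rightarrow> bool" where
  "hyperbolic X t \<longleftrightarrow> translation_length X t > 0"

definition combinatorial_axis :: "'v set set \<Rightarrow> ('v \<Rightarrow> 'v) \<Rightarrow> (int \<Rightarrow> 'v) \<Rightarrow> bool" where
  "combinatorial_axis X t \<gamma> \<longleftrightarrow>
     range \<gamma> \<subseteq> \<Union>X \<and> (\<forall>i j. int (comb_dist X (\<gamma> i) (\<gamma> j)) = \<bar>i - j\<bar>) \<and>
     (\<forall>i. t (\<gamma> i) = \<gamma> (i + int (translation_length X t)))"

definition pos_char_halfspaces :: "'v set set \<Rightarrow> ('v \<Rightarrow> 'v) \<Rightarrow> 'v set set" where
  "pos_char_halfspaces X t =
     {H \<in> halfspaces X. \<exists>\<gamma> i. combinatorial_axis X t \<gamma> \<and> \<gamma> i \<notin> H \<and> \<gamma> (i + 1) \<in> H}"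

definition char_halfspaces :: "'v set set \<Rightarrow> ('v \<Rightarrow> 'v) \<Rightarrow> 'v set set" where
  "char_halfspaces X t =
     pos_char_halfspaces X t \<union> (\<lambda>H. \<Union>X - H) ` pos_char_halfspaces X t"

definition ess_char_set :: "'v set set \<Rightarrow> ('v \<Rightarrow> 'v) \<Rightarrow> 'v set set set set" where
  "ess_char_set X t = sageev_complex (\<Union>X) (char_halfspaces X t)"

definition min_set :: "'v set set \<Rightarrow> ('v \<Rightarrow> 'v) \<Rightarrow> 'v set set" where
  "min_set X t = {c \<in> X. \<forall>x\<in>c. comb_dist X x (t x) = translation_length X t}"

text \<open>The projection to the essential factor sends a vertex, regarded as the set of half-spaces
  containing it, to its intersection with the characteristic half-spaces.\<close>

definition ess_proj :: "'v set set \<Rightarrow> ('v \<Rightarrow> 'v) \<Rightarrow> 'v \<Rightarrow> 'v set set" where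
  "ess_proj X t v = {H \<in> halfspaces X. v \<in> H} \<inter> char_halfspaces X t"

definition ess_min_set :: "'v set set \<Rightarrow> ('v \<Rightarrow> 'v) \<Rightarrow> 'v set set set set" where
  "ess_min_set X t = (\<lambda>c. ess_proj X t ` c) ` min_set X t"

text \<open>The half-space of a Sageev complex \<open>Y\<close> that corresponds to \<open>H\<close>.\<close>

definition sageev_halfspace :: "'v set set set set \<Rightarrow> 'v set \<Rightarrow> 'v set set set" where
  "sageev_halfspace Y H = {U \<in> \<Union>Y. H \<in> U}"

definition acts_nontransversely_ess :: "'v set set \<Rightarrow> ('v \<Rightarrow> 'v) \<Rightarrow> bool" where
  "acts_nontransversely_ess X t \<longleftrightarrow>
     (let Y = ess_char_set X t in
      \<forall>H\<in>char_halfspaces X t.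
        \<not> transverse (\<Union>Y) (sageev_halfspace Y H) (sageev_halfspace Y (t ` H)))"

end

theory Submission
  imports Defs
begin

text \<open>
  Edge paths are studied modulo exchanging the two halves of a square. The flag condition gives
  this calculus Garside's lemma, so that a non-reduced path can be shortened by square exchanges and
  one backtrack, and simple connectivity then identifies reduced paths with geodesics. Quadrangle
  condition, two-sidedness and convexity of hyperplanes follow.

  Let \<open>M\<close> be the set of vertices \<open>v\<close> moved by the minimal distance. By Haglund's theorem each lies
  on an axis, so the orbit of \<open>v\<close> under \<open>\<langle>g\<rangle>\<close> enters each \<open>H \<in> A\<^sub>g\<^sup>+\<close> exactly once and never leaves it;
  hence \<open>v \<in> gH\<close> implies \<open>v \<in> H\<close>. If \<open>M\<close> projects onto the essential characteristic set, \<open>H\<close> and \<open>gH\<close>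
  therefore cannot be transverse. Conversely, non-transversality forces \<open>gH \<subseteq> H\<close> for
  \<open>H \<in> A\<^sub>g\<^sup>+\<close>. A vertex \<open>U\<close> of the essential characteristic set, completed by the half-spaces
  outside \<open>A\<^sub>g\<close> containing a fixed \<open>v \<in> M\<close>, is then the set of half-spaces containing a vertex \<open>w\<close> of
  \<open>X\<close>. Exactly one half-space of each \<open>\<langle>g\<rangle>\<close>-orbit in \<open>A\<^sub>g\<^sup>+\<close> separates \<open>w\<close> from \<open>gw\<close>, as for
  \<open>v\<close>, so \<open>w \<in> M\<close>.
\<close>

section \<open>Cubes and squares\<close>

text \<open>Apart from simple connectivity, the hypothesis on \<open>X\<close> is local, so the
  global structure has to be extracted from edge paths. The flag condition enters at two places:
  three squares around a vertex close up to a 3-cube, which is what makes overlapping square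
  exchanges commute, and an embedded 1-skeleton of a cube bounds a cube. Simple connectivity is
  exploited by letting each edge act on classes of reduced paths. This action respects backtracks
  and squares, hence homotopic paths have the same normal form. After that, geometry becomes
  counting: distance is the number of separating half-spaces, and displacement the number of
  half-spaces entered in one period.

  The equality to be proved is one of complexes, so cubes must be followed in both directions.
  Projection collapses the directions of a cube that are not characteristic. The lift uses one and
  the same \<open>v\<close> for all corners, so that neighbouring corners are still separated by a
  single half-space.\<close>

definition square :: "'v set set \<Rightarrow> 'v \<Rightarrow> 'v \<Rightarrow> 'v \<Rightarrow> 'v \<Rightarrow> bool" where
  "square X x y z w \<longleftrightarrow> adjacent X x y \<and> adjacent X y z \<and> adjacent X x w \<and> adjacent X w z \<and>
     {x, y, z, w} \<in> X \<and> x \<noteq> z \<and> y \<noteq> w"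

lemma adjacent_sym: "adjacent X x y \<longleftrightarrow> adjacent X y x"
  by (auto simp: adjacent_def insert_commute)

lemma adjacent_irrefl: "\<not> adjacent X x x"
  by (simp add: adjacent_def)

lemma adjacent_vertex: "adjacent X x y \<Longrightarrow> x \<in> \<Union>X \<and> y \<in> \<Union>X"
  by (auto simp: adjacent_def)

lemma square_flip: "square X x y z w \<Longrightarrow> square X x w z y"
  by (auto simp: square_def insert_commute)

lemma square_rotate: "square X x y z w \<Longrightarrow> square X y z w x"
  by (auto simp: square_def insert_commute adjacent_sym)

lemma square_reverse: "square X x y z w \<Longrightarrow> square X z y x w"
  by (blast intro: square_flip square_rotate)

lemma edges_iff_adjacent: "{a, b} \<in> edges X \<longleftrightarrow> adjacent X a b"
  by (auto simp: edges_def adjacent_def card_2_iff doubleton_eq_iff)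

lemma atLeastAtMost_insert: "{P..insert i P} = {P, insert i P}"
  by auto

text \<open>The interval is the 2-face through \<open>S\<close> in the directions \<open>i\<close>
  and \<open>j\<close>. Symmetric differences name its corners without a case split on whether
  \<open>i\<close> and \<open>j\<close> belong to \<open>S\<close>.\<close>

lemma atLeastAtMost_two:
  fixes S :: "'a set"
  assumes "i \<noteq> j"
  shows "{S - {i, j}..S \<union> {i, j}} = {S, sym_diff S {i}, sym_diff S {j}, sym_diff S {i, j}}"
    (is "?L = ?R")
proof
  show "?L \<subseteq> ?R"
  proof
    fix T assume T: "T \<in> ?L"
    have *: "k \<in> T \<longleftrightarrow> k \<in> S" if "k \<noteq> i" "k \<noteq> j" for k
      using T that by auto
    have eqI: "T = S'" if "i \<in> T \<longleftrightarrow> i \<in> S'" "j \<in> T \<longleftrightarrow> j \<in> S'"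
      "\<And>k. k \<noteq> i \<Longrightarrow> k \<noteq> j \<Longrightarrow> k \<in> S \<longleftrightarrow> k \<in> S'" for S'
      using that * by (metis subsetI subset_antisym)
    show "T \<in> ?R"
    proof (cases "i \<in> T \<longleftrightarrow> i \<in> S"; cases "j \<in> T \<longleftrightarrow> j \<in> S")
      assume "i \<in> T \<longleftrightarrow> i \<in> S" "j \<in> T \<longleftrightarrow> j \<in> S"
      then have "T = S" by (intro eqI) auto
      then show ?thesis by simp
    next
      assume "i \<in> T \<longleftrightarrow> i \<in> S" "\<not> (j \<in> T \<longleftrightarrow> j \<in> S)"
      then have "T = sym_diff S {j}" using assms by (intro eqI) auto
      then show ?thesis by simp
    next
      assume "\<not> (i \<in> T \<longleftrightarrow> i \<in> S)" "j \<in> T \<longleftrightarrow> j \<in> S"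
      then have "T = sym_diff S {i}" using assms by (intro eqI) auto
      then show ?thesis by simp
    next
      assume "\<not> (i \<in> T \<longleftrightarrow> i \<in> S)" "\<not> (j \<in> T \<longleftrightarrow> j \<in> S)"
      then have "T = sym_diff S {i, j}" using assms by (intro eqI) auto
      then show ?thesis by simp
    qed
  qed
qed auto

lemma sym_diff_sym_diff: "sym_diff (sym_diff A B) B = A"
  by auto

section \<open>Cubes labelled from a chosen corner\<close>

lemma cube_complex_cube:
  assumes "cube_complex X" "c \<in> X"
  obtains n :: nat and f where "bij_betw f (Pow {..<n}) c"
    "{d \<in> X. d \<subseteq> c} = {f ` {P..Q} | P Q. P \<subseteq> Q \<and> Q \<subseteq> {..<n}}"
proof -
  have "\<exists>(n::nat) f. bij_betw f (Pow {..<n}) c \<and>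
        {d \<in> X. d \<subseteq> c} = {f ` {P..Q} | P Q. P \<subseteq> Q \<and> Q \<subseteq> {..<n}}"
    using assms(1)[unfolded cube_complex_def, THEN conjunct1] assms(2) by (rule bspec)
  then show ?thesis by (elim exE conjE) (rule that)
qed

text \<open>Taking symmetric differences with a fixed set moves the label \<open>{}\<close> to any
  corner. Adjacency and 2-faces are expressed by symmetric differences because this form survives
  the relabelling.\<close>

definition chart :: "'v set set \<Rightarrow> 'v set \<Rightarrow> nat \<Rightarrow> (nat set \<Rightarrow> 'v) \<Rightarrow> bool" where
  "chart X c n f \<longleftrightarrow> bij_betw f (Pow {..<n}) c \<and>
     (\<forall>S T. S \<subseteq> {..<n} \<longrightarrow> T \<subseteq> {..<n} \<longrightarrow>
       (adjacent X (f S) (f T) \<longleftrightarrow> (\<exists>i<n. T = sym_diff S {i}))) \<and>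
     (\<forall>S i j. S \<subseteq> {..<n} \<longrightarrow> i < n \<longrightarrow> j < n \<longrightarrow> i \<noteq> j \<longrightarrow>
       {f S, f (sym_diff S {i}), f (sym_diff S {j}), f (sym_diff S {i, j})} \<in> X)"

lemma chart_inj: "chart X c n f \<Longrightarrow> inj_on f (Pow {..<n})"
  by (simp add: chart_def bij_betw_def)

lemma chart_image: "chart X c n f \<Longrightarrow> f ` Pow {..<n} = c"
  by (simp add: chart_def bij_betw_def)

lemma chart_adjacent:
  "chart X c n f \<Longrightarrow> S \<subseteq> {..<n} \<Longrightarrow> T \<subseteq> {..<n} \<Longrightarrow>
   adjacent X (f S) (f T) \<longleftrightarrow> (\<exists>i<n. T = sym_diff S {i})"
  by (simp add: chart_def)

lemma card_chart: "chart X c n f \<Longrightarrow> card c = 2 ^ n"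
  unfolding chart_def by (metis bij_betw_same_card card_Pow card_lessThan finite_lessThan)

lemma chart_square:
  assumes f: "chart X c n f" and S: "S \<subseteq> {..<n}" "i < n" "j < n" "i \<noteq> j"
  shows "square X (f S) (f (sym_diff S {i})) (f (sym_diff S {i, j})) (f (sym_diff S {j}))"
proof -
  note inj = chart_inj[OF f] and adj = chart_adjacent[OF f]
  have sub: "sym_diff S {i} \<subseteq> {..<n}" "sym_diff S {j} \<subseteq> {..<n}" "sym_diff S {i, j} \<subseteq> {..<n}"
    using S by auto
  have e1: "sym_diff S {i, j} = sym_diff (sym_diff S {i}) {j}" using S by auto
  have e2: "sym_diff S {i, j} = sym_diff (sym_diff S {j}) {i}" using S by auto
  have "adjacent X (f S) (f (sym_diff S {i}))" "adjacent X (f S) (f (sym_diff S {j}))"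
    using adj S sub by auto
  moreover have "adjacent X (f (sym_diff S {i})) (f (sym_diff S {i, j}))"
    using adj[OF sub(1) sub(3)] e1 S by blast
  moreover have "adjacent X (f (sym_diff S {j})) (f (sym_diff S {i, j}))"
    using adj[OF sub(2) sub(3)] e2 S by blast
  moreover have "f S \<noteq> f (sym_diff S {i, j})"
  proof
    assume "f S = f (sym_diff S {i, j})"
    then have "S = sym_diff S {i, j}" using inj sub S by (auto dest: inj_onD)
    then show False by auto
  qed
  moreover have "f (sym_diff S {i}) \<noteq> f (sym_diff S {j})"
  proof
    assume "f (sym_diff S {i}) = f (sym_diff S {j})"
    then have "sym_diff S {i} = sym_diff S {j}" using inj sub S by (auto dest: inj_onD)
    then show False using S by auto
  qed
  moreover have "{f S, f (sym_diff S {i}), f (sym_diff S {j}), f (sym_diff S {i, j})} \<in> X"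
    using f S by (simp add: chart_def)
  ultimately show ?thesis by (simp add: square_def insert_commute)
qed

lemma chart_neighbour:
  assumes f: "chart X c n f" and w: "w \<in> c" "adjacent X (f {}) w"
  shows "\<exists>i<n. w = f {i}"
proof -
  from w chart_image[OF f] obtain T where T: "T \<subseteq> {..<n}" "w = f T" by blast
  then show ?thesis using chart_adjacent[OF f, of "{}" T] w by auto
qed

lemma cube_chart:
  assumes X: "cube_complex X" and c: "c \<in> X" and v: "v \<in> c"
  obtains n f where "chart X c n f" "f {} = v"
proof -
  obtain n :: nat and f0 where bij0: "bij_betw f0 (Pow {..<n}) c"
    and faces: "{d \<in> X. d \<subseteq> c} = {f0 ` {P..Q} | P Q. P \<subseteq> Q \<and> Q \<subseteq> {..<n}}"
    using X c by (rule cube_complex_cube)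
  have inj: "inj_on f0 (Pow {..<n})" and img: "f0 ` Pow {..<n} = c"
    using bij0 by (auto simp: bij_betw_def)
  from v img obtain S0 where S0: "S0 \<subseteq> {..<n}" "f0 S0 = v" by auto
  \<comment> \<open>\<open>S0\<close> is the label of \<open>v\<close>; translating by it gives
    \<open>v\<close> the label \<open>{}\<close>.\<close>
  define f where "f S = f0 (sym_diff S S0)" for S
  have bijs: "bij_betw (\<lambda>S. sym_diff S S0) (Pow {..<n}) (Pow {..<n})"
  proof (rule bij_betw_byWitness[where f' = "\<lambda>S. sym_diff S S0"])
    show "\<forall>S\<in>Pow {..<n}. sym_diff (sym_diff S S0) S0 = S" using sym_diff_sym_diff by blast
    show "\<forall>S\<in>Pow {..<n}. sym_diff (sym_diff S S0) S0 = S" using sym_diff_sym_diff by blast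
  qed (use S0(1) in blast)+
  have bij: "bij_betw f (Pow {..<n}) c"
    using bij_betw_trans[OF bijs bij0] unfolding f_def comp_def .
  have sub: "f0 ` {P..Q} \<in> X" if "P \<subseteq> Q" "Q \<subseteq> {..<n}" for P Q
    using faces that by blast
  have adj0: "adjacent X (f0 S) (f0 T) \<longleftrightarrow> (\<exists>i<n. T = sym_diff S {i})"
    if ST: "S \<subseteq> {..<n}" "T \<subseteq> {..<n}" for S T
  proof
    assume a: "adjacent X (f0 S) (f0 T)"
    then have "{f0 S, f0 T} \<in> {d \<in> X. d \<subseteq> c}"
      using img ST by (auto simp: adjacent_def)
    then obtain P Q where PQ: "P \<subseteq> Q" "Q \<subseteq> {..<n}" "f0 ` {S, T} = f0 ` {P..Q}"
      unfolding faces by auto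
    have eq: "{S, T} = {P..Q}"
      by (rule inj_on_image_eq_iff[OF inj, THEN iffD1, OF _ _ PQ(3)]) (use ST PQ in \<open>auto simp: subset_iff\<close>)
    have "S \<noteq> T" using a by (auto simp: adjacent_def)
    have PQ': "{P, Q} \<subseteq> {S, T}" using eq PQ(1) by simp
    have "P \<noteq> Q"
      using eq \<open>S \<noteq> T\<close> by (metis atLeastAtMost_singleton insertI1 insert_iff singletonD)
    then obtain i where i: "i \<in> Q" "i \<notin> P" using PQ(1) by blast
    \<comment> \<open>This set lies between \<open>P\<close> and \<open>Q\<close> in an interval
      with only two elements; as it differs from \<open>P\<close>, it must be
      \<open>Q\<close>.\<close>
    have "insert i P \<in> {S, T}" using eq i PQ(1) by auto
    then have Q: "Q = insert i P" using PQ' \<open>P \<noteq> Q\<close> i by auto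
    have "(S = P \<and> T = Q) \<or> (S = Q \<and> T = P)" using PQ' \<open>P \<noteq> Q\<close> by auto
    then have "T = sym_diff S {i}" using Q i by auto
    moreover have "i < n" using i PQ by auto
    ultimately show "\<exists>i<n. T = sym_diff S {i}" by blast
  next
    assume "\<exists>i<n. T = sym_diff S {i}"
    then obtain i where i: "i < n" "T = sym_diff S {i}" by blast
    have "{S, T} = {S - {i}..insert i S}"
      using i atLeastAtMost_insert[of "S - {i}" i] by (cases "i \<in> S") auto
    then have "f0 ` {S, T} \<in> X" using sub[of "S - {i}" "insert i S"] ST i by auto
    moreover have "S \<noteq> T" using i by auto
    then have "f0 S \<noteq> f0 T" using inj ST by (auto dest: inj_onD)
    ultimately show "adjacent X (f0 S) (f0 T)" by (simp add: adjacent_def)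
  qed
  have sq0: "{f0 S, f0 (sym_diff S {i}), f0 (sym_diff S {j}), f0 (sym_diff S {i, j})} \<in> X"
    if "S \<subseteq> {..<n}" "i < n" "j < n" "i \<noteq> j" for S i j
    using sub[of "S - {i, j}" "S \<union> {i, j}"] that unfolding atLeastAtMost_two[OF \<open>i \<noteq> j\<close>] by auto
  have com: "sym_diff (sym_diff S T) S0 = sym_diff (sym_diff S S0) T" for S T by auto
  have in_n: "sym_diff S S0 \<subseteq> {..<n}" if "S \<subseteq> {..<n}" for S using that S0 by auto
  have "adjacent X (f S) (f T) \<longleftrightarrow> (\<exists>i<n. T = sym_diff S {i})"
    if "S \<subseteq> {..<n}" "T \<subseteq> {..<n}" for S T
  proof -
    have "sym_diff T S0 = sym_diff (sym_diff S S0) {i} \<longleftrightarrow> T = sym_diff S {i}" for i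
      using com[of S "{i}"] sym_diff_sym_diff[of T S0] sym_diff_sym_diff[of "sym_diff S {i}" S0]
      by metis
    then show ?thesis unfolding f_def using adj0[OF in_n in_n, OF that] by simp
  qed
  moreover have "{f S, f (sym_diff S {i}), f (sym_diff S {j}), f (sym_diff S {i, j})} \<in> X"
    if "S \<subseteq> {..<n}" "i < n" "j < n" "i \<noteq> j" for S i j
    unfolding f_def com using sq0[OF in_n[OF that(1)] that(2-4)] .
  ultimately have "chart X c n f" using bij unfolding chart_def by blast
  moreover have "f {} = v" using S0 by (simp add: f_def)
  ultimately show ?thesis by (rule that)
qed

section \<open>Squares, links and the flag condition\<close>

lemma card_cube: assumes "cube_complex X" "c \<in> X" shows "\<exists>n. card c = 2 ^ n"
proof -
  obtain n :: nat and f where "bij_betw f (Pow {..<n}) c"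
    using assms by (rule cube_complex_cube)
  then have "card c = 2 ^ n" by (metis bij_betw_same_card card_Pow card_lessThan finite_lessThan)
  then show ?thesis ..
qed

lemma cube_nonempty: assumes "cube_complex X" "c \<in> X" shows "c \<noteq> {}"
  using card_cube[OF assms] by auto

text \<open>Squares with different fourth corners would meet in three vertices, and the number of
  vertices of a cube is a power of two.\<close>

lemma square_unique:
  assumes X: "cube_complex X" and s: "square X x y z w" "square X x y z' w"
  shows "z = z'"
proof (rule ccontr)
  assume "z \<noteq> z'"
  have ne: "x \<noteq> y" "x \<noteq> w" "y \<noteq> w" "z' \<noteq> x" "z' \<noteq> y" "z' \<noteq> w"
    using s by (auto simp: square_def adjacent_def)
  have "{x, y, z, w} \<inter> {x, y, z', w} = {x, y, w}" using \<open>z \<noteq> z'\<close> ne by auto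
  moreover have "{x, y, z, w} \<in> X" "{x, y, z', w} \<in> X" using s by (simp_all add: square_def)
  ultimately have "{x, y, w} \<in> X"
    using X[unfolded cube_complex_def, THEN conjunct2, rule_format, of "{x, y, z, w}" "{x, y, z', w}"]
    by simp
  then obtain n where "card {x, y, w} = 2 ^ n" using card_cube[OF X] by blast
  then have n: "2 ^ n = (3::nat)" using ne by simp
  then have "n \<noteq> 0" by (intro notI) simp
  then have "even ((2::nat) ^ n)" by simp
  then show False unfolding n by simp
qed

text \<open>The point is that the diagonal is not an edge: a 2-dimensional cube has two directions
  at \<open>v\<close>, which cannot accommodate three distinct neighbours.\<close>

lemma square_link:
  assumes X: "cube_complex X" and s: "square X v a p b"
  shows "{a, b} \<in> link X v"
proof -
  let ?c = "{v, a, p, b}"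
  have c: "?c \<in> X" "v \<in> ?c" using s by (auto simp: square_def)
  have ne: "v \<noteq> a" "v \<noteq> p" "v \<noteq> b" "a \<noteq> p" "a \<noteq> b" "p \<noteq> b"
    using s by (auto simp: square_def adjacent_def)
  obtain n f where f: "chart X ?c n f" "f {} = v"
    using X c by (rule cube_chart)
  have "2 ^ n = (2::nat) ^ 2" using ne card_chart[OF f(1)] by simp
  then have n: "n = 2" using power_inject_exp[of "2::nat" n 2] by simp
  have nbr: "\<exists>i<2. w = f {i}" if "w \<in> ?c" "adjacent X v w" for w
    using chart_neighbour[OF f(1)] that f(2) n by blast
  have "\<not> adjacent X v p"
  proof
    assume "adjacent X v p"
    then obtain i where i: "i < 2" "p = f {i}" using nbr by blast
    obtain j where j: "j < 2" "a = f {j}" using nbr s by (auto simp: square_def)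
    obtain k where k: "k < 2" "b = f {k}" using nbr s by (auto simp: square_def)
    have "i \<noteq> j" "i \<noteq> k" "j \<noteq> k" using i j k ne by auto
    then show False using i j k by auto
  qed
  then have "{w \<in> ?c. adjacent X v w} = {a, b}"
    using s by (auto simp: square_def adjacent_irrefl)
  then show ?thesis unfolding link_def using c by blast
qed

lemma edge_link:
  assumes "adjacent X v a" shows "{a} \<in> link X v"
proof -
  have "{w \<in> {v, a}. adjacent X v w} = {a}" using assms by (auto simp: adjacent_def)
  then show ?thesis unfolding link_def using assms by (auto simp: adjacent_def)
qed

lemma flag_cube:
  assumes X: "cube_complex X" and fl: "flag (link X v)" and N: "finite N"
    and adj: "\<And>a. a \<in> N \<Longrightarrow> adjacent X v a"
    and sq: "\<And>a b. a \<in> N \<Longrightarrow> b \<in> N \<Longrightarrow> a \<noteq> b \<Longrightarrow> \<exists>p. square X v a p b"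
    and v: "v \<in> \<Union>X"
  shows "\<exists>c\<in>X. v \<in> c \<and> {w \<in> c. adjacent X v w} = N"
proof -
  have "{a, b} \<in> link X v" if "a \<in> N" "b \<in> N" for a b
    using that sq[OF that] square_link[OF X] edge_link[OF adj] by (cases "a = b") auto
  moreover have "N \<subseteq> \<Union>(link X v)" using edge_link[OF adj] by blast
  ultimately have "N \<in> link X v" using fl N unfolding flag_def by blast
  then show ?thesis unfolding link_def by blast
qed

text \<open>The flag condition supplies a cube whose directions at \<open>v\<close> are exactly
  \<open>a\<close>, \<open>b\<close> and \<open>c\<close>. Uniqueness of fourth corners identifies
  the given squares with its faces, and \<open>u\<close> is the corner opposite to
  \<open>v\<close>.\<close>

lemma three_cube:
  assumes X: "cube_complex X" and fl: "flag (link X v)"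
    and s: "square X v a p b" "square X v b q c" "square X v a r c"
  shows "\<exists>u. square X a p u r \<and> square X b p u q \<and> square X c q u r"
proof -
  have ne: "a \<noteq> b" "b \<noteq> c" "a \<noteq> c" and av: "adjacent X v a" "adjacent X v b" "adjacent X v c"
    using s by (auto simp: square_def)
  have pair: "\<exists>p. square X v a' p b'" if "a' \<in> {a, b, c}" "b' \<in> {a, b, c}" "a' \<noteq> b'" for a' b'
    using that s square_flip[OF s(1)] square_flip[OF s(2)] square_flip[OF s(3)] by auto
  have "\<exists>C\<in>X. v \<in> C \<and> {w \<in> C. adjacent X v w} = {a, b, c}"
    by (rule flag_cube[OF X fl _ _ pair]) (use av adjacent_vertex[OF av(1)] in auto)
  then obtain C where C: "C \<in> X" "v \<in> C" "{w \<in> C. adjacent X v w} = {a, b, c}" by blast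
  obtain n f where f: "chart X C n f" "f {} = v"
    using X C(1,2) by (rule cube_chart)
  have nbr: "\<exists>i<n. w = f {i}" if "w \<in> C" "adjacent X v w" for w
    using chart_neighbour[OF f(1)] that f(2) by blast
  note SQ = chart_square[OF f(1)]
  obtain i where i: "i < n" "a = f {i}" using nbr C av by blast
  obtain j where j: "j < n" "b = f {j}" using nbr C av by blast
  obtain k where k: "k < n" "c = f {k}" using nbr C av by blast
  have ijk: "i \<noteq> j" "j \<noteq> k" "i \<noteq> k" using i j k ne by auto
  have p: "p = f {i, j}" using SQ[of "{}" i j] i j ijk f s(1) square_unique[OF X] by auto
  have q: "q = f {j, k}" using SQ[of "{}" j k] k j ijk f s(2) square_unique[OF X] by auto
  have r: "r = f {i, k}" using SQ[of "{}" i k] k i ijk f s(3) square_unique[OF X] by auto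
  have eqs: "{i} - {j} \<union> ({j} - {i}) = {i, j}" "{i} - {k} \<union> ({k} - {i}) = {i, k}"
     "{i} - {j, k} \<union> ({j, k} - {i}) = {i, j, k}"
     "{j} - {i} \<union> ({i} - {j}) = {i, j}" "{j} - {k} \<union> ({k} - {j}) = {j, k}"
     "{j} - {i, k} \<union> ({i, k} - {j}) = {i, j, k}"
     "{k} - {j} \<union> ({j} - {k}) = {j, k}" "{k} - {i} \<union> ({i} - {k}) = {i, k}"
     "{k} - {j, i} \<union> ({j, i} - {k}) = {i, j, k}"
    using ijk by auto
  have "square X a p (f {i, j, k}) r" using SQ[of "{i}" j k] i j k p r ijk eqs by simp
  moreover have "square X b p (f {i, j, k}) q" using SQ[of "{j}" i k] i j k p q ijk eqs by simp
  moreover have "square X c q (f {i, j, k}) r" using SQ[of "{k}" j i] i j k q r ijk eqs by simp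
  ultimately show ?thesis by blast
qed

section \<open>Edge paths modulo squares\<close>

lemma square_rotate3: "square X x y z w \<Longrightarrow> square X w x y z"
  by (blast intro: square_rotate)

text \<open>Exchanges preserve the length of a path, whereas homotopies may also delete backtracks.
  The two moves are kept apart so that reducedness can be defined modulo exchanges.\<close>

inductive swap :: "'v set set \<Rightarrow> 'v list \<Rightarrow> 'v list \<Rightarrow> bool" for X where
  swap_here: "square X x y z w \<Longrightarrow> swap X (x # y # z # q) (x # w # z # q)"
| swap_there: "swap X p q \<Longrightarrow> swap X (x # p) (x # q)"

abbreviation swaps :: "'v set set \<Rightarrow> 'v list \<Rightarrow> 'v list \<Rightarrow> bool" where
  "swaps X \<equiv> (swap X)\<^sup>*\<^sup>*"

inductive backtracks :: "'v list \<Rightarrow> bool" where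
  backtracks_here: "backtracks (x # y # x # q)"
| backtracks_there: "backtracks p \<Longrightarrow> backtracks (x # p)"

definition reduced :: "'v set set \<Rightarrow> 'v list \<Rightarrow> bool" where
  "reduced X p \<longleftrightarrow> (\<forall>q. swaps X p q \<longrightarrow> \<not> backtracks q)"

lemma swap_sym: "swap X p q \<Longrightarrow> swap X q p"
  by (induction rule: swap.induct) (auto intro: swap.intros square_flip)

lemma swaps_sym: "swaps X p q \<Longrightarrow> swaps X q p"
  using symp_rtranclp[of "swap X"] swap_sym by (metis sympD sympI)

lemma swaps_Cons: "swaps X p q \<Longrightarrow> swaps X (x # p) (x # q)"
  by (induction rule: rtranclp_induct) (auto intro: swap_there rtranclp.rtrancl_into_rtrancl)

lemma swaps_square: "square X x y z w \<Longrightarrow> swaps X (x # y # z # q) (x # w # z # q)"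
  by (blast intro: swap_here)

lemma swap_length: "swap X p q \<Longrightarrow> length p = length q"
  by (induction rule: swap.induct) auto

lemma swaps_length: "swaps X p q \<Longrightarrow> length p = length q"
  by (induction rule: rtranclp_induct) (auto dest: swap_length)

lemma swap_hd: "swap X p q \<Longrightarrow> hd p = hd q"
  by (induction rule: swap.induct) auto

lemma swaps_hd: "swaps X p q \<Longrightarrow> hd p = hd q"
  by (induction rule: rtranclp_induct) (auto dest: swap_hd)

lemma swap_ne: "swap X p q \<Longrightarrow> p \<noteq> [] \<and> q \<noteq> []"
  by (induction rule: swap.induct) auto

lemma swap_last: "swap X p q \<Longrightarrow> last p = last q"
  by (induction rule: swap.induct) (auto dest: swap_ne)

lemma swaps_last: "swaps X p q \<Longrightarrow> last p = last q"
  by (induction rule: rtranclp_induct) (auto dest: swap_last)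

lemma swap_Cons_cases:
  assumes "swap X (x # c # s) m"
  obtains (here) z s' w where "s = z # s'" "m = x # w # z # s'" "square X x c z w"
  | (there) m' where "m = x # m'" "swap X (c # s) m'"
  using assms by (cases rule: swap.cases) auto

lemma swaps_ConsD: "swaps X (x # y # p) m \<Longrightarrow> \<exists>y' q. m = x # y' # q"
  using swaps_length[of X "x # y # p" m] swaps_hd[of X "x # y # p" m]
  by (cases m; cases "tl m") auto

lemma edge_path_Cons:
  "edge_path X (x # y # p) \<longleftrightarrow> adjacent X x y \<and> edge_path X (y # p)"
  by (auto simp: edge_path_def adjacent_def)

lemma edge_path_single: "edge_path X [x] \<longleftrightarrow> x \<in> \<Union>X"
  by (auto simp: edge_path_def)

lemma edge_path_tl: "edge_path X (x # p) \<Longrightarrow> p \<noteq> [] \<Longrightarrow> edge_path X p"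
  by (cases p) (auto simp: edge_path_Cons)

lemma swap_edge_path: "swap X p q \<Longrightarrow> edge_path X p \<Longrightarrow> edge_path X q"
proof (induction rule: swap.induct)
  case (swap_here x y z w q)
  then show ?case by (cases q) (auto simp: edge_path_Cons edge_path_single square_def)
next
  case (swap_there p q x)
  have ne: "p \<noteq> []" "q \<noteq> []" using swap_ne[OF swap_there(1)] by auto
  have "hd p = hd q" using swap_hd[OF swap_there(1)] .
  then show ?case using swap_there ne
    by (cases p; cases q) (auto simp: edge_path_Cons)
qed

lemma swaps_edge_path: "swaps X p q \<Longrightarrow> edge_path X p \<Longrightarrow> edge_path X q"
  by (induction rule: rtranclp_induct) (auto dest: swap_edge_path)

lemma reduced_swaps: "swaps X p q \<Longrightarrow> reduced X p \<longleftrightarrow> reduced X q"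
  unfolding reduced_def by (meson rtranclp_trans swaps_sym)

lemma reduced_tl: "reduced X (x # p) \<Longrightarrow> reduced X p"
  unfolding reduced_def by (meson swaps_Cons backtracks_there)

lemma not_reduced_backtrack: "swaps X p (x # y # x # q) \<Longrightarrow> \<not> reduced X p"
  unfolding reduced_def by (blast intro: backtracks_here)

lemma reduced_single: "reduced X [x]"
proof -
  have "\<not> backtracks q" if "length q \<le> 1" for q :: "'a list"
  proof
    assume "backtracks q" then have "length q \<ge> 2" by induction auto
    then show False using that by simp
  qed
  then show ?thesis unfolding reduced_def by (metis length_Cons list.size(3) One_nat_def le_refl swaps_length)
qed

locale cat0_complex =
  fixes X :: "'v set set"
  assumes cat0: "cat0_cube_complex X"
begin

lemma cubes: "cube_complex X" and flag_link: "v \<in> \<Union>X \<Longrightarrow> flag (link X v)"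
  and simply_connected: "simply_connected_complex X"
  using cat0 by (auto simp: cat0_cube_complex_def)

lemmas square_unique = square_unique[OF cubes]

text \<open>The form in which \<open>three_cube\<close> is used when two exchanges overlap along a
  path; \<open>u\<close> is the corner opposite to \<open>c\<close>.\<close>

lemma cube_at:
  assumes "square X x y z c" "square X x c z' y'" "square X c z' w z" "z \<noteq> z'"
  shows "\<exists>u. square X x y u y' \<and> square X y u w z \<and> square X y' u w z'"
proof -
  have "c \<in> \<Union>X" using assms by (auto simp: square_def dest: adjacent_vertex)
  moreover have "square X c x y z" using assms(1) by (rule square_rotate3)
  moreover have "square X c x y' z'" using assms(2)[THEN square_rotate] by (rule square_flip)
  moreover have "square X c z w z'" using assms(3) by (rule square_flip)
  ultimately obtain u where u: "square X x y u y'" "square X z y u w" "square X z' w u y'"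
    using three_cube[OF cubes flag_link] by blast
  moreover have "square X y u w z" using u(2) by (rule square_rotate)
  moreover have "square X y' u w z'" using u(3)[THEN square_flip] by (rule square_rotate)
  ultimately show ?thesis by blast
qed

text \<open>Garside's lemma: in the category of edge paths modulo \<^const>\<open>swap\<close>, two edges with a common
  multiple have a least one, given by the square they span.\<close>

lemma swaps_diamond:
  "swaps X (x # y # p) (x # y' # q) \<Longrightarrow>
   (y = y' \<and> swaps X (y # p) (y' # q)) \<or>
   (\<exists>z r. square X x y z y' \<and> swaps X (y # p) (y # z # r) \<and> swaps X (y' # q) (y' # z # r))"
proof (induction "length p" arbitrary: x y y' p q rule: less_induct)
  case less
  let ?C = "\<lambda>y' q. (y = y' \<and> swaps X (y # p) (y' # q)) \<or>
   (\<exists>z r. square X x y z y' \<and> swaps X (y # p) (y # z # r) \<and> swaps X (y' # q) (y' # z # r))"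
  \<comment> \<open>An inner induction along the exchanges moves the second path while the first
    stays fixed. The outer induction on the length is called when an exchange replaces the second
    vertex.\<close>
  have "\<forall>y' q. m = x # y' # q \<longrightarrow> ?C y' q" if "swaps X (x # y # p) m" for m
    using that
  proof (induction rule: rtranclp_induct)
    case base then show ?case by simp
  next
    case (step m m')
    obtain c s where m: "m = x # c # s" using swaps_ConsD[OF step(1)] by blast
    have C: "?C c s" using step.IH m by simp
    have len: "length s = length p" using swaps_length[OF step(1)] m by simp
    show ?case
    proof (intro allI impI)
      fix y' q assume m': "m' = x # y' # q"
      show "?C y' q"
        using step(2) unfolding m
      proof (cases rule: swap_Cons_cases)
        case (there m'')
        then have y': "y' = c" and sw: "swap X (c # s) (y' # q)"
          using m' swap_hd[OF there(2)] by auto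
        then have sw': "swaps X (y' # q) (c # s)" using swap_sym by blast
        from C show ?thesis
        proof (elim disjE exE conjE)
          assume "y = c" "swaps X (y # p) (c # s)"
          then show ?thesis using sw y' by (auto intro: rtranclp.rtrancl_into_rtrancl)
        next
          fix z r assume "square X x y z c" "swaps X (y # p) (y # z # r)" "swaps X (c # s) (c # z # r)"
          then show ?thesis using sw' y' rtranclp_trans by metis
        qed
      next
        case (here z' s' w)
        then have s: "s = z' # s'" "q = z' # s'" and sq: "square X x c z' y'" using m' by auto
        from C show ?thesis
        proof (elim disjE exE conjE)
          assume "y = c" "swaps X (y # p) (c # s)"
          then show ?thesis using s sq by auto
        next
          fix z r assume z: "square X x y z c" "swaps X (y # p) (y # z # r)"
            "swaps X (c # s) (c # z # r)"
          have "length s' < length p" using len s by simp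
          from less.hyps[OF this, of c z' z r] z(3) s
          consider "z' = z" "swaps X (z' # s') (z # r)"
            | u r' where "square X c z' u z" "swaps X (z' # s') (z' # u # r')" "swaps X (z # r) (z # u # r')"
            by auto
          then show ?thesis
          proof cases
            case 1
            have "square X c z y x" using z(1)[THEN square_flip] by (rule square_rotate)
            moreover have "square X c z y' x" using sq[THEN square_rotate] 1 by simp
            ultimately have "y = y'" by (rule square_unique)
            have "swaps X (y # z # r) (y' # q)"
              using 1 s \<open>y = y'\<close> swaps_Cons swaps_sym by metis
            then show ?thesis using z(2) \<open>y = y'\<close> rtranclp_trans by metis
          next
            case (2 w r')
            \<comment> \<open>The squares spanned at \<open>c\<close> by \<open>x\<close>,
              \<open>z\<close> and \<open>z'\<close> bound a cube. Both paths can be pushed through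
              its corner \<open>u\<close> opposite to \<open>c\<close>, and \<open>u\<close>
              completes the square spanned by \<open>y\<close> and \<open>y'\<close>.\<close>
            have "z \<noteq> z'" using 2(1) by (auto simp: square_def)
            then obtain u where u: "square X x y u y'" "square X y u w z" "square X y' u w z'"
              using cube_at[OF z(1) sq 2(1)] by blast
            have "swaps X (y # p) (y # u # w # r')"
              using z(2) swaps_Cons[OF 2(3), of y] swaps_square[OF square_flip[OF u(2)], of r']
              by (meson rtranclp_trans)
            moreover have "swaps X (y' # q) (y' # u # w # r')"
              using s(2) swaps_Cons[OF 2(2), of y'] swaps_square[OF square_flip[OF u(3)], of r']
              by (metis rtranclp_trans)
            ultimately show ?thesis using u(1) by blast
          qed
        qed
      qed
    qed
  qed
  then show ?case using less.prems by blast
qed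

text \<open>The square alternative of \<open>swaps_diamond\<close> would need two different second
  vertices.\<close>

lemma swaps_Cons_cancel: "swaps X (x # y # p) (x # y # q) \<Longrightarrow> swaps X (y # p) (y # q)"
  using swaps_diamond[of x y p y q] by (auto simp: square_def)

text \<open>A backtracking representative is compared with the original path by
  \<open>swaps_diamond\<close>. Either the new edge is undone at once, or the two paths part along a
  square, and then the same question arises for a shorter path across that square.\<close>

lemma not_reduced_Cons:
  "\<lbrakk>reduced X (x # p); \<not> reduced X (x' # x # p)\<rbrakk> \<Longrightarrow> \<exists>p'. swaps X (x # p) (x # x' # p')"
proof (induction "length p" arbitrary: x x' p rule: less_induct)
  case less
  from less.prems(2) obtain m where m: "swaps X (x' # x # p) m" "backtracks m"
    unfolding reduced_def by blast
  obtain c s where cs: "m = x' # c # s" using swaps_ConsD[OF m(1)] by blast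
  from swaps_diamond[OF m(1)[unfolded cs]] show ?case
  proof (elim disjE exE conjE)
    assume c: "x = c" "swaps X (x # p) (c # s)"
    from m(2)[unfolded cs] show ?thesis
    proof cases
      case (backtracks_here q)
      then show ?thesis using c by auto
    next
      case backtracks_there
      then show ?thesis using c less.prems(1) unfolding reduced_def by blast
    qed
  next
    fix z r assume z: "square X x' x z c" "swaps X (x # p) (x # z # r)" "swaps X (c # s) (c # z # r)"
    have zr: "reduced X (x # z # r)" using less.prems(1) z(2) reduced_swaps by blast
    from m(2)[unfolded cs] show ?thesis
    proof cases
      case (backtracks_here q)
      \<comment> \<open>Backtracking at once on the other side of the square is impossible: the
        diamond at \<open>c\<close> closes up at \<open>x\<close> and would make the reduced path
        \<open>x # z # r\<close> backtrack.\<close>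
      then have "swaps X (c # x' # q) (c # z # r)" using z(3) by simp
      moreover have "x' \<noteq> z" using z(1) by (auto simp: square_def)
      ultimately obtain w r' where w: "square X c x' w z" "swaps X (z # r) (z # w # r')"
        using swaps_diamond by blast
      have "w = x" using square_unique[OF w(1) square_rotate3[OF z(1)]] .
      then have "swaps X (x # z # r) (x # z # x # r')" using swaps_Cons[OF w(2), of x] \<open>w = x\<close> by simp
      then have "\<not> reduced X (x # z # r)" by (rule not_reduced_backtrack)
      with zr show ?thesis by blast
    next
      case backtracks_there
      then have "\<not> reduced X (c # z # r)"
        using z(3) swaps_sym unfolding reduced_def by blast
      moreover have "length r < length p" using swaps_length[OF z(2)] by simp
      ultimately obtain r' where "swaps X (z # r) (z # c # r')"
        using less.hyps[of r z c] reduced_tl[OF zr] by blast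
      from rtranclp_trans[OF z(2) swaps_Cons[OF this]] have "swaps X (x # p) (x # z # c # r')" .
      moreover have "swaps X (x # z # c # r') (x # x' # c # r')"
        using z(1)[THEN square_rotate] by (rule swaps_square)
      ultimately show ?thesis using rtranclp_trans by metis
    qed
  qed
qed

end

section \<open>Reduced paths are geodesics\<close>

context cat0_complex
begin

definition reduced_path :: "'v list \<Rightarrow> bool" where
  "reduced_path p \<longleftrightarrow> reduced X p \<and> edge_path X p"

text \<open>The edges act on swap classes of reduced paths: an edge is prepended, or cancelled when the
  path can be made to start with its inverse.\<close>

definition step :: "'v \<Rightarrow> 'v list \<Rightarrow> 'v list" where
  "step x q = (if reduced X (x # q) then x # q
     else x # (SOME r. swaps X q (hd q # x # r)))"

lemma reduced_path_swaps: "swaps X p q \<Longrightarrow> reduced_path p \<Longrightarrow> reduced_path q"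
  using reduced_swaps swaps_edge_path unfolding reduced_path_def by blast

lemma reduced_path_tl: "reduced_path (x # y # p) \<Longrightarrow> reduced_path (y # p)"
  using reduced_tl[of X x "y # p"] by (simp add: reduced_path_def edge_path_Cons)

lemma reduced_path_Cons: assumes "reduced_path q" obtains z s where "q = z # s"
  using assms that by (cases q) (auto simp: reduced_path_def edge_path_def)

text \<open>Left cancellation determines \<open>x # r\<close> up to exchanges, so the choice made in
  \<open>step\<close> is harmless and any witness of a cancellation may be used.\<close>

lemma step_eqI:
  assumes q: "reduced_path q" and r: "swaps X q (hd q # x # r)"
  shows "swaps X (step x q) (x # r)" and "\<not> reduced X (x # q)"
proof -
  have "swaps X (x # q) (x # hd q # x # r)" using r by (rule swaps_Cons)
  then show nr: "\<not> reduced X (x # q)" by (rule not_reduced_backtrack)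
  define r' where "r' = (SOME r. swaps X q (hd q # x # r))"
  have r': "swaps X q (hd q # x # r')" unfolding r'_def using r by (rule someI)
  have "swaps X (hd q # x # r') (hd q # x # r)"
    using swaps_sym[OF r'] r by (rule rtranclp_trans)
  then have "swaps X (x # r') (x # r)" by (rule swaps_Cons_cancel)
  then show "swaps X (step x q) (x # r)" using nr by (simp add: step_def r'_def)
qed

lemma step_cancel:
  assumes q: "reduced_path q" and nr: "\<not> reduced X (x # q)"
  obtains r where "step x q = x # r" "swaps X q (hd q # x # r)"
proof -
  obtain z s where s: "q = z # s" using q by (rule reduced_path_Cons)
  have "reduced X (z # s)" "\<not> reduced X (x # z # s)"
    using q nr s by (auto simp: reduced_path_def)
  then obtain r where "swaps X q (hd q # x # r)" using not_reduced_Cons s by fastforce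
  then have "swaps X q (hd q # x # (SOME r. swaps X q (hd q # x # r)))" by (rule someI)
  then show ?thesis using that nr by (simp add: step_def)
qed

lemma step_prepend: "reduced X (x # q) \<Longrightarrow> step x q = x # q"
  by (simp add: step_def)

lemma step_reduced_path:
  assumes q: "reduced_path q" and a: "adjacent X x (hd q)"
  shows "reduced_path (step x q) \<and> hd (step x q) = x \<and> last (step x q) = last q \<and>
    (length (step x q) = Suc (length q) \<or> length q = Suc (length (step x q)))"
proof (cases "reduced X (x # q)")
  case True
  obtain z s where "q = z # s" using q by (rule reduced_path_Cons)
  with True show ?thesis using q a by (simp add: reduced_path_def edge_path_Cons step_prepend)
next
  case False
  obtain r where r: "step x q = x # r" "swaps X q (hd q # x # r)"
    using step_cancel[OF q False] by blast
  then have "reduced_path (hd q # x # r)" using reduced_path_swaps q by blast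
  then have "reduced_path (x # r)" by (rule reduced_path_tl)
  moreover have "last (x # r) = last q" using swaps_last[OF r(2)] by simp
  moreover have "length q = Suc (length (x # r))" using swaps_length[OF r(2)] by simp
  ultimately show ?thesis using r(1) by simp
qed

lemma step_cong:
  assumes q: "reduced_path q" and s: "swaps X q q'"
  shows "swaps X (step x q) (step x q')"
proof (cases "reduced X (x # q)")
  case True
  then have "reduced X (x # q')" using reduced_swaps swaps_Cons[OF s] by blast
  then show ?thesis using True swaps_Cons[OF s] by (simp add: step_prepend)
next
  case False
  obtain r where r: "step x q = x # r" "swaps X q (hd q # x # r)"
    using step_cancel[OF q False] by blast
  have "swaps X q' (hd q' # x # r)"
    using rtranclp_trans[OF swaps_sym[OF s] r(2)] swaps_hd[OF s] by simp
  then have "swaps X (step x q') (x # r)" using step_eqI reduced_path_swaps[OF s q] by blast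
  then show ?thesis using r swaps_sym by metis
qed

text \<open>Invariance of the action under the backtrack homotopy.\<close>

lemma step_inverse:
  assumes q: "reduced_path q" and a: "adjacent X x (hd q)"
  shows "swaps X (step (hd q) (step x q)) q"
proof (cases "reduced X (x # q)")
  case True
  obtain z s where s: "q = z # s" using q by (rule reduced_path_Cons)
  have "reduced_path (step x q)" using step_reduced_path[OF q a] by blast
  then show ?thesis using step_eqI(1)[of "x # q" z s] s True by (simp add: step_prepend)
next
  case False
  obtain r where r: "step x q = x # r" "swaps X q (hd q # x # r)"
    using step_cancel[OF q False] by blast
  then have "reduced X (hd q # x # r)" using reduced_path_swaps q reduced_path_def by blast
  then show ?thesis using r swaps_sym by (simp add: step_prepend)
qed

lemma step_step_cancel:
  assumes p: "reduced_path p" and r: "swaps X p (hd p # y # x # r)"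
  shows "swaps X (step x (step y p)) (x # r)"
proof -
  have y: "swaps X (step y p) (y # x # r)" using step_eqI[OF p r] by blast
  have "reduced_path (hd p # y # x # r)" using r p by (rule reduced_path_swaps)
  then have g: "reduced_path (y # x # r)" by (rule reduced_path_tl)
  then have "reduced_path (step y p)" using y swaps_sym reduced_path_swaps by blast
  then have "swaps X (step x (step y p)) (step x (y # x # r))" using y by (rule step_cong)
  moreover have "swaps X (step x (y # x # r)) (x # r)" using step_eqI(1)[OF g] by simp
  ultimately show ?thesis by (rule rtranclp_trans)
qed

text \<open>If \<open>x\<close> cancels against \<open>y # p\<close>, the diamond shows that
  \<open>p\<close> itself can start with the edge to \<open>w\<close>. The route through
  \<open>w\<close> then first cancels and afterwards prepends, with the same result.\<close>

lemma step_square_prepend: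
  assumes p: "reduced_path p" "hd p = z" and sq: "square X x y z w" and yp: "reduced X (y # p)"
  shows "swaps X (step x (step y p)) (step x (step w p))"
proof -
  obtain s where s: "p = z # s" using p by (auto elim: reduced_path_Cons)
  have gyp: "reduced_path (y # p)" using yp p s sq by (auto simp: reduced_path_def edge_path_Cons square_def)
  show ?thesis
  proof (cases "reduced X (x # y # p)")
    case True
    have sw: "swaps X (x # y # p) (x # w # p)" using swaps_square[OF sq] s by simp
    then have "reduced X (x # w # p)" using True reduced_swaps by blast
    then show ?thesis using sw True by (simp add: step_prepend yp reduced_tl[of _ x])
  next
    case False
    obtain r where r: "step x (y # p) = x # r" "swaps X (y # p) (y # x # r)"
      using step_cancel[OF gyp False] by auto
    have "z \<noteq> x" using sq by (auto simp: square_def)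
    then obtain v r' where v: "square X y z v x" "swaps X p (z # v # r')" "swaps X (x # r) (x # v # r')"
      using swaps_diamond[of y z s x r] r(2) s by auto
    have "v = w" using square_unique[OF v(1) square_rotate[OF sq]] .
    have "reduced_path (y # x # r)" using r(2) gyp by (rule reduced_path_swaps)
    then have "reduced_path (x # r)" by (rule reduced_path_tl)
    then have xw: "reduced_path (x # w # r')" using v(3) reduced_path_swaps \<open>v = w\<close> by blast
    have w: "swaps X (step w p) (w # r')" using step_eqI(1)[OF p(1)] v(2) \<open>v = w\<close> p(2) by simp
    have "reduced_path (step w p)" using reduced_path_swaps[OF swaps_sym[OF w] reduced_path_tl[OF xw]] .
    then have "swaps X (step x (step w p)) (step x (w # r'))" using w by (rule step_cong)
    moreover have "step x (w # r') = x # w # r'" using xw by (simp add: step_prepend reduced_path_def)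
    ultimately show ?thesis
      using r(1) v(3) \<open>v = w\<close> swaps_sym rtranclp_trans by (metis step_prepend yp)
  qed
qed

text \<open>Invariance under the square homotopy. When both edges at \<open>z\<close> cancel, the
  diamond lets \<open>p\<close> start along either half of the square, and both routes remove two
  edges.\<close>

lemma step_square:
  assumes p: "reduced_path p" "hd p = z" and sq: "square X x y z w"
  shows "swaps X (step x (step y p)) (step x (step w p))"
proof -
  consider "reduced X (y # p)" | "reduced X (w # p)" | "\<not> reduced X (y # p)" "\<not> reduced X (w # p)"
    by blast
  then show ?thesis
  proof cases
    case 1 then show ?thesis using step_square_prepend[OF p sq] by blast
  next
    case 2 then show ?thesis using step_square_prepend[OF p square_flip[OF sq]] swaps_sym by blast
  next
    case 3
    obtain r1 where r1: "swaps X p (z # y # r1)" using step_cancel[OF p(1) 3(1)] p(2) by blast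
    obtain r2 where r2: "swaps X p (z # w # r2)" using step_cancel[OF p(1) 3(2)] p(2) by blast
    have "swaps X (z # y # r1) (z # w # r2)" using swaps_sym[OF r1] r2 by (rule rtranclp_trans)
    moreover have "y \<noteq> w" using sq by (auto simp: square_def)
    ultimately obtain v r where v: "square X z y v w" "swaps X (y # r1) (y # v # r)"
      "swaps X (w # r2) (w # v # r)" using swaps_diamond by blast
    have "v = x" using square_unique[OF v(1) square_reverse[OF sq]] .
    have "swaps X p (z # y # x # r)" using rtranclp_trans[OF r1 swaps_Cons[OF v(2)]] \<open>v = x\<close> by simp
    moreover have "swaps X p (z # w # x # r)"
      using rtranclp_trans[OF r2 swaps_Cons[OF v(3)]] \<open>v = x\<close> by simp
    ultimately show ?thesis using step_step_cancel[OF p(1)] p(2) swaps_sym rtranclp_trans by metis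
  qed
qed

text \<open>The edges of the path act, from the last one backwards, on the trivial path at its
  endpoint.\<close>

fun normal_form :: "'v list \<Rightarrow> 'v list" where
  "normal_form [] = []"
| "normal_form [x] = [x]"
| "normal_form (x # y # p) = step x (normal_form (y # p))"

text \<open>Each edge changes the length by exactly one; the resulting parity statement is what
  later makes the 1-skeleton bipartite.\<close>

lemma normal_form_reduced_path:
  "edge_path X p \<Longrightarrow> reduced_path (normal_form p) \<and> hd (normal_form p) = hd p \<and> last (normal_form p) = last p \<and>
    length (normal_form p) \<le> length p \<and> even (length (normal_form p) + length p)"
proof (induction p rule: normal_form.induct)
  case 1 then show ?case by (simp add: edge_path_def)
next
  case (2 x) then show ?case by (simp add: reduced_path_def reduced_single)
next
  case (3 x y p)
  then have IH: "reduced_path (normal_form (y # p))" "hd (normal_form (y # p)) = y" "last (normal_form (y # p)) = last (y # p)"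
    "length (normal_form (y # p)) \<le> length (y # p)" "even (length (normal_form (y # p)) + length (y # p))"
    and a: "adjacent X x y" by (auto simp: edge_path_Cons)
  from step_reduced_path[OF IH(1), of x] IH a show ?case by auto
qed

lemma normal_form_reduced: "reduced_path p \<Longrightarrow> normal_form p = p"
proof (induction p rule: normal_form.induct)
  case (3 x y p)
  then show ?case using reduced_path_tl[OF 3(2)] by (simp add: step_prepend reduced_path_def)
qed auto

lemma normal_form_append:
  assumes "swaps X (normal_form s) (normal_form s')" "s \<noteq> []" "s' \<noteq> []" "edge_path X (p @ s)"
  shows "swaps X (normal_form (p @ s)) (normal_form (p @ s'))"
  using assms(4)
proof (induction p)
  case (Cons x p)
  have "edge_path X (p @ s)" using edge_path_tl[of X x "p @ s"] Cons(2) assms by simp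
  then have IH: "swaps X (normal_form (p @ s)) (normal_form (p @ s'))" "reduced_path (normal_form (p @ s))"
    using Cons normal_form_reduced_path by auto
  obtain a b where "p @ s = a # b" using assms by (cases "p @ s") auto
  moreover obtain a' b' where "p @ s' = a' # b'" using assms by (cases "p @ s'") auto
  ultimately show ?case using step_cong[OF IH(2,1), of x] by simp
qed (use assms in simp)

section \<open>Homotopy invariance of normal forms\<close>

lemma edge_path_append:
  "edge_path X (p @ x # q) \<longleftrightarrow> edge_path X (p @ [x]) \<and> edge_path X (x # q)"
  by (auto simp: edge_path_def successively_append_iff)

lemma elementary_homotopy_normal_form:
  assumes h: "elementary_homotopy X p q" and p: "edge_path X p"
  shows "edge_path X q \<and> swaps X (normal_form p) (normal_form q)"
  using h
proof cases
  case (backtrack x y a b)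
  have e: "edge_path X (x # y # x # b)" using p backtrack(1) edge_path_append[of a x "y # x # b"] by simp
  then have e': "edge_path X (x # b)" by (simp add: edge_path_Cons)
  have q: "edge_path X q" 
    using p backtrack(1,2) edge_path_append[of a x b] edge_path_append[of a x "y # x # b"] e' by simp
  have "swaps X (normal_form (x # y # x # b)) (normal_form (x # b))"
  proof (cases b)
    case Nil
    have "x \<in> \<Union>X" using e' by (simp add: edge_path_def)
    then have "reduced_path [x]" by (simp add: reduced_path_def reduced_single edge_path_single)
    from step_inverse[OF this] Nil backtrack(3) show ?thesis by (simp add: adjacent_sym)
  next
    case (Cons c b')
    then show ?thesis
      using step_inverse[of "normal_form (x # b)" y] normal_form_reduced_path[OF e'] backtrack(3) by (simp add: adjacent_sym)
  qed
  then have "swaps X (normal_form (a @ x # y # x # b)) (normal_form (a @ x # b))"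
    by (rule normal_form_append) (use p backtrack in auto)
  then show ?thesis using q backtrack by simp
next
  case (square x y z w a b)
  have sq: "square X x y z w" using square by (auto simp: square_def)
  have e: "edge_path X (x # y # z # b)" using p square(1) edge_path_append[of a x "y # z # b"] by simp
  have e': "edge_path X (z # b)" using e by (simp add: edge_path_Cons)
  have e'': "edge_path X (x # w # z # b)" using e' sq by (simp add: edge_path_Cons square_def)
  have q: "edge_path X q"
    using p square(1,2) edge_path_append[of a x "w # z # b"] edge_path_append[of a x "y # z # b"] e''
    by simp
  have "swaps X (normal_form (x # y # z # b)) (normal_form (x # w # z # b))"
    using step_square[of "normal_form (z # b)", OF _ _ sq] normal_form_reduced_path[OF e'] by simp
  then have "swaps X (normal_form (a @ x # y # z # b)) (normal_form (a @ x # w # z # b))"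
    by (rule normal_form_append) (use p square in auto)
  then show ?thesis using q square by simp
qed

lemma elementary_homotopy_edge_path_back:
  assumes h: "elementary_homotopy X p q" and q: "edge_path X q"
  shows "edge_path X p"
  using h
proof cases
  case (backtrack x y a b)
  have "edge_path X (a @ [x])" "edge_path X (x # b)"
    using q backtrack(2) edge_path_append[of a x b] by auto
  then show ?thesis using backtrack edge_path_append[of a x "y # x # b"]
    by (simp add: edge_path_Cons adjacent_sym)
next
  case (square x y z w a b)
  have "edge_path X (a @ [x])" "edge_path X (x # w # z # b)"
    using q square(2) edge_path_append[of a x "w # z # b"] by auto
  then show ?thesis using square edge_path_append[of a x "y # z # b"]
    by (simp add: edge_path_Cons adjacent_sym)
qed

lemma homotopic_normal_form:
  assumes "equivclp (elementary_homotopy X) p q" "edge_path X p"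
  shows "edge_path X q \<and> swaps X (normal_form p) (normal_form q)"
  using assms(1)
proof (induction rule: equivclp_induct)
  case base then show ?case using assms by simp
next
  case (step y z)
  from step(2) show ?case
  proof
    assume "elementary_homotopy X y z"
    then show ?thesis using elementary_homotopy_normal_form step.IH rtranclp_trans by metis
  next
    assume h: "elementary_homotopy X z y"
    then have "edge_path X z" using elementary_homotopy_edge_path_back step.IH by blast
    then show ?thesis using elementary_homotopy_normal_form[OF h] step.IH swaps_sym rtranclp_trans by metis
  qed
qed

lemma elementary_homotopy_context:
  "elementary_homotopy X p q \<Longrightarrow> elementary_homotopy X (a @ p @ b) (a @ q @ b)"
proof (induction rule: elementary_homotopy.induct)
  case (backtrack x y p q)
  then show ?case using elementary_homotopy.backtrack[of X x y "a @ p" "q @ b"] by simp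
next
  case (square x y z w p q)
  then show ?case using elementary_homotopy.square[of X x y z w "a @ p" "q @ b"] by simp
qed

lemma homotopic_context:
  "equivclp (elementary_homotopy X) p q \<Longrightarrow> equivclp (elementary_homotopy X) (a @ p @ b) (a @ q @ b)"
proof (induction rule: equivclp_induct)
  case (step y z)
  then show ?case using elementary_homotopy_context by (blast intro: equivclp_into_equivclp)
qed simp

lemma homotopic_inverse:
  "edge_path X q \<Longrightarrow> equivclp (elementary_homotopy X) (rev q @ tl q) [last q]"
proof (induction q rule: normal_form.induct)
  case (3 x y q)
  then have "adjacent X y x" "edge_path X (y # q)" by (auto simp: edge_path_Cons adjacent_sym)
  then have "elementary_homotopy X (rev q @ [y, x, y] @ q) (rev q @ [y] @ q)"
    and "equivclp (elementary_homotopy X) (rev q @ [y] @ q) [last (y # q)]"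
    using 3 elementary_homotopy.backtrack[of X y x "rev q" q] by auto
  then have "equivclp (elementary_homotopy X) (rev q @ [y, x, y] @ q) [last (y # q)]"
    by (meson equivclp_trans r_into_equivclp)
  then show ?case by simp
qed (auto simp: edge_path_def)

lemma edge_path_rev: "edge_path X (rev p) \<longleftrightarrow> edge_path X p"
proof -
  have "(\<lambda>x y. adjacent X y x) = adjacent X" by (intro ext) (rule adjacent_sym)
  from arg_cong[OF this, of "\<lambda>P. successively P p"] show ?thesis by (simp add: edge_path_def)
qed

lemma edge_path_join:
  assumes "edge_path X p" "edge_path X q" "last p = hd q"
  shows "edge_path X (p @ tl q)"
proof -
  obtain p' x where p: "p = p' @ [x]" using assms(1) by (metis edge_path_def append_butlast_last_id)
  then obtain q' where "q = x # q'" using assms by (cases q) (auto simp: edge_path_def)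
  then show ?thesis using assms p edge_path_append[of p' x q'] by simp
qed

text \<open>The path composed of \<open>p\<close>, the reverse of \<open>q\<close>, and
  \<open>q\<close> contracts to \<open>q\<close> because its first two pieces form a loop, and to
  \<open>p\<close> because its last two cancel.\<close>

lemma homotopic:
  assumes p: "edge_path X p" and q: "edge_path X q" and e: "hd p = hd q" "last p = last q"
  shows "equivclp (elementary_homotopy X) p q"
proof -
  let ?h = "equivclp (elementary_homotopy X)"
  have ne: "p \<noteq> []" "q \<noteq> []" using p q by (auto simp: edge_path_def)
  have rq: "edge_path X (rev q)" "last p = hd (rev q)" using q e edge_path_rev by (auto simp: hd_rev)
  let ?l = "p @ tl (rev q)"
  have l: "edge_path X ?l" using edge_path_join[OF p rq] .
  have "last ?l = last (rev q)"
    using rq(2) ne by (metis append_Nil2 last_appendR last_tl hd_Cons_tl last_ConsL rev_is_Nil_conv)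
  then have "hd ?l = last ?l" using e ne by (simp add: last_rev)
  then have "?h ?l [hd ?l]" using l simply_connected by (auto simp: simply_connected_complex_def)
  from homotopic_context[OF this, of "[]" "tl q"] have 1: "?h (?l @ tl q) q"
    using ne e by simp
  have "?h (butlast p @ (rev q @ tl q) @ []) (butlast p @ [last q] @ [])"
    by (rule homotopic_context[OF homotopic_inverse[OF q]])
  moreover have "butlast p @ rev q = ?l"
  proof -
    obtain a r where r: "rev q = a # r" using ne by (cases "rev q") auto
    then have "a = last p" using rq(2) by simp
    then show ?thesis unfolding r using ne(1) append_butlast_last_id[OF ne(1)]
      by (metis append.assoc append_Cons append_Nil list.sel(3))
  qed
  moreover have "butlast p @ [last q] = p" using ne e by (metis append_butlast_last_id)
  ultimately have "?h (?l @ tl q) p" by (metis append.assoc append_Nil2)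
  then show ?thesis using 1 by (meson equivclp_sym equivclp_trans)
qed

text \<open>Reduced paths are their own normal forms, and simple connectivity makes the two
  homotopic.\<close>

lemma reduced_path_unique:
  assumes "reduced_path p" "reduced_path q" "hd p = hd q" "last p = last q"
  shows "swaps X p q"
  using homotopic_normal_form[OF homotopic, of p q] assms by (simp add: reduced_path_def normal_form_reduced)

lemma normal_form_unique:
  assumes "reduced_path p" "edge_path X q" "hd p = hd q" "last p = last q"
  shows "length p \<le> length q" "even (length p + length q)"
proof -
  have "length p = length (normal_form q)"
    using reduced_path_unique[of p "normal_form q"] normal_form_reduced_path[OF assms(2)] assms swaps_length by metis
  then show "length p \<le> length q" "even (length p + length q)" using normal_form_reduced_path[OF assms(2)] by auto
qed

section \<open>Reduced paths compute the distance\<close>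

lemma path_exists: "x \<in> \<Union>X \<Longrightarrow> y \<in> \<Union>X \<Longrightarrow> \<exists>p. edge_path X p \<and> hd p = x \<and> last p = y"
  using simply_connected by (auto simp: simply_connected_complex_def)

lemma reduced_path_exists: "x \<in> \<Union>X \<Longrightarrow> y \<in> \<Union>X \<Longrightarrow> \<exists>p. reduced_path p \<and> hd p = x \<and> last p = y"
  using path_exists normal_form_reduced_path by metis

lemma reduced_path_length:
  assumes "reduced_path p" shows "length p = Suc (comb_dist X (hd p) (last p))"
proof -
  have "p \<noteq> []" using assms by (auto simp: reduced_path_def edge_path_def)
  then have "comb_dist X (hd p) (last p) = length p - 1"
    unfolding comb_dist_def
    by (intro Least_equality) (use assms normal_form_unique(1)[OF assms] in \<open>auto simp: reduced_path_def\<close>, fastforce)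
  then show ?thesis using \<open>p \<noteq> []\<close> by (cases p) auto
qed

lemma backtracks_shorten:
  "backtracks q \<Longrightarrow> edge_path X q \<Longrightarrow>
   \<exists>q'. edge_path X q' \<and> hd q' = hd q \<and> last q' = last q \<and> length q' < length q"
proof (induction rule: backtracks.induct)
  case (backtracks_here x y q)
  then show ?case by (intro exI[of _ "x # q"]) (auto simp: edge_path_Cons)
next
  case (backtracks_there p x)
  have "p \<noteq> []" using backtracks_there(1) by (auto elim: backtracks.cases)
  then obtain y p' where p: "p = y # p'" by (cases p) auto
  with backtracks_there obtain q' where q': "edge_path X q'" "hd q' = y" "last q' = last p" "length q' < length p"
    by (auto simp: edge_path_Cons)
  obtain q'' where "q' = y # q''" using q' by (cases q') (auto simp: edge_path_def)
  then show ?case using q' p backtracks_there(3)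
    by (intro exI[of _ "x # q'"]) (auto simp: edge_path_Cons)
qed

text \<open>A geodesic is reduced because exchanges preserve length and a backtrack could be cut
  out. Conversely, a reduced path is as long as the normal form of any competitor, which is no
  longer than the competitor.\<close>

lemma reduced_path_iff:
  "reduced_path p \<longleftrightarrow> edge_path X p \<and> length p = Suc (comb_dist X (hd p) (last p))"
proof (intro iffI conjI)
  assume p: "edge_path X p \<and> length p = Suc (comb_dist X (hd p) (last p))"
  have "\<not> backtracks q" if s: "swaps X p q" for q
  proof
    assume "backtracks q"
    then obtain q' where q': "edge_path X q'" "hd q' = hd q" "last q' = last q" "length q' < length q"
      using backtracks_shorten swaps_edge_path[OF s] p by blast
    have eq: "hd p = hd q" "last p = last q" "length p = length q"
      using s by (auto dest: swaps_hd swaps_last swaps_length)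
    have "reduced_path (normal_form q')" "hd (normal_form q') = hd p" "last (normal_form q') = last p"
      using normal_form_reduced_path[OF q'(1)] q' eq by auto
    then have "length p \<le> length q'" using reduced_path_length[of "normal_form q'"] p normal_form_reduced_path[OF q'(1)] by simp
    then show False using q' eq by simp
  qed
  then show "reduced_path p" using p by (simp add: reduced_path_def reduced_def)
qed (auto simp: reduced_path_length reduced_path_def)

end

section \<open>The combinatorial metric and half-spaces\<close>

context cat0_complex
begin

section \<open>Metric, parity and the quadrangle condition\<close>

abbreviation d :: "'v \<Rightarrow> 'v \<Rightarrow> nat" where "d \<equiv> comb_dist X"

lemma dist_le_path: "edge_path X p \<Longrightarrow> Suc (d (hd p) (last p)) \<le> length p"
  using normal_form_reduced_path[of p] reduced_path_length[of "normal_form p"] by simp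

lemma dist_path:
  assumes "x \<in> \<Union>X" "y \<in> \<Union>X"
  obtains p where "reduced_path p" "hd p = x" "last p = y" "length p = Suc (d x y)"
  using reduced_path_exists[OF assms] reduced_path_length by metis

lemma dist_sym_le: assumes "x \<in> \<Union>X" "y \<in> \<Union>X" shows "d y x \<le> d x y"
proof -
  obtain p where p: "reduced_path p" "hd p = x" "last p = y" "length p = Suc (d x y)"
    using dist_path[OF assms] .
  then have "edge_path X (rev p)" "p \<noteq> []" using edge_path_rev by (auto simp: reduced_path_def)
  then show ?thesis using dist_le_path[of "rev p"] p by (simp add: hd_rev last_rev)
qed

lemma dist_sym: "x \<in> \<Union>X \<Longrightarrow> y \<in> \<Union>X \<Longrightarrow> d x y = d y x"
  by (simp add: dist_sym_le le_antisym)

lemma dist_triangle: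
  assumes "x \<in> \<Union>X" "y \<in> \<Union>X" "z \<in> \<Union>X" shows "d x z \<le> d x y + d y z"
proof -
  obtain p where p: "reduced_path p" "hd p = x" "last p = y" "length p = Suc (d x y)"
    using dist_path assms by metis
  obtain q where q: "reduced_path q" "hd q = y" "last q = z" "length q = Suc (d y z)"
    using dist_path assms by metis
  have ne: "p \<noteq> []" "q \<noteq> []" using p q by auto
  have e: "edge_path X (p @ tl q)" using edge_path_join p q by (auto simp: reduced_path_def)
  have "last (p @ tl q) = z"
    using q ne p(3) by (cases q) auto
  then show ?thesis using dist_le_path[OF e] p q ne by simp
qed

lemma dist_refl: "x \<in> \<Union>X \<Longrightarrow> d x x = 0"
  using dist_le_path[of "[x]"] by (simp add: edge_path_single)

lemma dist_eq_0: assumes "x \<in> \<Union>X" "y \<in> \<Union>X" shows "d x y = 0 \<longleftrightarrow> x = y"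
proof
  assume 0: "d x y = 0"
  obtain p where p: "hd p = x" "last p = y" "length p = Suc (d x y)"
    using dist_path assms by metis
  then obtain a where "p = [a]" using 0 by (auto simp: length_Suc_conv)
  then show "x = y" using p by simp
qed (use dist_refl assms in auto)

lemma dist_neighbour:
  assumes "x \<in> \<Union>X" "y \<in> \<Union>X" "x \<noteq> y"
  obtains z where "adjacent X x z" "d x y = Suc (d z y)"
proof -
  obtain p where p: "reduced_path p" "hd p = x" "last p = y" "length p = Suc (d x y)"
    using dist_path assms by metis
  have "d x y \<noteq> 0" using dist_eq_0 assms by blast
  then obtain z q where q: "p = x # z # q"
    using p by (cases p; cases "tl p") auto
  have "reduced_path (z # q)" using p(1)[unfolded q] by (rule reduced_path_tl)
  from reduced_path_length[OF this] p q show ?thesis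
    by (intro that[of z]) (auto simp: reduced_path_def edge_path_Cons)
qed

lemma dist_eq_1: assumes "x \<in> \<Union>X" "y \<in> \<Union>X" shows "d x y = 1 \<longleftrightarrow> adjacent X x y"
proof
  assume 1: "d x y = 1"
  then have "x \<noteq> y" using dist_refl[OF assms(1)] by auto
  then obtain z where z: "adjacent X x z" "d x y = Suc (d z y)" using dist_neighbour assms by blast
  have "z \<in> \<Union>X" using adjacent_vertex[OF z(1)] by blast
  then have "z = y" using z 1 dist_eq_0 assms by simp
  then show "adjacent X x y" using z by simp
next
  assume a: "adjacent X x y"
  then have "edge_path X [x, y]" using assms by (simp add: edge_path_Cons edge_path_single)
  from dist_le_path[OF this] have "d x y \<le> 1" by simp
  moreover have "d x y \<noteq> 0" using dist_eq_0 a assms by (auto simp: adjacent_def)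
  ultimately show "d x y = 1" by simp
qed

text \<open>Besides the claim, the triangle inequality leaves only equal distances. Parity excludes
  these: a reduced path from \<open>b\<close> and a reduced path from \<open>a\<close> prolonged by
  the edge have the same ends.\<close>

lemma dist_edge:
  assumes v: "v \<in> \<Union>X" and a: "adjacent X a b"
  shows "d v a = Suc (d v b) \<or> d v b = Suc (d v a)"
proof -
  have ab: "a \<in> \<Union>X" "b \<in> \<Union>X" using adjacent_vertex[OF a] by auto
  obtain p where p: "reduced_path p" "hd p = a" "last p = v" "length p = Suc (d a v)"
    using dist_path v ab by metis
  obtain q where q: "reduced_path q" "hd q = b" "last q = v" "length q = Suc (d b v)"
    using dist_path v ab by metis
  obtain p' where "p = a # p'" using p by (cases p) auto
  then have "edge_path X (b # p)" using p(1) a by (simp add: reduced_path_def edge_path_Cons adjacent_sym)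
  moreover have "last (b # p) = v" using p by auto
  ultimately have "even (length q + Suc (length p))"
    using normal_form_unique(2)[of q "b # p"] q by simp
  then have "d a v \<noteq> d b v" using p(4) q(4) by auto
  moreover have "d a v \<le> Suc (d b v)" "d b v \<le> Suc (d a v)"
    using dist_triangle[of a b v] dist_triangle[of b a v] dist_eq_1[of a b] dist_eq_1[of b a] ab v a
    by (auto simp: adjacent_sym)
  ultimately show ?thesis using dist_sym[OF v ab(1)] dist_sym[OF v ab(2)] by linarith
qed

text \<open>Geodesics from \<open>b\<close> to \<open>v\<close> through \<open>a\<close> and through
  \<open>c\<close> are reduced, hence equal up to exchanges. \<open>swaps_diamond\<close> turns this
  into a square with a common continuation beyond it.\<close>

lemma quadrangle:
  assumes v: "v \<in> \<Union>X" and ab: "adjacent X b a" "adjacent X b c" "a \<noteq> c"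
    and dd: "d v b = Suc (d v a)" "d v b = Suc (d v c)"
  obtains z where "square X b a z c" "d v a = Suc (d v z)"
proof -
  have V: "a \<in> \<Union>X" "b \<in> \<Union>X" "c \<in> \<Union>X" using adjacent_vertex[OF ab(1)] adjacent_vertex[OF ab(2)] by blast+
  have ext: "\<exists>p. reduced_path (b # a # p) \<and> last (a # p) = v" if a: "a \<in> \<Union>X" "adjacent X b a" "d v b = Suc (d v a)" for a
  proof -
    obtain p where p: "reduced_path p" "hd p = a" "last p = v" "length p = Suc (d a v)"
      using dist_path v a by metis
    obtain p' where p': "p = a # p'" using p by (cases p) auto
    have "edge_path X (b # p)" using p a p' by (simp add: reduced_path_def edge_path_Cons)
    moreover have "length (b # p) = Suc (d b v)" using p(4) a dist_sym v V(2) by simp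
    ultimately have "reduced_path (b # p)" using p p' by (simp add: reduced_path_iff)
    then show ?thesis using p'(1) p(3) by blast
  qed
  obtain p where p: "reduced_path (b # a # p)" "last (a # p) = v" using ext[OF V(1) ab(1) dd(1)] by blast
  obtain q where q: "reduced_path (b # c # q)" "last (c # q) = v" using ext[OF V(3) ab(2) dd(2)] by blast
  have "swaps X (b # a # p) (b # c # q)" using reduced_path_unique p q by simp
  then obtain z r where z: "square X b a z c" "swaps X (a # p) (a # z # r)"
    using swaps_diamond ab by blast
  have g: "reduced_path (a # z # r)" using reduced_path_swaps[OF z(2) reduced_path_tl[OF p(1)]] .
  have l: "last (z # r) = v" using swaps_last[OF z(2)] p(2) by simp
  have zV: "z \<in> \<Union>X" using z(1) adjacent_vertex unfolding square_def by metis
  have "length (a # z # r) = Suc (d a v)" using reduced_path_length[OF g] l by simp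
  moreover have "length (z # r) = Suc (d z v)" using reduced_path_length[OF reduced_path_tl[OF g]] l by simp
  ultimately have "d a v = Suc (d z v)" by simp
  then show ?thesis using that z(1) dist_sym v V zV by simp
qed

text \<open>By parity \<open>u\<close> and \<open>v\<close> are at distance two. The quadrangle
  condition with base \<open>u\<close> gives a square whose far corner is at distance zero from
  \<open>u\<close>.\<close>

lemma four_cycle:
  assumes "adjacent X v a" "adjacent X a u" "adjacent X v b" "adjacent X b u" "v \<noteq> u" "a \<noteq> b"
  shows "square X v a u b"
proof -
  have V: "v \<in> \<Union>X" "a \<in> \<Union>X" "u \<in> \<Union>X" "b \<in> \<Union>X" 
    using adjacent_vertex[OF assms(1)] adjacent_vertex[OF assms(4)] by blast+
  have 1: "d u a = 1" "d u b = 1" using dist_eq_1 assms V by (auto simp: adjacent_sym)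
  moreover have "d u v \<noteq> 0" using dist_eq_0 V assms by blast
  ultimately have 2: "d u v = 2" using dist_edge[OF V(3) assms(1)] by auto
  obtain z where z: "square X v a z b" "d u a = Suc (d u z)"
    using quadrangle[OF V(3) assms(1,3,6)] 1 2 by auto
  have "z \<in> \<Union>X" using z(1) adjacent_vertex unfolding square_def by metis
  then have "z = u" using z 1 dist_eq_0 V by simp
  then show ?thesis using z by simp
qed

section \<open>Sides of edges and parallelism classes\<close>

definition side :: "'v \<Rightarrow> 'v \<Rightarrow> 'v set" where
  "side a b = {v \<in> \<Union>X. d v a < d v b}"

lemma side_iff: "v \<in> \<Union>X \<Longrightarrow> v \<in> side a b \<longleftrightarrow> d v a < d v b"
  by (simp add: side_def)

lemma side_subset: "side a b \<subseteq> \<Union>X"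
  by (auto simp: side_def)

lemma side_Diff: "adjacent X a b \<Longrightarrow> \<Union>X - side a b = side b a"
  using dist_edge by (fastforce simp: side_def)

lemma side_ends: assumes "adjacent X a b" shows "a \<in> side a b" "b \<notin> side a b"
proof -
  have "a \<in> \<Union>X" "b \<in> \<Union>X" using adjacent_vertex[OF assms] by auto
  then show "a \<in> side a b" "b \<notin> side a b"
    using dist_refl dist_eq_1[of a b] assms by (auto simp: side_def)
qed

text \<open>A vertex \<open>v\<close> violating this would be nearer to both \<open>a\<close> and
  \<open>c\<close> than to \<open>b\<close>. The quadrangle condition makes the fourth corner, which
  is \<open>e\<close>, nearer still, although \<open>v\<close> is farther from \<open>e\<close> than
  from \<open>a\<close>.\<close>

lemma side_mono_square:
  assumes sq: "square X a b c e" shows "side a b \<subseteq> side e c"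
proof
  fix v assume "v \<in> side a b"
  then have v: "v \<in> \<Union>X" "d v a < d v b" by (auto simp: side_def)
  have adj: "adjacent X a b" "adjacent X b c" "adjacent X a e" "adjacent X e c" "b \<noteq> e" "a \<noteq> c"
    using sq by (auto simp: square_def)
  note D = dist_edge[OF v(1) adj(1)] dist_edge[OF v(1) adj(2)] dist_edge[OF v(1) adj(3)]
    dist_edge[OF v(1) adj(4)]
  show "v \<in> side e c"
  proof (rule ccontr)
    assume "v \<notin> side e c"
    then have "\<not> d v e < d v c" using v(1) unfolding side_def by blast
    then have k: "d v b = Suc (d v a)" "d v b = Suc (d v c)" "d v e = Suc (d v a)"
      using D v(2) by linarith+
    have "adjacent X b a" using adj by (simp add: adjacent_sym)
    then obtain z where z: "square X b a z c" "d v a = Suc (d v z)"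
      using quadrangle[OF v(1) _ adj(2) adj(6) k(1,2)] by blast
    have "square X b a e c" using sq by (blast intro: square_rotate square_flip)
    then have "z = e" using z(1) square_unique by blast
    then show False using z(2) k(3) by simp
  qed
qed

lemma side_square: "square X a b c e \<Longrightarrow> side a b = side e c"
  using side_mono_square[of a b c e] side_mono_square[of e c b a]
  by (meson square_flip square_rotate subset_antisym)

lemma square_opposite: assumes "square X a b c e" shows "opposite X {a, b} {e, c}"
proof -
  have "{a, b} \<union> {e, c} = {a, b, c, e}" by auto
  then show ?thesis using assms
    by (auto simp: opposite_def edges_iff_adjacent square_def adjacent_def)
qed

lemma opposite_square:
  assumes o: "opposite X e f"
  obtains a b c w where "e = {a, b}" "f = {w, c}" "square X a b c w"
proof -
  from o have e: "e \<in> edges X" "f \<in> edges X" and dis: "e \<inter> f = {}" and un: "e \<union> f \<in> X"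
    by (auto simp: opposite_def)
  obtain a b where ab: "e = {a, b}" "a \<noteq> b" using e(1) by (auto simp: edges_def card_2_iff)
  have adj: "adjacent X a b" using e(1) ab by (simp add: edges_iff_adjacent)
  have c2: "card e = 2" "card f = 2" using e by (auto simp: edges_def)
  then have "finite e" "finite f" by (auto intro: card_ge_0_finite)
  then have c4: "card (e \<union> f) = 4" using card_Un_disjoint[OF _ _ dis] c2 by simp
  obtain n g where g: "chart X (e \<union> f) n g" "g {} = a"
    using cube_chart[OF cubes un, of a] ab by auto
  have "2 ^ n = (2::nat) ^ 2" using card_chart[OF g(1)] c4 by simp
  then have n: "n = 2" using power_inject_exp[of "2::nat" n 2] by simp
  obtain i where i: "i < 2" "b = g {i}"
    using chart_neighbour[OF g(1), of b] adj g ab n by auto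
  define j where "j = 1 - i"
  have j: "j < 2" "i \<noteq> j" "{..<2} = {i, j}" using i(1) by (auto simp: j_def less_2_cases_iff)
  have sq: "square X a b (g {i, j}) (g {j})"
    using chart_square[OF g(1), of "{}" i j] i j n g by simp
  have "g ` Pow {i, j} = e \<union> f" using chart_image[OF g(1)] n j by simp
  moreover have "Pow {i, j} = {{}, {i}, {j}, {i, j}}" by auto
  ultimately have "e \<union> f = {a, b, g {j}, g {i, j}}" using g i by auto
  then have "f = {g {j}, g {i, j}}" using dis ab sq by (auto simp: square_def adjacent_def)
  then show ?thesis using that ab sq by blast
qed

text \<open>The crossing edge is moved towards \<open>{a, b}\<close> one square at a time; each
  square preserves both the parallelism class and the side.\<close>

lemma side_crossing:
  "\<lbrakk>adjacent X a b; adjacent X c e; c \<in> side a b; e \<in> side b a\<rbrakk> \<Longrightarrow>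
   equivclp (opposite X) {a, b} {c, e} \<and> side a b = side c e"
proof (induction "d c a" arbitrary: c e rule: less_induct)
  case less
  have V: "a \<in> \<Union>X" "b \<in> \<Union>X" "c \<in> \<Union>X" "e \<in> \<Union>X" 
    using adjacent_vertex[OF less.prems(1)] adjacent_vertex[OF less.prems(2)] by blast+
  have 1: "d c b = Suc (d c a)" "d e a = Suc (d e b)"
    using less.prems dist_edge[OF V(3), of a b] dist_edge[OF V(4), of a b] by (auto simp: side_def)
  have 2: "d a e = Suc (d a c) \<or> d a c = Suc (d a e)" "d b e = Suc (d b c) \<or> d b c = Suc (d b e)"
    using dist_edge[OF V(1), of e c] dist_edge[OF V(2), of e c] less.prems by (auto simp: adjacent_sym)
  have eq: "d e b = d c a"
    using 1 2 dist_sym[OF V(1,3)] dist_sym[OF V(1,4)] dist_sym[OF V(2,3)] dist_sym[OF V(2,4)] by linarith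
  show ?case
  proof (cases "d c a = 0")
    case True
    then have "c = a" "e = b"
      using eq dist_eq_0[OF V(3,1)] dist_eq_0[OF V(4,2)] by simp_all
    then show ?thesis by simp
  next
    case False
    then have "e \<noteq> b" using eq dist_refl[OF V(2)] by auto
    then obtain z where z: "adjacent X e z" "d e b = Suc (d z b)" using dist_neighbour V by metis
    have zV: "z \<in> \<Union>X" using adjacent_vertex[OF z(1)] by blast
    have "d a z \<le> Suc (d z b)"
      using dist_triangle[OF V(1,2) zV] dist_eq_1[OF V(1,2)] less.prems(1) dist_sym[OF zV V(2)] by simp
    \<comment> \<open>Seen from \<open>a\<close>, both \<open>z\<close> and \<open>c\<close> are one
      step nearer than \<open>e\<close>, so the quadrangle condition produces the square across
      which the edge is moved.\<close>
    then have az: "d a e = Suc (d a z)" "d a e = Suc (d a c)"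
      using dist_edge[OF V(1) z(1)] 1 2 z(2) eq dist_sym[OF V(1,3)] dist_sym[OF V(1,4)] by linarith+
    have "c \<noteq> z" using 1 z eq by auto
    moreover have "adjacent X e c" using less.prems by (simp add: adjacent_sym)
    ultimately obtain w where w: "square X e c w z" "d a c = Suc (d a w)"
      using quadrangle[OF V(1) _ z(1) _ az(2,1)] by blast
    have cw: "adjacent X c w" and wz: "adjacent X w z" using w(1) by (auto simp: square_def adjacent_sym)
    have wV: "w \<in> \<Union>X" using adjacent_vertex[OF cw] by blast
    have "d b c = Suc (d b w) \<or> d b w = Suc (d b c)" using dist_edge[OF V(2) cw] .
    then have "w \<in> side a b" unfolding side_iff[OF wV]
      using w(2) 1 dist_sym[OF wV V(1)] dist_sym[OF wV V(2)] dist_sym[OF V(3,1)] dist_sym[OF V(3,2)]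
      by linarith
    moreover have "z \<in> side b a" unfolding side_iff[OF zV]
      using az z(2) eq dist_sym[OF zV V(1)] dist_sym[OF V(3,1)] by linarith
    moreover have "d w a < d c a" using w(2) dist_sym[OF wV V(1)] dist_sym[OF V(3,1)] by linarith
    ultimately have IH: "equivclp (opposite X) {a, b} {w, z}" "side a b = side w z"
      using less.hyps[of w z] less.prems(1) wz by auto
    have sq: "square X w z e c" using w(1) by (blast intro: square_rotate square_flip)
    have "equivclp (opposite X) {a, b} {c, e}"
      using IH(1) square_opposite[OF sq] by (blast intro: equivclp_into_equivclp)
    then show ?thesis using IH(2) side_square[OF sq] by blast
  qed
qed

lemma equivclp_opposite_side:
  assumes "equivclp (opposite X) e f" "e \<in> edges X"
  shows "f \<in> edges X \<and> (\<forall>a b. e = {a, b} \<longrightarrow> (\<exists>c w. f = {c, w} \<and> side a b = side c w))"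
  using assms(1)
proof (induction rule: equivclp_induct)
  case base then show ?case using assms(2) by blast
next
  case (step f g)
  have "g \<in> edges X" using step(2) by (auto simp: opposite_def)
  have "\<exists>c' w'. g = {c', w'} \<and> side c w = side c' w'" if f: "f = {c, w}" for c w
  proof -
    obtain f' g' where fg: "f' = f \<and> g' = g \<or> f' = g \<and> g' = f" "opposite X f' g'" using step(2) by blast
    obtain p q r s where p: "f' = {p, q}" "g' = {s, r}" "square X p q r s"
      using opposite_square[OF fg(2)] .
    have s: "side p q = side s r" "side q p = side r s"
      using side_square p(3) by (blast, meson side_square square_flip square_rotate square_reverse)
    from fg(1) show ?thesis
    proof (elim disjE conjE)
      assume "f' = f" "g' = g"
      then have "c = p \<and> w = q \<or> c = q \<and> w = p" using p f by (auto simp: doubleton_eq_iff)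
      then show ?thesis using s p \<open>g' = g\<close> by (metis insert_commute)
    next
      assume "f' = g" "g' = f"
      then have "c = s \<and> w = r \<or> c = r \<and> w = s" using p f by (auto simp: doubleton_eq_iff)
      then show ?thesis using s p \<open>f' = g\<close> by (metis insert_commute)
    qed
  qed
  then show ?case using step.IH \<open>g \<in> edges X\<close> by metis
qed

text \<open>Turns the generated equivalence relation into a condition on the two endpoints that can
  be tested for a single edge.\<close>

lemma hyperplane_crossing:
  assumes ab: "adjacent X a b"
  shows "equivclp (opposite X) {a, b} {p, q} \<longleftrightarrow>
    adjacent X p q \<and> (p \<in> side a b \<longleftrightarrow> q \<notin> side a b)"
proof
  assume e: "equivclp (opposite X) {a, b} {p, q}"
  have "{p, q} \<in> edges X \<and> (\<exists>c w. {p, q} = {c, w} \<and> side a b = side c w)"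
    using equivclp_opposite_side[OF e] ab by (auto simp: edges_iff_adjacent)
  then obtain c w where c: "adjacent X p q" "{p, q} = {c, w}" "side a b = side c w"
    by (auto simp: edges_iff_adjacent)
  have "p = c \<and> q = w \<or> p = w \<and> q = c" using c(2) by (auto simp: doubleton_eq_iff)
  then show "adjacent X p q \<and> (p \<in> side a b \<longleftrightarrow> q \<notin> side a b)"
    using c side_ends adjacent_sym by metis
next
  assume p: "adjacent X p q \<and> (p \<in> side a b \<longleftrightarrow> q \<notin> side a b)"
  have V: "p \<in> \<Union>X" "q \<in> \<Union>X" using adjacent_vertex p by metis+
  show "equivclp (opposite X) {a, b} {p, q}"
  proof (cases "p \<in> side a b")
    case True
    then have "q \<in> side b a" using p V side_Diff[OF ab] by blast
    then show ?thesis using side_crossing[OF ab _ True] p by blast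
  next
    case False
    then have "p \<in> side b a" "q \<in> side a b" using p V side_Diff[OF ab] by blast+
    then show ?thesis using side_crossing[OF ab, of q p] p by (simp add: adjacent_sym insert_commute)
  qed
qed

text \<open>An edge outside the hyperplane does not change sides, and every vertex of
  \<open>side a b\<close> is joined to \<open>a\<close> by a geodesic that stays there.\<close>

lemma component_side:
  assumes ab: "adjacent X a b" and x: "x \<in> side a b"
    and h: "h = {f. equivclp (opposite X) {a, b} f}"
  shows "{y. (x, y) \<in> {(p, q). {p, q} \<in> edges X - h}\<^sup>*} = side a b"
proof -
  let ?R = "{(p, q). {p, q} \<in> edges X - h}"
  have R: "(p, q) \<in> ?R \<longleftrightarrow> adjacent X p q \<and> (p \<in> side a b \<longleftrightarrow> q \<in> side a b)" for p q
    using hyperplane_crossing[OF ab, of p q] by (auto simp: h edges_iff_adjacent)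
  have symR: "sym ?R" by (auto simp: sym_def insert_commute)
  have "y \<in> side a b" if "(x, y) \<in> ?R\<^sup>*" for y
    using that by (induction rule: rtrancl_induct) (use x R in auto)
  moreover have toa: "(y, a) \<in> ?R\<^sup>*" if "y \<in> side a b" for y
    using that
  proof (induction "d y a" arbitrary: y rule: less_induct)
    case less
    have V: "y \<in> \<Union>X" "a \<in> \<Union>X" "b \<in> \<Union>X" 
      using less.prems adjacent_vertex[OF ab] by (auto simp: side_def)
    show ?case
    proof (cases "y = a")
      case False
      then obtain z where z: "adjacent X y z" "d y a = Suc (d z a)" using dist_neighbour V by metis
      have zV: "z \<in> \<Union>X" using adjacent_vertex[OF z(1)] by blast
      have "d b y = Suc (d b z) \<or> d b z = Suc (d b y)" using dist_edge[OF V(3) z(1)] .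
      moreover have "d y a < d y b" using less.prems side_iff[OF V(1)] by blast
      ultimately have "z \<in> side a b" unfolding side_iff[OF zV]
        using z(2) dist_sym[OF V(3,1)] dist_sym[OF V(3) zV] by linarith
      moreover from this have "(y, z) \<in> ?R" using R less.prems z by blast
      ultimately show ?thesis using less.hyps[of z] z by (simp add: converse_rtrancl_into_rtrancl)
    qed simp
  qed
  moreover have "(x, y) \<in> ?R\<^sup>*" if "y \<in> side a b" for y
    using toa[OF x] toa[OF that] sym_rtrancl[OF symR] by (meson rtrancl_trans symD)
  ultimately show ?thesis by blast
qed

lemma halfspaces_eq: "halfspaces X = {side a b | a b. adjacent X a b}"
proof
  show "halfspaces X \<subseteq> {side a b | a b. adjacent X a b}"
  proof
    fix H assume "H \<in> halfspaces X"
    then obtain x h where x: "x \<in> \<Union>X" "h \<in> hyperplanes X"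
      and H: "H = {y. (x, y) \<in> {(a, b). {a, b} \<in> edges X - h}\<^sup>*}"
      unfolding halfspaces_def by blast
    then obtain e where e: "e \<in> edges X" "h = {f. equivclp (opposite X) e f}"
      unfolding hyperplanes_def by blast
    obtain a b where ab: "e = {a, b}" using e(1) by (auto simp: edges_def card_2_iff)
    then have adj: "adjacent X a b" using e(1) by (simp add: edges_iff_adjacent)
    note ab = ab adj
    have ba: "adjacent X b a" using ab by (simp add: adjacent_sym)
    have "x \<in> side a b \<or> x \<in> side b a" using side_Diff[OF ab(2)] x by blast
    then show "H \<in> {side a b | a b. adjacent X a b}"
    proof
      assume "x \<in> side a b"
      moreover have "h = {f. equivclp (opposite X) {a, b} f}" using e(2) ab(1) by simp
      ultimately have "H = side a b" unfolding H by (rule component_side[OF ab(2)])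
      then show ?thesis using ab(2) by blast
    next
      assume "x \<in> side b a"
      moreover have "h = {f. equivclp (opposite X) {b, a} f}" using e(2) ab(1) by (simp add: insert_commute)
      ultimately have "H = side b a" unfolding H by (rule component_side[OF ba])
      then show ?thesis using ba by blast
    qed
  qed
  show "{side a b | a b. adjacent X a b} \<subseteq> halfspaces X"
  proof
    fix H assume "H \<in> {side a b | a b. adjacent X a b}"
    then obtain a b where ab: "H = side a b" "adjacent X a b" by blast
    define h where "h = {f. equivclp (opposite X) {a, b} f}"
    have "{a, b} \<in> edges X" using ab by (simp add: edges_iff_adjacent)
    then have "h \<in> hyperplanes X" unfolding hyperplanes_def h_def by blast
    moreover have "H = {y. (a, y) \<in> {(p, q). {p, q} \<in> edges X - h}\<^sup>*}"
      using component_side[OF ab(2) side_ends(1)[OF ab(2)] h_def] ab(1) by simp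
    moreover have "a \<in> \<Union>X" using adjacent_vertex[OF ab(2)] by blast
    ultimately show "H \<in> halfspaces X" unfolding halfspaces_def by blast
  qed
qed

end

section \<open>Gates, ultrafilters and cubes\<close>

context cat0_complex
begin

section \<open>Half-spaces, separation and convexity\<close>

lemma halfspace_side: "adjacent X a b \<Longrightarrow> side a b \<in> halfspaces X"
  by (auto simp: halfspaces_eq)

lemma halfspaceE:
  assumes "H \<in> halfspaces X" obtains a b where "H = side a b" "adjacent X a b"
  using assms by (auto simp: halfspaces_eq)

lemma halfspace_subset: "H \<in> halfspaces X \<Longrightarrow> H \<subseteq> \<Union>X"
  by (auto simp: halfspaces_eq side_def)

lemma halfspace_Diff: "H \<in> halfspaces X \<Longrightarrow> \<Union>X - H \<in> halfspaces X"
  by (metis adjacent_sym halfspaceE halfspace_side side_Diff)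

lemma halfspace_Diff_Diff: "H \<in> halfspaces X \<Longrightarrow> \<Union>X - (\<Union>X - H) = H"
  using halfspace_subset by blast

lemma halfspace_nonempty: "H \<in> halfspaces X \<Longrightarrow> H \<noteq> {}"
  by (metis empty_iff halfspaceE side_ends(1))

lemma halfspace_edge:
  assumes xz: "adjacent X x z" and H: "H \<in> halfspaces X" "x \<in> H" "z \<notin> H"
  shows "H = side x z"
proof -
  obtain a b where ab: "H = side a b" "adjacent X a b" using H(1) by (rule halfspaceE)
  have "z \<in> \<Union>X" using adjacent_vertex[OF xz] by blast
  then have "z \<in> side b a" using ab H(3) side_Diff by blast
  then show ?thesis using side_crossing[OF ab(2) xz] H(2) ab(1) by blast
qed

definition separators :: "'v \<Rightarrow> 'v \<Rightarrow> 'v set set" where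
  "separators x y = {H \<in> halfspaces X. x \<in> H \<and> y \<notin> H}"

text \<open>On the first edge of a geodesic from \<open>x\<close> to \<open>y\<close> exactly one
  separating half-space is lost and none is gained, since an edge determines the half-space that
  contains only its first end.\<close>

lemma card_separators:
  "x \<in> \<Union>X \<Longrightarrow> y \<in> \<Union>X \<Longrightarrow> finite (separators x y) \<and> card (separators x y) = d x y"
proof (induction "d x y" arbitrary: x)
  case 0
  then have "x = y" using dist_eq_0[OF 0(2,3)] by simp
  then show ?case using dist_refl[OF 0(3)] by (simp add: separators_def)
next
  case (Suc n)
  have "x \<noteq> y" using dist_refl[OF Suc.prems(1)] Suc.hyps(2) by auto
  then obtain z where z: "adjacent X x z" "d x y = Suc (d z y)" using dist_neighbour Suc.prems by blast
  have zV: "z \<in> \<Union>X" using adjacent_vertex[OF z(1)] by blast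
  have IH: "finite (separators z y)" "card (separators z y) = d z y"
    using Suc.hyps(1)[OF _ zV Suc.prems(2)] z Suc.hyps(2) by auto
  have zx: "adjacent X z x" using z(1) by (simp add: adjacent_sym)
  have y: "y \<notin> side x z" "y \<in> side z x"
    using z(2) Suc.prems zV dist_sym[OF Suc.prems(2)] by (simp_all add: side_iff)
  have "separators x y = insert (side x z) (separators z y)"
  proof (rule subset_antisym; rule subsetI)
    fix H assume "H \<in> separators x y"
    then show "H \<in> insert (side x z) (separators z y)"
      using halfspace_edge[OF z(1)] by (auto simp: separators_def)
  next
    fix H assume "H \<in> insert (side x z) (separators z y)"
    then show "H \<in> separators x y"
      using halfspace_edge[OF zx] y halfspace_side[OF z(1)] side_ends(1)[OF z(1)]
      by (auto simp: separators_def)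
  qed
  moreover have "side x z \<notin> separators z y" using side_ends(2)[OF z(1)] by (simp add: separators_def)
  ultimately show ?case using IH z by simp
qed

text \<open>Convexity by counting: otherwise \<open>H\<close> would separate \<open>v\<close> from
  \<open>y\<close> without separating \<open>v\<close> from \<open>z\<close>, and the partial
  distances would add up to too much.\<close>

lemma between_halfspace:
  assumes V: "v \<in> \<Union>X" "y \<in> \<Union>X" "z \<in> \<Union>X" and dd: "d v z = d v y + d y z"
    and H: "H \<in> halfspaces X" "v \<in> H" "z \<in> H"
  shows "y \<in> H"
proof (rule ccontr)
  assume y: "y \<notin> H"
  have f: "finite (separators v y)" "finite (separators y z)"
    using card_separators V by blast+
  have "separators v z \<subseteq> (separators v y \<union> separators y z) - {H}"
    using H by (auto simp: separators_def)
  moreover have "H \<in> separators v y \<union> separators y z" using H y by (simp add: separators_def)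
  ultimately have "separators v z \<subset> separators v y \<union> separators y z" by blast
  then have "card (separators v z) < card (separators v y \<union> separators y z)"
    using f by (intro psubset_card_mono) auto
  also have "\<dots> \<le> card (separators v y) + card (separators y z)" by (rule card_Un_le)
  finally show False using card_separators V dd by simp
qed

lemma between_halfspace':
  assumes V: "v \<in> \<Union>X" "y \<in> \<Union>X" "z \<in> \<Union>X" and dd: "d v z = d v y + d y z"
    and H: "H \<in> halfspaces X" "v \<notin> H" "y \<in> H"
  shows "z \<in> H"
  using between_halfspace[OF V dd halfspace_Diff[OF H(1)]] H V by blast

text \<open>A nearest vertex of a half-space is a gate. If the distance from \<open>v\<close> fell
  on the last step of a geodesic from \<open>y\<close> to \<open>z\<close>, the quadrangle condition
  at the preceding vertex would give a vertex of \<open>H\<close> that contradicts the induction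
  hypothesis.\<close>

lemma halfspace_gate:
  assumes v: "v \<in> \<Union>X" and H: "H \<in> halfspaces X" and y: "y \<in> H"
    and near: "\<And>z. z \<in> H \<Longrightarrow> d v y \<le> d v z"
  shows "z \<in> H \<Longrightarrow> d v z = d v y + d y z"
proof (induction "d y z" arbitrary: z rule: less_induct)
  case less
  note HV = halfspace_subset[OF H]
  have V: "y \<in> \<Union>X" "z \<in> \<Union>X" using HV y less.prems by blast+
  show ?case
  proof (cases "z = y")
    case True then show ?thesis using dist_refl[OF V(1)] by simp
  next
    case False
    then obtain z1 where z1: "adjacent X z z1" "d z y = Suc (d z1 y)" using dist_neighbour V by metis
    have V1: "z1 \<in> \<Union>X" using adjacent_vertex[OF z1(1)] by blast
    have zz1: "d z z1 = 1" using dist_eq_1[OF V(2) V1] z1(1) by blast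
    have k1: "d y z = Suc (d y z1)" using z1(2) dist_sym V V1 by metis
    have "z1 \<in> H" by (rule between_halfspace[OF V(2) V1 V(1) _ H less.prems y]) (simp add: z1 zz1)
    then have IH1: "d v z1 = d v y + d y z1" using less.hyps k1 by simp
    show ?thesis
    proof (rule ccontr)
      assume "d v z \<noteq> d v y + d y z"
      then have vz: "d v z1 = Suc (d v z)" using dist_edge[OF v z1(1)] k1 IH1 by auto
      have "z1 \<noteq> y"
      proof
        assume "z1 = y"
        then show False using near[OF less.prems] vz by simp
      qed
      then obtain z2 where z2: "adjacent X z1 z2" "d z1 y = Suc (d z2 y)"
        using dist_neighbour V1 V by metis
      have V2: "z2 \<in> \<Union>X" using adjacent_vertex[OF z2(1)] by blast
      have z12: "d z1 z2 = 1" using dist_eq_1[OF V1 V2] z2(1) by blast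
      have k2: "d y z1 = Suc (d y z2)" using z2(2) dist_sym V(1) V1 V2 by metis
      have "z2 \<in> H" by (rule between_halfspace[OF V1 V2 V(1) _ H \<open>z1 \<in> H\<close> y]) (simp add: z2 z12)
      then have IH2: "d v z2 = d v y + d y z2" using less.hyps k1 k2 by simp
      have "z \<noteq> z2" using k1 k2 by auto
      moreover have "adjacent X z1 z" using z1(1) by (simp add: adjacent_sym)
      moreover have "d v z1 = Suc (d v z2)" using IH1 IH2 k2 by simp
      ultimately obtain w where w: "square X z1 z w z2" "d v z = Suc (d v w)"
        using quadrangle[OF v _ z2(1) _ vz] by blast
      have adj: "adjacent X z w" "adjacent X w z2" using w(1) by (auto simp: square_def adjacent_sym)
      have Vw: "w \<in> \<Union>X" using adjacent_vertex[OF adj(1)] by blast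
      have zw: "d z w = 1" "d w z2 = 1" using dist_eq_1 adj V Vw V2 by blast+
      have "d z z2 \<noteq> 0" "d z z2 \<noteq> 1"
        using dist_eq_0[OF V(2) V2] \<open>z \<noteq> z2\<close> dist_edge[OF V(1), of z z2] dist_eq_1[OF V(2) V2] k1 k2
        by auto
      then have "d z z2 = d z w + d w z2" using dist_triangle[OF V(2) Vw V2] zw by simp
      then have "w \<in> H" using between_halfspace[OF V(2) Vw V2 _ H less.prems \<open>z2 \<in> H\<close>] by blast
      \<comment> \<open>With the next bound this puts \<open>w\<close> as far from \<open>y\<close>
        as \<open>z1\<close> is. The induction hypothesis then predicts the distance
        \<open>d v z1\<close> from \<open>v\<close>, which is two too many.\<close>
      moreover have "d y w \<le> d y z1"
        using dist_triangle[OF V(1) V2 Vw] zw(2) dist_sym[OF V2 Vw] k2 by simp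
      moreover have "d y z \<le> Suc (d y w)"
        using dist_triangle[OF V(1) Vw V(2)] zw(1) dist_sym[OF V(2) Vw] by simp
      ultimately have "d v w = d v y + d y w" using less.hyps k1 by simp
      then show False using vz w(2) IH1 \<open>d y z \<le> Suc (d y w)\<close> k1 by simp
    qed
  qed
qed

text \<open>The edge is the first one on a geodesic from \<open>v\<close> to its gate in
  \<open>H\<close>. The gate lies between \<open>v\<close> and each vertex of \<open>H\<close>, so
  convexity keeps all of \<open>H\<close> on the far side of the edge.\<close>

lemma neighbour_towards_halfspace:
  assumes v: "v \<in> \<Union>X" and H: "H \<in> halfspaces X" "v \<notin> H"
  obtains z where "adjacent X v z" "H \<subseteq> side z v"
proof -
  obtain y where y: "y \<in> H" "\<And>z. z \<in> H \<Longrightarrow> d v y \<le> d v z"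
    using ex_has_least_nat[of "\<lambda>y. y \<in> H" _ "d v"] halfspace_nonempty[OF H(1)] by blast
  have V: "y \<in> \<Union>X" using halfspace_subset[OF H(1)] y by blast
  have "v \<noteq> y" using H y by blast
  then obtain z where z: "adjacent X v z" "d v y = Suc (d z y)" using dist_neighbour v V by blast
  have zv: "adjacent X z v" using z(1) by (simp add: adjacent_sym)
  have zV: "z \<in> \<Union>X" using adjacent_vertex[OF z(1)] by blast
  have K: "side z v \<in> halfspaces X" "v \<notin> side z v" "y \<in> side z v"
    using halfspace_side[OF zv] side_ends[OF zv] z(2) dist_sym[OF V v] dist_sym[OF V zV]
    by (auto simp: side_iff[OF V])
  have "H \<subseteq> side z v"
  proof
    fix u assume u: "u \<in> H"
    then have "u \<in> \<Union>X" using halfspace_subset[OF H(1)] by blast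
    then show "u \<in> side z v"
      using between_halfspace'[OF v V _ _ K] halfspace_gate[OF v H(1) y u] by blast
  qed
  then show ?thesis using that z(1) by blast
qed

text \<open>For the complement of \<open>H\<close>, \<open>neighbour_towards_halfspace\<close>
  yields a half-space that contains \<open>x\<close>, lies in \<open>H\<close> and is bounded at an
  edge of \<open>x\<close>; minimality identifies it with \<open>H\<close>.\<close>

lemma flip_minimal:
  assumes x: "x \<in> \<Union>X" and H: "H \<in> halfspaces X" "x \<in> H"
    and min: "\<And>L. L \<in> halfspaces X \<Longrightarrow> x \<in> L \<Longrightarrow> L \<subseteq> H \<Longrightarrow> L = H"
  obtains x' where "adjacent X x x'" "H = side x x'"
proof -
  obtain z where z: "adjacent X x z" "\<Union>X - H \<subseteq> side z x"
    using neighbour_towards_halfspace[OF x halfspace_Diff[OF H(1)]] H by blast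
  have "\<Union>X - side z x = side x z" using side_Diff z(1) adjacent_sym by metis
  then have "side x z \<subseteq> H" using z(2) by blast
  then have "side x z = H" using min halfspace_side[OF z(1)] side_ends(1)[OF z(1)] by blast
  then show ?thesis using that z(1) by blast
qed

section \<open>Ultrafilters of half-spaces, and filling cubes\<close>

definition ultrafilter :: "'v set set \<Rightarrow> bool" where
  "ultrafilter U \<longleftrightarrow> U \<subseteq> halfspaces X \<and> (\<forall>H\<in>halfspaces X. (H \<in> U) \<noteq> (\<Union>X - H \<in> U)) \<and>
     (\<forall>H\<in>U. \<forall>K\<in>U. H \<inter> K \<noteq> {})"

definition principal :: "'v \<Rightarrow> 'v set set" where
  "principal v = {H \<in> halfspaces X. v \<in> H}"

lemma ultrafilter_upward:
  assumes U: "ultrafilter U" and H: "H \<in> U" "H \<subseteq> K" and K: "K \<in> halfspaces X"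
  shows "K \<in> U"
proof (rule ccontr)
  assume "K \<notin> U"
  then have "\<Union>X - K \<in> U" using U K by (auto simp: ultrafilter_def)
  then have "H \<inter> (\<Union>X - K) \<noteq> {}" using U H by (auto simp: ultrafilter_def)
  then show False using H by blast
qed

lemma ultrafilter_eqI:
  assumes U: "ultrafilter U" and v: "v \<in> \<Union>X" and sub: "U \<subseteq> principal v"
  shows "principal v = U"
proof
  show "principal v \<subseteq> U"
  proof
    fix H assume H: "H \<in> principal v"
    then have "\<Union>X - H \<notin> U" using sub by (auto simp: principal_def)
    then show "H \<in> U" using U H by (auto simp: ultrafilter_def principal_def)
  qed
qed (rule sub)

text \<open>While some half-space of \<open>U\<close> misses \<open>v\<close>, step over an edge at
  \<open>v\<close> whose far side contains it. Upward closure puts the far side into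
  \<open>U\<close>, so the step repairs one disagreement and creates none.\<close>

lemma ultrafilter_principal:
  "\<lbrakk>ultrafilter U; v \<in> \<Union>X; finite (U - principal v)\<rbrakk> \<Longrightarrow> \<exists>w\<in>\<Union>X. principal w = U"
proof (induction "card (U - principal v)" arbitrary: v rule: less_induct)
  case less
  note U = less.prems(1) and v = less.prems(2) and fin = less.prems(3)
  show ?case
  proof (cases "U - principal v = {}")
    case True
    then show ?thesis using ultrafilter_eqI[OF U v] v by blast
  next
    case False
    then obtain H where H: "H \<in> U - principal v"
      and max: "\<And>K. K \<in> U - principal v \<Longrightarrow> H \<subseteq> K \<Longrightarrow> H = K"
      using finite_has_maximal[OF fin] by blast
    have HH: "H \<in> halfspaces X" "v \<notin> H" using H U by (auto simp: principal_def ultrafilter_def)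
    obtain z where z: "adjacent X v z" "H \<subseteq> side z v"
      using neighbour_towards_halfspace[OF v HH] .
    have zv: "adjacent X z v" using z(1) by (simp add: adjacent_sym)
    have zV: "z \<in> \<Union>X" using adjacent_vertex[OF z(1)] by blast
    have KU: "side z v \<in> U" using ultrafilter_upward[OF U _ z(2) halfspace_side[OF zv]] H by blast
    have "side v z \<notin> U"
      using KU U halfspace_side[OF zv] side_Diff[OF zv] by (auto simp: ultrafilter_def)
    have sub: "U - principal z \<subseteq> U - principal v - {side z v}"
    proof
      fix L assume L: "L \<in> U - principal z"
      then have LH: "L \<in> halfspaces X" "z \<notin> L" using U by (auto simp: ultrafilter_def principal_def)
      have "v \<notin> L" using halfspace_edge[OF z(1) LH(1) _ LH(2)] L \<open>side v z \<notin> U\<close> by blast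
      then show "L \<in> U - principal v - {side z v}"
        using L LH side_ends[OF zv] by (auto simp: principal_def)
    qed
    moreover have K: "side z v \<in> U - principal v" using KU side_ends[OF zv] by (simp add: principal_def)
    ultimately have "card (U - principal z) < card (U - principal v)"
      using fin by (intro psubset_card_mono) auto
    moreover have "finite (U - principal z)" using sub fin finite_subset by blast
    ultimately show ?thesis using less.hyps[of z] U zV by blast
  qed
qed

text \<open>The flag condition at the corner \<open>w {}\<close> provides a cube with the right
  directions. That its other corners are the given vertices follows from
  \<open>square_unique\<close>, adding two directions at a time.\<close>

lemma cube_of_skeleton:
  fixes w :: "nat set \<Rightarrow> 'v"
  assumes inj: "inj_on w (Pow {..<n})" and wV: "w {} \<in> \<Union>X"
    and adj: "\<And>S i. S \<subseteq> {..<n} \<Longrightarrow> i < n \<Longrightarrow> i \<notin> S \<Longrightarrow> adjacent X (w S) (w (insert i S))"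
  shows "w ` Pow {..<n} \<in> X"
proof -
  have SQ: "square X (w S) (w (insert i S)) (w (insert i (insert j S))) (w (insert j S))"
    if "S \<subseteq> {..<n}" "i < n" "j < n" "i \<notin> S" "j \<notin> S" "i \<noteq> j" for S i j
  proof (rule four_cycle)
    show "adjacent X (w (insert i S)) (w (insert i (insert j S)))"
      using adj[of "insert i S" j] that by (simp add: insert_commute)
    show "adjacent X (w (insert j S)) (w (insert i (insert j S)))"
      using adj[of "insert j S" i] that by simp
    show "w S \<noteq> w (insert i (insert j S))"
    proof
      assume "w S = w (insert i (insert j S))"
      then have "S = insert i (insert j S)" by (rule inj_onD[OF inj]) (use that in auto)
      then show False using that by blast
    qed
    show "w (insert i S) \<noteq> w (insert j S)"
    proof
      assume "w (insert i S) = w (insert j S)"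
      then have "insert i S = insert j S" by (rule inj_onD[OF inj]) (use that in auto)
      then show False using that by blast
    qed
  qed (use adj that in auto)
  define v where "v = w {}"
  define N where "N = (\<lambda>i. w {i}) ` {..<n}"
  have "\<exists>c\<in>X. v \<in> c \<and> {u \<in> c. adjacent X v u} = N"
  proof (rule flag_cube[OF cubes flag_link])
    show "adjacent X v a" if "a \<in> N" for a using that adj[of "{}"] by (auto simp: v_def N_def)
    show "\<exists>p. square X v a p b" if "a \<in> N" "b \<in> N" "a \<noteq> b" for a b
      using that SQ[of "{}"] unfolding v_def N_def by fastforce
  qed (use wV in \<open>auto simp: v_def N_def\<close>)
  then obtain c where c: "c \<in> X" "v \<in> c" "{u \<in> c. adjacent X v u} = N" by blast
  obtain m f where f: "chart X c m f" "f {} = v" using cube_chart[OF cubes c(1,2)] .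
  have "\<exists>k<m. w {i} = f {k}" if "i < n" for i
  proof -
    have "w {i} \<in> {u \<in> c. adjacent X v u}" using c(3) that by (simp add: N_def)
    then show ?thesis using chart_neighbour[OF f(1), of "w {i}"] f(2) by simp
  qed
  then obtain \<pi> where \<pi>: "\<And>i. i < n \<Longrightarrow> \<pi> i < m \<and> w {i} = f {\<pi> i}" by metis
  have \<pi>_inj: "inj_on \<pi> {..<n}"
  proof
    fix i j assume ij: "i \<in> {..<n}" "j \<in> {..<n}" "\<pi> i = \<pi> j"
    then have "w {i} = w {j}" using \<pi>[of i] \<pi>[of j] by simp
    then have "{i} = {j}" by (rule inj_onD[OF inj]) (use ij in auto)
    then show "i = j" by simp
  qed
  have \<pi>_img: "\<pi> ` {..<n} = {..<m}"
  proof
    show "{..<m} \<subseteq> \<pi> ` {..<n}"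
    proof
      fix k assume k: "k \<in> {..<m}"
      have fk: "f {k} \<in> c" using chart_image[OF f(1)] k by auto
      have "adjacent X v (f {k})" using chart_adjacent[OF f(1), of "{}" "{k}"] k f(2) by auto
      then have "f {k} \<in> N" using c(3) fk by blast
      then obtain i where i: "i < n" "f {k} = w {i}" by (auto simp: N_def)
      then have "f {k} = f {\<pi> i}" using \<pi> by simp
      then have "{k} = {\<pi> i}" by (rule inj_onD[OF chart_inj[OF f(1)]]) (use k \<pi>[OF i(1)] in auto)
      then show "k \<in> \<pi> ` {..<n}" using i by simp
    qed
  qed (use \<pi> in auto)
  have "w S = f (\<pi> ` S)" if "S \<subseteq> {..<n}" for S
    using that
  proof (induction "card S" arbitrary: S rule: less_induct)
    case less
    have fS: "finite S" using less.prems finite_subset by blast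
    consider "S = {}" | i where "S = {i}" | i j T where "S = insert i (insert j T)" "i \<notin> T" "j \<notin> T" "i \<noteq> j"
      by (metis Set.set_insert insertI1 insert_iff equals0I)
    then show ?case
    proof cases
      case 1 then show ?thesis using f v_def by simp
    next
      case 2 then show ?thesis using \<pi> less.prems by simp
    next
      case (3 i j T)
      have sub: "T \<subseteq> {..<n}" "i < n" "j < n" using 3 less.prems by auto
      have fT: "finite T" using fS 3 by simp
      have "w T = f (\<pi> ` T)" "w (insert i T) = f (\<pi> ` insert i T)" "w (insert j T) = f (\<pi> ` insert j T)"
        using less.hyps[of T] less.hyps[of "insert i T"] less.hyps[of "insert j T"] 3 fT sub by auto
      note IH = this
      have ni: "\<pi> i \<notin> \<pi> ` T" "\<pi> j \<notin> \<pi> ` T" "\<pi> i \<noteq> \<pi> j"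
        using inj_onD[OF \<pi>_inj] 3 sub by blast+
      have e: "sym_diff (\<pi> ` T) {\<pi> i} = \<pi> ` insert i T" "sym_diff (\<pi> ` T) {\<pi> j} = \<pi> ` insert j T"
        "sym_diff (\<pi> ` T) {\<pi> i, \<pi> j} = \<pi> ` S"
        using ni 3(1) by auto
      have "square X (f (\<pi> ` T)) (f (\<pi> ` insert i T)) (f (\<pi> ` S)) (f (\<pi> ` insert j T))"
        using chart_square[OF f(1), of "\<pi> ` T" "\<pi> i" "\<pi> j"] ni \<pi> sub unfolding e by blast
      moreover have "square X (w T) (w (insert i T)) (w S) (w (insert j T))"
        using SQ[of T i j] 3 sub by simp
      ultimately show ?thesis using IH square_unique by simp
    qed
  qed
  then have "w ` Pow {..<n} = (\<lambda>S. f (\<pi> ` S)) ` Pow {..<n}" by (intro image_cong) auto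
  also have "\<dots> = f ` (image \<pi> ` Pow {..<n})" by (simp add: image_image)
  also have "\<dots> = f ` Pow {..<m}" using image_Pow_surj[OF \<pi>_img] by simp
  also have "\<dots> = c" using chart_image[OF f(1)] .
  finally show ?thesis using c by simp
qed

lemma adjacent_if_one_separator:
  assumes "x \<in> \<Union>X" "y \<in> \<Union>X" "separators x y = {H}"
  shows "adjacent X x y"
  using card_separators[OF assms(1,2)] dist_eq_1[OF assms(1,2)] assms(3) by simp

end

section \<open>Orbits of minimally displaced vertices\<close>

text \<open>\<open>T k\<close> stands for the action of the \<open>k\<close>-th power of the group
  element. Its laws are stated on vertices, where an action is prescribed.\<close>

locale cat0_translation = cat0_complex +
  fixes T :: "int \<Rightarrow> 'a \<Rightarrow> 'a"
  assumes T_zero: "x \<in> \<Union>X \<Longrightarrow> T 0 x = x"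
    and T_add: "x \<in> \<Union>X \<Longrightarrow> T (j + k) x = T j (T k x)"
    and T_cube: "c \<in> X \<Longrightarrow> T k ` c \<in> X"
    and T_no_inversion: "H \<in> halfspaces X \<Longrightarrow> T k ` H \<noteq> \<Union>X - H"
    and T_hyperbolic: "hyperbolic X (T 1)"
begin

section \<open>Isometries of the vertex set\<close>

lemma T_vertex: assumes "x \<in> \<Union>X" shows "T k x \<in> \<Union>X"
proof -
  obtain c where "c \<in> X" "x \<in> c" using assms by blast
  then show ?thesis using T_cube[of c k] by blast
qed

lemma T_inverse: "x \<in> \<Union>X \<Longrightarrow> T (- k) (T k x) = x"
  using T_add[of x "- k" k] T_zero by simp

lemma T_inverse': "x \<in> \<Union>X \<Longrightarrow> T k (T (- k) x) = x"
  using T_add[of x k "- k"] T_zero by simp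

lemma T_inj: "x \<in> \<Union>X \<Longrightarrow> y \<in> \<Union>X \<Longrightarrow> T k x = T k y \<Longrightarrow> x = y"
  using T_inverse by metis

lemma T_adjacent_imp: assumes "adjacent X x y" shows "adjacent X (T k x) (T k y)"
proof -
  have "x \<in> \<Union>X" "y \<in> \<Union>X" using adjacent_vertex[OF assms] by blast+
  then have "T k x \<noteq> T k y" using T_inj assms by (metis adjacent_def)
  moreover have "{T k x, T k y} \<in> X" using T_cube[of "{x, y}" k] assms by (simp add: adjacent_def)
  ultimately show ?thesis by (simp add: adjacent_def)
qed

lemma T_edge_path: assumes "edge_path X p" shows "edge_path X (map (T k) p)"
proof -
  have "set (map (T k) p) \<subseteq> \<Union>X" using assms T_vertex unfolding edge_path_def by fastforce
  moreover have "successively (adjacent X) (map (T k) p)"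
    unfolding successively_map
    by (rule successively_mono[of "adjacent X"]) (use assms T_adjacent_imp in \<open>auto simp: edge_path_def\<close>)
  ultimately show ?thesis using assms by (simp add: edge_path_def)
qed

lemma T_dist_le: assumes "x \<in> \<Union>X" "y \<in> \<Union>X" shows "d (T k x) (T k y) \<le> d x y"
proof -
  obtain p where p: "reduced_path p" "hd p = x" "last p = y" "length p = Suc (d x y)"
    using dist_path[OF assms] .
  then have "edge_path X (map (T k) p)" "p \<noteq> []" using T_edge_path by (auto simp: reduced_path_def)
  then show ?thesis using dist_le_path[of "map (T k) p"] p by (simp add: hd_map last_map)
qed

lemma T_dist: assumes "x \<in> \<Union>X" "y \<in> \<Union>X" shows "d (T k x) (T k y) = d x y"
  using T_dist_le[OF assms, of k] T_dist_le[OF T_vertex[OF assms(1), of k] T_vertex[OF assms(2), of k], of "- k"]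
    T_inverse[OF assms(1), of k] T_inverse[OF assms(2), of k]
  by simp

lemma T_image_iff:
  assumes "H \<subseteq> \<Union>X" "x \<in> \<Union>X" shows "x \<in> T k ` H \<longleftrightarrow> T (- k) x \<in> H"
proof
  assume "x \<in> T k ` H"
  then obtain y where y: "y \<in> H" "x = T k y" by blast
  then have "T (- k) x = y" using T_inverse assms(1) by blast
  then show "T (- k) x \<in> H" using y by simp
next
  assume "T (- k) x \<in> H"
  then have "T k (T (- k) x) \<in> T k ` H" by (rule imageI)
  then show "x \<in> T k ` H" using assms T_inverse' by simp
qed

lemma T_image_image: assumes "H \<subseteq> \<Union>X" shows "T j ` T k ` H = T (j + k) ` H"
  unfolding image_image by (rule image_cong[OF refl]) (use assms in \<open>simp add: T_add subset_iff\<close>)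

lemma T_image_zero: assumes "H \<subseteq> \<Union>X" shows "T 0 ` H = H"
proof -
  have "T 0 ` H = (\<lambda>x. x) ` H" by (rule image_cong[OF refl]) (use assms T_zero in blast)
  then show ?thesis by simp
qed

lemma T_image_vertices: "T k ` \<Union>X = \<Union>X"
proof
  show "T k ` \<Union>X \<subseteq> \<Union>X" using T_vertex by blast
  show "\<Union>X \<subseteq> T k ` \<Union>X" using T_image_iff[of "\<Union>X"] T_vertex by blast
qed

lemma T_image_Diff: assumes "H \<subseteq> \<Union>X" shows "T k ` (\<Union>X - H) = \<Union>X - T k ` H"
proof -
  have "inj_on (T k) (\<Union>X)" using T_inj by (blast intro: inj_onI)
  then have "T k ` (\<Union>X - H) = T k ` \<Union>X - T k ` H" using assms by (intro inj_on_image_set_diff) auto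
  then show ?thesis by (simp only: T_image_vertices)
qed

lemma T_side: assumes "adjacent X a b" shows "T k ` side a b = side (T k a) (T k b)"
proof -
  have V: "a \<in> \<Union>X" "b \<in> \<Union>X" using adjacent_vertex[OF assms] by blast+
  have *: "x \<in> T k ` side a b \<longleftrightarrow> x \<in> side (T k a) (T k b)" if x: "x \<in> \<Union>X" for x
  proof -
    have y: "T (- k) x \<in> \<Union>X" using T_vertex[OF x] .
    have "x \<in> T k ` side a b \<longleftrightarrow> d (T (- k) x) a < d (T (- k) x) b"
      using T_image_iff[OF side_subset x] side_iff[OF y] by blast
    then show ?thesis using T_dist[OF y V(1), of k] T_dist[OF y V(2), of k] side_iff[OF x] T_inverse'[OF x]
      by simp
  qed
  have sub: "T k ` side a b \<subseteq> \<Union>X" using side_subset T_vertex by blast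
  show ?thesis
  proof (rule subset_antisym; rule subsetI)
    fix x assume x: "x \<in> T k ` side a b"
    show "x \<in> side (T k a) (T k b)" using *[OF subsetD[OF sub x]] x by simp
  next
    fix x assume x: "x \<in> side (T k a) (T k b)"
    show "x \<in> T k ` side a b" using *[OF subsetD[OF side_subset x]] x by simp
  qed
qed

lemma T_halfspace: assumes "H \<in> halfspaces X" shows "T k ` H \<in> halfspaces X"
proof -
  obtain a b where "H = side a b" "adjacent X a b" using assms by (rule halfspaceE)
  then show ?thesis using T_side[of a b k] halfspace_side[OF T_adjacent_imp[of a b k]] by simp
qed

lemma mem_T: "H \<in> halfspaces X \<Longrightarrow> x \<in> \<Union>X \<Longrightarrow> x \<in> T k ` H \<longleftrightarrow> T (- k) x \<in> H"
  by (rule T_image_iff[OF halfspace_subset])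

section \<open>Minimal displacement and orbits\<close>

abbreviation t :: "'a \<Rightarrow> 'a" where "t \<equiv> T 1"

definition tlen :: nat where "tlen = translation_length X t"

definition Min_vertices :: "'a set" where "Min_vertices = {x \<in> \<Union>X. d x (t x) = tlen}"

lemma tlen_pos: "tlen > 0"
  using T_hyperbolic by (simp add: hyperbolic_def tlen_def)

lemma tlen_le: "x \<in> \<Union>X \<Longrightarrow> tlen \<le> d x (t x)"
  unfolding tlen_def translation_length_def by (rule Least_le) blast

lemma Min_vertices_nonempty: "Min_vertices \<noteq> {}"
proof -
  obtain x where "x \<in> \<Union>X" using simply_connected by (auto simp: simply_connected_complex_def)
  then have "\<exists>n. \<exists>x\<in>\<Union>X. d x (t x) = n" by blast
  then have "\<exists>x\<in>\<Union>X. d x (t x) = tlen"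
    unfolding tlen_def translation_length_def by (rule LeastI_ex)
  then show ?thesis by (auto simp: Min_vertices_def)
qed

lemma Min_vertex: "x \<in> Min_vertices \<Longrightarrow> x \<in> \<Union>X"
  unfolding Min_vertices_def by blast

lemma T_commute: "x \<in> \<Union>X \<Longrightarrow> T k (T j x) = T j (T k x)"
  using T_add[of x k j] T_add[of x j k] by (simp add: add.commute)

lemma T_Min_vertices: assumes "x \<in> Min_vertices" shows "T k x \<in> Min_vertices"
proof -
  have x: "x \<in> \<Union>X" "d x (t x) = tlen" using assms unfolding Min_vertices_def by blast+
  have "d (T k x) (t (T k x)) = tlen"
    using T_dist[OF x(1) T_vertex[OF x(1)], of k 1] T_commute[OF x(1), of k 1] x(2) by simp
  then show ?thesis using T_vertex[OF x(1)] unfolding Min_vertices_def by blast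
qed

text \<open>The half-spaces entered in one period, so that their number is the displacement of
  \<open>x\<close>.\<close>

definition crossed :: "'a \<Rightarrow> 'a set set" where "crossed x = separators (t x) x"

lemma crossed_iff: "H \<in> crossed x \<longleftrightarrow> H \<in> halfspaces X \<and> x \<notin> H \<and> t x \<in> H"
  by (auto simp: crossed_def separators_def)

lemma card_crossed: assumes "x \<in> \<Union>X" shows "finite (crossed x)" "card (crossed x) = d x (t x)"
  using card_separators[OF T_vertex[OF assms] assms] dist_sym[OF T_vertex[OF assms] assms]
  by (simp_all add: crossed_def)

lemma edge_same_side:
  assumes "adjacent X p q" "L \<in> halfspaces X" "L \<noteq> side p q" "L \<noteq> side q p"
  shows "p \<in> L \<longleftrightarrow> q \<in> L"
  using halfspace_edge[of p q L] halfspace_edge[of q p L] assms by (auto simp: adjacent_sym)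

text \<open>Haglund's argument. If the orbit of a minimally displaced vertex leaves a half-space that it
  entered, choose the earliest exit and an inclusion-minimal such half-space. Flipping it at
  \<open>t x\<close> gives a vertex whose displacement is smaller, or which is again minimal and exits sooner;
  the absence of inversions makes the flipped hyperplanes distinct.\<close>

lemma orbit_no_return:
  "\<lbrakk>N \<ge> 2; x \<in> Min_vertices; H \<in> crossed x; T (int N) x \<notin> H\<rbrakk> \<Longrightarrow> False"
proof (induction N arbitrary: x H rule: less_induct)
  case (less N)
  have xV: "x \<in> \<Union>X" using Min_vertex less.prems by blast
  note txV = T_vertex[OF xV, of 1]
  \<comment> \<open>The induction hypothesis excludes exits before time \<open>N\<close>.\<close>
  have stay: "T (int n) x \<in> L" if "L \<in> crossed x" "1 \<le> n" "n < N" for n L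
  proof (cases "n = 1")
    case True then show ?thesis using that by (simp add: crossed_iff)
  next
    case False then show ?thesis using less.IH[of n x L] less.prems that by force
  qed
  define F where "F = {L \<in> crossed x. T (int N) x \<notin> L}"
  have "finite F" "F \<noteq> {}" using card_crossed[OF xV] less.prems by (auto simp: F_def)
  then obtain K where K: "K \<in> F" and min: "\<And>L. L \<in> F \<Longrightarrow> L \<subseteq> K \<Longrightarrow> K = L"
    using finite_has_minimal[of F] by blast
  have KH: "K \<in> halfspaces X" "x \<notin> K" "t x \<in> K" "T (int N) x \<notin> K" and KD: "K \<in> crossed x"
    using K by (auto simp: F_def crossed_iff)
  obtain x' where x': "adjacent X (t x) x'" "K = side (t x) x'"
  \<comment> \<open>A smaller half-space containing \<open>t x\<close> also misses \<open>x\<close>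
    and \<open>T (int N) x\<close>. It therefore competes in \<open>F\<close>, and minimality there
    is minimality at \<open>t x\<close>.\<close>
  proof (rule flip_minimal[OF txV KH(1,3)])
    fix L assume "L \<in> halfspaces X" "t x \<in> L" "L \<subseteq> K"
    then have "L \<in> F" using KH by (auto simp: F_def crossed_iff)
    then show "L = K" using min \<open>L \<subseteq> K\<close> by blast
  qed
  have x'V: "x' \<in> \<Union>X" using adjacent_vertex[OF x'(1)] by blast
  have x'K: "x' \<notin> K" using side_ends[OF x'(1)] x'(2) by blast
  have sideK: "side x' (t x) = \<Union>X - K" using side_Diff[OF x'(1)] x'(2) by simp
  have adjT: "adjacent X (T k (t x)) (T k x')" for k using T_adjacent_imp[OF x'(1)] .
  have TK: "side (T k (t x)) (T k x') = T k ` K" for k using T_side[OF x'(1)] x'(2) by simp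
  have TK': "side (T k x') (T k (t x)) = \<Union>X - T k ` K" for k using side_Diff[OF adjT] TK by metis
  have same: "t x \<in> L \<longleftrightarrow> x' \<in> L" if "L \<in> halfspaces X" "L \<noteq> K" "L \<noteq> \<Union>X - K" for L
    using edge_same_side[OF x'(1) that(1)] that x'(2) sideK by simp
  have sameT: "T k (t x) \<in> L \<longleftrightarrow> T k x' \<in> L"
    if "L \<in> halfspaces X" "L \<noteq> T k ` K" "L \<noteq> \<Union>X - T k ` K" for L k
    using edge_same_side[OF adjT that(1)] that TK TK' by simp
  have tK: "t ` K \<in> halfspaces X" using T_halfspace KH(1) by blast
  have mem_tK: "t y \<in> t ` K \<longleftrightarrow> y \<in> K" if "y \<in> \<Union>X" for y
    using mem_T[OF KH(1) T_vertex[OF that], of 1 1] T_inverse[OF that] by simp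
  have "t ` K \<noteq> K" using mem_tK[OF xV] KH by auto
  moreover have "t ` K \<noteq> \<Union>X - K" using T_no_inversion KH(1) by blast
  ultimately have ne: "t ` K \<noteq> K" "t ` K \<noteq> \<Union>X - K" "K \<noteq> t ` K" "K \<noteq> \<Union>X - t ` K"
    using halfspace_Diff_Diff[OF tK] halfspace_Diff_Diff[OF KH(1)] by auto
  have ttx: "t (t x) \<in> t ` K" "t x \<notin> t ` K" using mem_tK[OF txV] mem_tK[OF xV] KH by auto
  have tx'K: "t x' \<notin> t ` K" "x' \<notin> t ` K"
    using mem_tK[OF x'V] x'K same[OF tK] ne ttx by auto
  have tx'V: "t x' \<in> \<Union>X" using T_vertex[OF x'V] .
  \<comment> \<open>\<open>x'\<close> differs from \<open>t x\<close> only across \<open>K\<close>,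
    and \<open>t x'\<close> from \<open>t (t x)\<close> only across the translate of
    \<open>K\<close>. Compared with \<open>t x\<close>, the vertex \<open>x'\<close> can gain at
    most \<open>K\<close> and loses the translate.\<close>
  have sub: "L \<in> crossed (t x) \<and> L \<noteq> t ` K" if L: "L \<in> crossed x'" "L \<noteq> K" for L
  proof -
    have LH: "L \<in> halfspaces X" "x' \<notin> L" "t x' \<in> L" using L by (auto simp: crossed_iff)
    have "L \<noteq> \<Union>X - K" using LH x'K x'V by blast
    moreover have "L \<noteq> t ` K" using LH tx'K by blast
    moreover have "L \<noteq> \<Union>X - t ` K" using LH tx'K x'V by blast
    ultimately show ?thesis using same[OF LH(1)] sameT[OF LH(1), of 1] LH L(2) by (simp add: crossed_iff)
  qed
  have tKD: "t ` K \<in> crossed (t x)" using ttx tK by (simp add: crossed_iff)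
  have "t x \<in> Min_vertices" using T_Min_vertices less.prems by blast
  then have fin: "finite (crossed (t x))" "card (crossed (t x)) = tlen"
    using card_crossed[OF txV] by (auto simp: Min_vertices_def)
  have less_tlen: "card (crossed (t x) - {t ` K}) < tlen"
    using card_Diff1_less[OF fin(1) tKD] fin(2) by simp
  have tt: "t (t x) = T 2 x" using T_add[OF xV, of 1 1] by simp
  have tx'K_iff: "t x' \<in> K \<longleftrightarrow> t (t x) \<in> K" using sameT[OF KH(1), of 1] ne by simp
  show False
  proof (cases "N = 2")
    case True
    then have "t x' \<notin> K" using tx'K_iff tt KH(4) by simp
    then have "K \<notin> crossed x'" by (simp add: crossed_iff)
    then have "crossed x' \<subseteq> crossed (t x) - {t ` K}" 
    proof (intro subsetI)
      fix L assume L: "L \<in> crossed x'"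
      then have "L \<noteq> K" using \<open>K \<notin> crossed x'\<close> by metis
      then show "L \<in> crossed (t x) - {t ` K}" using sub[OF L] by (intro DiffI) simp_all
    qed
    then have "card (crossed x') < tlen" using less_tlen fin(1) card_mono
      by (metis finite_Diff le_less_trans)
    then show False using tlen_le[OF x'V] card_crossed[OF x'V] by simp
  next
    case False
    then have N: "N \<ge> 3" using less.prems by simp
    then have "t x' \<in> K" using tx'K_iff tt stay[OF KD, of 2] by simp
    then have Kx': "K \<in> crossed x'" using x'K KH by (simp add: crossed_iff)
    have "crossed x' \<subseteq> insert K (crossed (t x) - {t ` K})" using sub by blast
    then have "card (crossed x') \<le> card (insert K (crossed (t x) - {t ` K}))"
      using fin(1) by (intro card_mono) auto
    also have "\<dots> \<le> Suc (card (crossed (t x) - {t ` K}))" by (rule card_insert_le_m1) auto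
    finally have "d x' (t x') = tlen"
      using less_tlen tlen_le[OF x'V] card_crossed[OF x'V] by simp
    then have "x' \<in> Min_vertices" using x'V unfolding Min_vertices_def by blast
    \<comment> \<open>Otherwise \<open>K\<close> would be the complement of one of its own
      translates, namely the one dual to the edge at that time, which is an inversion. So the new
      vertex has left \<open>K\<close> by time \<open>N - 1\<close>, against the induction
      hypothesis.\<close>
    moreover have "T (int (N - 1)) x' \<notin> K"
    proof
      assume a: "T (int (N - 1)) x' \<in> K"
      have "T (int (N - 1)) (t x) = T (int N) x"
        using T_add[OF xV, of "int (N - 1)" 1] N by (simp add: of_nat_diff)
      then have "K = side (T (int (N - 1)) x') (T (int (N - 1)) (t x))"
        using halfspace_edge[OF _ KH(1) a] adjT[of "int (N - 1)"] KH(4) by (simp add: adjacent_sym)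
      then have "K = \<Union>X - T (int (N - 1)) ` K" using TK' by simp
      then show False using T_no_inversion[OF KH(1)] halfspace_Diff_Diff[OF T_halfspace[OF KH(1)]]
        by metis
    qed
    moreover have "N - 1 < N" "2 \<le> N - 1" using N by auto
    ultimately show False using less.IH Kx' by blast
  qed
qed

lemma int_crossing:
  fixes i j :: int
  assumes "i \<le> j" "P i" "\<not> P j"
  shows "\<exists>k. i \<le> k \<and> k < j \<and> P k \<and> \<not> P (k + 1)"
  using assms(1,3)
proof (induction j rule: int_ge_induct)
  case base then show ?case using assms(2) by simp
next
  case (step j)
  show ?case
  proof (cases "P j")
    case True then show ?thesis using step by (intro exI[of _ j]) auto
  next
    case False
    then obtain k where "i \<le> k" "k < j" "P k" "\<not> P (k + 1)" using step.IH by blast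
    then show ?thesis by (intro exI[of _ k]) auto
  qed
qed

text \<open>For the past, the forward statement is applied to the complement: an earlier visit to
  \<open>H\<close> would end in an exit that is never undone, yet \<open>t x\<close> lies in
  \<open>H\<close>.\<close>

lemma orbit_iff:
  assumes x: "x \<in> Min_vertices" and H: "H \<in> crossed x"
  shows "T n x \<in> H \<longleftrightarrow> n \<ge> 1"
proof -
  have forward: "T n y \<in> K" if "y \<in> Min_vertices" "K \<in> crossed y" "n \<ge> 1" for n y K
  proof (cases "n = 1")
    case True then show ?thesis using that by (simp add: crossed_iff)
  next
    case False then show ?thesis using orbit_no_return[of "nat n" y K] that by force
  qed
  note xV = Min_vertex[OF x]
  have HH: "H \<in> halfspaces X" "x \<notin> H" "t x \<in> H" using H by (auto simp: crossed_iff)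
  have "T n x \<notin> H" if n: "n \<le> 0"
  proof
    assume "T n x \<in> H"
    then obtain k where k: "n \<le> k" "k < 0" "T k x \<in> H" "T (k + 1) x \<notin> H"
      using int_crossing[OF n, of "\<lambda>k. T k x \<in> H"] T_zero[OF xV] HH by auto
    have e: "t (T k x) = T (k + 1) x" using T_add[OF xV, of 1 k] by (simp add: add.commute)
    have "\<Union>X - H \<in> crossed (T k x)"
      using k HH halfspace_Diff T_vertex[OF xV] e by (simp add: crossed_iff)
    then have "T (1 - k) (T k x) \<in> \<Union>X - H" using forward[OF T_Min_vertices[OF x]] k(2) by force
    then show False using T_add[OF xV, of "1 - k" k] HH by simp
  qed
  then show ?thesis using forward[OF x H] by force
qed

text \<open>The set \<open>A\<^sub>g\<^sup>+\<close> described without axes;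
  \<open>pos_char_halfspaces_eq\<close> proves the agreement.\<close>

definition Pos :: "'a set set" where "Pos = (\<Union>x\<in>Min_vertices. crossed x)"

lemma Pos_halfspace: "H \<in> Pos \<Longrightarrow> H \<in> halfspaces X"
  by (auto simp: Pos_def crossed_iff)

text \<open>The orbits of \<open>x\<close> and \<open>z\<close> run in parallel: the times at which
  they disagree about \<open>H\<close> inject into the finitely many half-spaces separating
  \<open>x\<close> and \<open>z\<close>. Hence the orbit of \<open>z\<close> also passes from
  outside \<open>H\<close> to inside.\<close>

lemma orbit_crossing:
  assumes z: "z \<in> Min_vertices" and H: "H \<in> Pos"
  shows "\<exists>k. \<forall>n. T n z \<in> H \<longleftrightarrow> n > k"
proof -
  obtain x where x: "x \<in> Min_vertices" "H \<in> crossed x" using H by (auto simp: Pos_def)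
  have HH: "H \<in> halfspaces X" using H by (rule Pos_halfspace)
  note zV = Min_vertex[OF z] and xV = Min_vertex[OF x(1)]
  note orb = orbit_iff[OF x]
  define B where "B = {n. (T n x \<in> H) \<noteq> (T n z \<in> H)}"
  have "(\<lambda>n. T (- n) ` H) ` B \<subseteq> separators x z \<union> separators z x"
  proof
    fix K assume "K \<in> (\<lambda>n. T (- n) ` H) ` B"
    then obtain n where n: "K = T (- n) ` H" "(T n x \<in> H) \<noteq> (T n z \<in> H)" by (auto simp: B_def)
    then have "(x \<in> K) \<noteq> (z \<in> K)" using mem_T[OF HH xV, of "- n"] mem_T[OF HH zV, of "- n"] by simp
    then show "K \<in> separators x z \<union> separators z x"
      using T_halfspace[OF HH, of "- n"] n(1) by (auto simp: separators_def)
  qed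
  moreover have "finite (separators x z \<union> separators z x)" using card_separators xV zV by blast
  moreover have "inj_on (\<lambda>n. T (- n) ` H) B"
  proof
    fix m n assume e: "T (- m) ` H = T (- n) ` H"
    have "T i x \<in> T (- j) ` H \<longleftrightarrow> i + j \<ge> 1" for i j
      using mem_T[OF HH T_vertex[OF xV], of i "- j"] T_add[OF xV, of j i] orb[of "j + i"]
      by (simp add: add.commute)
    then have "i + m \<ge> 1 \<longleftrightarrow> i + n \<ge> 1" for i using e by blast
    from this[of "1 - m"] this[of "1 - n"] show "m = n" by simp
  qed
  ultimately have "finite B" by (metis finite_imageD finite_subset)
  then obtain b where b: "\<And>n. n \<in> B \<Longrightarrow> \<bar>n\<bar> \<le> b"
    by (metis finite_nat_set_iff_bounded_le finite_imageI image_eqI Max_ge)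
  \<comment> \<open>Beyond all disagreements in both directions, and at least 1, so that the orbit
    of \<open>x\<close> is inside \<open>H\<close> at time \<open>c\<close> and outside at time
    \<open>- c\<close>.\<close>
  define c where "c = max 1 (b + 1)"
  have "c \<notin> B" "- c \<notin> B" using b[of c] b[of "- c"] by (auto simp: c_def)
  then have "T c z \<in> H" "T (- c) z \<notin> H" using orb[of c] orb[of "- c"] by (auto simp: B_def c_def)
  moreover have "- c \<le> c" by (simp add: c_def)
  ultimately obtain k where k: "T k z \<notin> H" "T (k + 1) z \<in> H"
    using int_crossing[of "- c" c "\<lambda>n. T n z \<notin> H"] by blast
  have "t (T k z) = T (k + 1) z" using T_add[OF zV, of 1 k] by (simp add: add.commute)
  then have "H \<in> crossed (T k z)" using k HH by (simp add: crossed_iff)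
  note orbz = orbit_iff[OF T_Min_vertices[OF z] this]
  have "T n z \<in> H \<longleftrightarrow> n > k" for n
    using orbz[of "n - k"] T_add[OF zV, of "n - k" k] by auto
  then show ?thesis by blast
qed

end

section \<open>Axes and characteristic half-spaces\<close>

context cat0_translation
begin

section \<open>Axes through minimally displaced vertices\<close>

lemma crossing_at:
  assumes x: "x \<in> Min_vertices" and H: "H \<in> halfspaces X" "T k x \<notin> H" "T (k + 1) x \<in> H"
  shows "H \<in> Pos" "T n x \<in> H \<longleftrightarrow> n > k"
proof -
  note xV = Min_vertex[OF x] and Tx = T_Min_vertices[OF x, of k]
  have "t (T k x) = T (k + 1) x" using T_add[OF xV, of 1 k] by (simp add: add.commute)
  then have c: "H \<in> crossed (T k x)" using H by (simp add: crossed_iff)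
  then show "H \<in> Pos" using Tx by (auto simp: Pos_def)
  show "T n x \<in> H \<longleftrightarrow> n > k"
    using orbit_iff[OF Tx c, of "n - k"] T_add[OF xV, of "n - k" k] by auto
qed

text \<open>A half-space once entered is kept, so each period contributes \<open>tlen\<close> new
  ones.\<close>

lemma dist_orbit: assumes x: "x \<in> Min_vertices" shows "m * tlen \<le> d x (T (int m) x)"
proof -
  note xV = Min_vertex[OF x]
  have "m * tlen \<le> card (separators (T (int m) x) x)"
  proof (induction m)
    case (Suc m)
    let ?S = "separators (T (int m) x) x" and ?C = "crossed (T (int m) x)"
    let ?S' = "separators (T (int (Suc m)) x) x"
    have e: "t (T (int m) x) = T (int (Suc m)) x" using T_add[OF xV, of 1 "int m"] by simp
    have "H \<in> ?S'" if H: "H \<in> ?S" for H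
    proof -
      have HH: "H \<in> halfspaces X" "T (int m) x \<in> H" "x \<notin> H" using H by (auto simp: separators_def)
      then obtain k where k: "0 \<le> k" "k < int m" "T k x \<notin> H" "T (k + 1) x \<in> H"
        using int_crossing[of 0 "int m" "\<lambda>n. T n x \<notin> H"] T_zero[OF xV] by auto
      then have "T (int (Suc m)) x \<in> H" 
        using crossing_at(2)[OF x HH(1) k(3,4), of "int (Suc m)"] k(2) by simp
      then show ?thesis using HH by (simp add: separators_def)
    qed
    moreover have "H \<in> ?S'" if H: "H \<in> ?C" for H
    proof -
      have "H \<in> halfspaces X" "T (int m) x \<notin> H" "T (int m + 1) x \<in> H"
        using H e by (auto simp: crossed_iff add.commute)
      then show ?thesis using crossing_at(2)[OF x, of H "int m" 0] T_zero[OF xV]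
        by (simp add: separators_def add.commute)
    qed
    ultimately have sub: "?S \<union> ?C \<subseteq> ?S'" by blast
    have disj: "?S \<inter> ?C = {}" by (auto simp: separators_def crossed_iff)
    have fin: "finite ?S" "finite ?C" "finite ?S'"
      using card_separators[OF T_vertex[OF xV, of "int m"] xV]
        card_separators[OF T_vertex[OF xV, of "int (Suc m)"] xV]
        card_crossed(1)[OF T_vertex[OF xV, of "int m"]]
      by (simp_all only:)
    have "card ?C = tlen" using card_crossed T_Min_vertices[OF x] unfolding Min_vertices_def by auto
    then have "Suc m * tlen \<le> card ?S + card ?C" using Suc by simp
    also have "\<dots> = card (?S \<union> ?C)" using card_Un_disjoint[OF fin(1,2) disj] by simp
    also have "\<dots> \<le> card ?S'" using sub fin by (intro card_mono)
    finally show ?case .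
  qed simp
  then show ?thesis using card_separators[OF T_vertex[OF xV] xV] dist_sym[OF T_vertex[OF xV] xV] by simp
qed

lemma axis_Min_vertex:
  assumes "combinatorial_axis X t \<gamma>" shows "\<gamma> i \<in> Min_vertices"
proof -
  have "\<gamma> i \<in> \<Union>X" using assms unfolding combinatorial_axis_def by blast
  moreover have "int (d (\<gamma> i) (t (\<gamma> i))) = \<bar>i - (i + int tlen)\<bar>"
    using assms unfolding combinatorial_axis_def tlen_def by metis
  ultimately show ?thesis unfolding Min_vertices_def by simp
qed

text \<open>By convexity, a half-space entered on one edge of an axis still contains the vertex a
  full period after the start of that edge.\<close>

lemma axis_crossing:
  assumes \<gamma>: "combinatorial_axis X t \<gamma>" and H: "H \<in> halfspaces X" "\<gamma> i \<notin> H" "\<gamma> (i + 1) \<in> H"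
  shows "H \<in> Pos"
proof -
  have V: "\<gamma> j \<in> \<Union>X" for j using Min_vertex[OF axis_Min_vertex[OF \<gamma>]] .
  have dd: "int (d (\<gamma> j) (\<gamma> k)) = \<bar>j - k\<bar>" for j k using \<gamma> unfolding combinatorial_axis_def by blast
  have "int (d (\<gamma> i) (\<gamma> (i + int tlen))) =
      int (d (\<gamma> i) (\<gamma> (i + 1)) + d (\<gamma> (i + 1)) (\<gamma> (i + int tlen)))"
    unfolding of_nat_add dd using tlen_pos by simp
  then have "d (\<gamma> i) (\<gamma> (i + int tlen)) = d (\<gamma> i) (\<gamma> (i + 1)) + d (\<gamma> (i + 1)) (\<gamma> (i + int tlen))"
    by (simp only: of_nat_eq_iff)
  from between_halfspace'[OF V V V this H] have "\<gamma> (i + int tlen) \<in> H" .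
  then have "t (\<gamma> i) \<in> H" using \<gamma> unfolding combinatorial_axis_def tlen_def by simp
  then have "H \<in> crossed (\<gamma> i)" using H by (simp add: crossed_iff)
  then show ?thesis using axis_Min_vertex[OF \<gamma>] unfolding Pos_def by blast
qed

text \<open>The axis concatenates the translates of one geodesic from \<open>x\<close> to
  \<open>t x\<close>. It is geodesic because \<open>dist_orbit\<close> forces this for long pieces
  between orbit points.\<close>

lemma axis_through:
  assumes x: "x \<in> Min_vertices"
  obtains \<gamma> where "combinatorial_axis X t \<gamma>" "\<gamma> 0 = x"
proof -
  note xV = Min_vertex[OF x]
  define L where "L = int tlen"
  have L: "L > 0" using tlen_pos by (simp add: L_def)
  obtain p where p: "reduced_path p" "hd p = x" "last p = t x" "length p = Suc (d x (t x))"
    using dist_path[OF xV T_vertex[OF xV]] .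
  have len: "length p = Suc tlen" using p x by (simp add: Min_vertices_def)
  then have ne: "p \<noteq> []" by auto
  have p0: "p ! 0 = x" using p ne by (simp add: hd_conv_nth)
  have pl: "p ! tlen = t x" using p ne len by (simp add: last_conv_nth)
  have pV: "p ! r \<in> \<Union>X" if "r \<le> tlen" for r
  proof -
    have "p ! r \<in> set p" using that len by (intro nth_mem) simp
    moreover have "set p \<subseteq> \<Union>X" using p(1) by (simp add: reduced_path_def edge_path_def)
    ultimately show ?thesis by blast
  qed
  have padj: "adjacent X (p ! r) (p ! Suc r)" if "r < tlen" for r
    using p(1) that len unfolding reduced_path_def edge_path_def by (auto simp: successively_conv_nth)
  define \<gamma> where "\<gamma> i = T (i div L) (p ! nat (i mod L))" for i
  have md: "0 \<le> i mod L" "i mod L < L" for i using L by simp_all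
  have mdn: "nat (i mod L) < tlen" for i using md[of i] by (simp add: L_def)
  have V: "\<gamma> i \<in> \<Union>X" for i unfolding \<gamma>_def using T_vertex[OF pV] mdn less_imp_le by blast
  have shift: "\<gamma> (i + L) = t (\<gamma> i)" for i
  proof -
    have "(i + L) div L = 1 + i div L" "(i + L) mod L = i mod L" using L by (simp_all add: div_add_self2)
    then show ?thesis unfolding \<gamma>_def using T_add[OF pV[OF less_imp_le[OF mdn]], of 1 "i div L"] by simp
  qed
  have step: "adjacent X (\<gamma> i) (\<gamma> (i + 1))" for i
  proof -
    let ?r = "nat (i mod L)"
    have a: "adjacent X (T (i div L) (p ! ?r)) (T (i div L) (p ! Suc ?r))"
      using T_adjacent_imp[OF padj[OF mdn]] .
    have dec: "i + 1 = (i div L) * L + (i mod L + 1)" by simp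
    have "\<gamma> (i + 1) = T (i div L) (p ! Suc ?r)"
    \<comment> \<open>At the end of a period, the last vertex of one translate is the first vertex
      of the next.\<close>
    proof (cases "i mod L + 1 = L")
      case True
      then have "i + 1 = (i div L + 1) * L" using dec by (simp add: algebra_simps)
      then have "(i + 1) div L = i div L + 1" "(i + 1) mod L = 0" using L by simp_all
      then have "\<gamma> (i + 1) = T (i div L + 1) x" unfolding \<gamma>_def using p0 by simp
      also have "\<dots> = T (i div L) (t x)" using T_add[OF xV] by blast
      also have "Suc ?r = tlen" using True md[of i] by (simp add: L_def)
      ultimately show ?thesis using pl by simp
    next
      case False
      then have r: "0 \<le> i mod L + 1" "i mod L + 1 < L" using md[of i] by auto
      have "(i + 1) div L = i div L" "(i + 1) mod L = i mod L + 1"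
        using r dec L by (metis div_pos_pos_trivial div_mult_self3 add.right_neutral less_irrefl add.commute,
            metis mod_add_left_eq mod_pos_pos_trivial)
      then show ?thesis unfolding \<gamma>_def using md[of i] by (simp add: nat_add_distrib)
    qed
    then show ?thesis using a unfolding \<gamma>_def by simp
  qed
  have upper: "int (d (\<gamma> i) (\<gamma> (i + int n))) \<le> int n" for i n
  proof (induction n)
    case 0 then show ?case using dist_refl[OF V] by simp
  next
    case (Suc n)
    have "d (\<gamma> (i + int n)) (\<gamma> (i + int n + 1)) = 1" using dist_eq_1[OF V V] step by blast
    then show ?case using Suc dist_triangle[OF V V V, of i "i + int (Suc n)" "i + int n"]
      by (simp add: add.commute add.left_commute)
  qed
  have g0: "\<gamma> (k * L) = T k x" for k unfolding \<gamma>_def using L p0 by simp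
  have ge: "j - i \<le> int (d (\<gamma> i) (\<gamma> j))" if "i \<le> j" for i j
  proof -
    \<comment> \<open>Large enough for \<open>i\<close> and \<open>j\<close> to lie between
      \<open>- n * L\<close> and \<open>n * L\<close>. The ends of this window are orbit points at
      distance at least \<open>2 * n * L\<close>, which leaves no room for a shortcut
      inside.\<close>
    define n where "n = nat (\<bar>i\<bar> + \<bar>j\<bar>)"
    have nL: "int n \<le> int n * L" using L mult_left_mono[of 1 L "int n"] by simp
    moreover have "- int n \<le> i" "j \<le> int n" by (auto simp: n_def)
    ultimately have n: "- int n * L \<le> i" "j \<le> int n * L" by linarith+
    have "int (2 * n) * L \<le> int (d (T (- int n) x) (T (int (2 * n)) (T (- int n) x)))"
      using dist_orbit[OF T_Min_vertices[OF x], of "2 * n" "- int n"]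
      unfolding L_def by (metis of_nat_le_iff of_nat_mult)
    moreover have "T (int (2 * n)) (T (- int n) x) = T (int n) x"
      using T_add[OF xV, of "int (2 * n)" "- int n"] by simp
    ultimately have "int (2 * n) * L \<le> int (d (\<gamma> (- int n * L)) (\<gamma> (int n * L)))"
      unfolding g0 by simp
    also have "\<dots> \<le> int (d (\<gamma> (- int n * L)) (\<gamma> i)) + int (d (\<gamma> i) (\<gamma> j)) + int (d (\<gamma> j) (\<gamma> (int n * L)))"
      using dist_triangle[OF V V V, of "- int n * L" "int n * L" i]
        dist_triangle[OF V V V, of i "int n * L" j] by simp
    also have "int (d (\<gamma> (- int n * L)) (\<gamma> i)) \<le> i + int n * L"
      using upper[of "- int n * L" "nat (i + int n * L)"] n by simp
    also have "int (d (\<gamma> j) (\<gamma> (int n * L))) \<le> int n * L - j"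
      using upper[of j "nat (int n * L - j)"] n by simp
    finally show ?thesis by simp
  qed
  have eq: "int (d (\<gamma> i) (\<gamma> j)) = j - i" if "i \<le> j" for i j
    using ge[OF that] upper[of i "nat (j - i)"] that by simp
  have "int (d (\<gamma> i) (\<gamma> j)) = \<bar>i - j\<bar>" for i j
    using eq[of i j] eq[of j i] dist_sym[OF V V, of i j] by (cases "i \<le> j") auto
  then have "combinatorial_axis X t \<gamma>"
    unfolding combinatorial_axis_def using V shift by (auto simp: L_def tlen_def)
  moreover have "\<gamma> 0 = x" using g0[of 0] T_zero[OF xV] by simp
  ultimately show ?thesis using that by blast
qed

lemma pos_char_halfspaces_eq: "pos_char_halfspaces X t = Pos"
proof
  show "pos_char_halfspaces X t \<subseteq> Pos"
    using axis_crossing unfolding pos_char_halfspaces_def by blast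
  show "Pos \<subseteq> pos_char_halfspaces X t"
  proof
    fix H assume H: "H \<in> Pos"
    then obtain x where x: "x \<in> Min_vertices" "H \<in> crossed x" by (auto simp: Pos_def)
    then have HH: "H \<in> halfspaces X" "x \<notin> H" "t x \<in> H" by (auto simp: crossed_iff)
    obtain \<gamma> where \<gamma>: "combinatorial_axis X t \<gamma>" "\<gamma> 0 = x" using axis_through[OF x(1)] .
    have "t (\<gamma> 0) = \<gamma> (0 + int tlen)" using \<gamma>(1) unfolding combinatorial_axis_def tlen_def by blast
    then obtain k where "\<gamma> k \<notin> H" "\<gamma> (k + 1) \<in> H"
      using int_crossing[of 0 "int tlen" "\<lambda>n. \<gamma> n \<notin> H"] HH \<gamma>(2) by auto
    then show "H \<in> pos_char_halfspaces X t" using \<gamma>(1) HH(1) unfolding pos_char_halfspaces_def by blast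
  qed
qed

section \<open>Invariance of the characteristic half-spaces\<close>

abbreviation char_set :: "'a set set" where "char_set \<equiv> char_halfspaces X t"

lemma char_set_eq: "char_set = Pos \<union> (\<lambda>H. \<Union>X - H) ` Pos"
  by (simp add: char_halfspaces_def pos_char_halfspaces_eq)

lemma char_halfspace: "H \<in> char_set \<Longrightarrow> H \<in> halfspaces X"
  using Pos_halfspace halfspace_Diff by (auto simp: char_set_eq)

lemma char_Diff: assumes "H \<in> char_set" shows "\<Union>X - H \<in> char_set"
  using assms unfolding char_set_eq
proof
  assume "H \<in> (\<lambda>H. \<Union>X - H) ` Pos"
  then obtain K where "K \<in> Pos" "H = \<Union>X - K" by blast
  then show "\<Union>X - H \<in> Pos \<union> (\<lambda>H. \<Union>X - H) ` Pos" using halfspace_Diff_Diff[OF Pos_halfspace] by simp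
qed blast

lemma char_Diff_iff: "H \<in> halfspaces X \<Longrightarrow> \<Union>X - H \<in> char_set \<longleftrightarrow> H \<in> char_set"
  using char_Diff halfspace_Diff_Diff by metis

lemma T_Pos: assumes "H \<in> Pos" shows "T k ` H \<in> Pos"
proof -
  obtain x where x: "x \<in> Min_vertices" "H \<in> crossed x" using assms by (auto simp: Pos_def)
  note xV = Min_vertex[OF x(1)]
  have HH: "H \<in> halfspaces X" "x \<notin> H" "t x \<in> H" using x by (auto simp: crossed_iff)
  have "T k x \<notin> T k ` H" using mem_T[OF HH(1) T_vertex[OF xV], of k k] T_inverse[OF xV] HH by simp
  moreover have "t (T k x) \<in> T k ` H"
    using mem_T[OF HH(1) T_vertex[OF T_vertex[OF xV]], of 1 k k] T_commute[OF xV, of 1 k]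
      T_inverse[OF T_vertex[OF xV]] HH by simp
  ultimately have "T k ` H \<in> crossed (T k x)" using T_halfspace[OF HH(1)] by (simp add: crossed_iff)
  then show ?thesis using T_Min_vertices[OF x(1)] unfolding Pos_def by blast
qed

lemma T_char: assumes "H \<in> char_set" shows "T k ` H \<in> char_set"
  using assms unfolding char_set_eq
proof
  assume "H \<in> (\<lambda>H. \<Union>X - H) ` Pos"
  then obtain K where "K \<in> Pos" "H = \<Union>X - K" by blast
  then show "T k ` H \<in> Pos \<union> (\<lambda>H. \<Union>X - H) ` Pos"
    using T_image_Diff[OF halfspace_subset[OF Pos_halfspace]] T_Pos by simp
qed (use T_Pos in blast)

text \<open>A passage of the orbit into or out of \<open>K\<close> would put \<open>K\<close> or its
  complement into \<open>Pos\<close>.\<close>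

lemma orbit_avoids_non_char:
  assumes v: "v \<in> Min_vertices" and K: "K \<in> halfspaces X" "K \<notin> char_set"
  shows "T n v \<in> K \<longleftrightarrow> v \<in> K"
proof -
  have step: "T (k + 1) v \<in> L" if L: "L \<in> halfspaces X" "L \<notin> char_set" "T k v \<in> L" for k L
  proof (rule ccontr)
    assume "T (k + 1) v \<notin> L"
    then have "\<Union>X - L \<in> Pos"
      using crossing_at(1)[OF v halfspace_Diff[OF L(1)], of k] L T_vertex[OF Min_vertex[OF v]] by blast
    then show False using L char_Diff_iff[OF L(1)] unfolding char_set_eq by blast
  qed
  have iff: "T (k + 1) v \<in> K \<longleftrightarrow> T k v \<in> K" for k
    using step[OF K, of k] step[OF halfspace_Diff[OF K(1)], of k] char_Diff_iff[OF K(1)] K(2)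
      T_vertex[OF Min_vertex[OF v]] by blast
  show ?thesis
  proof (induction n rule: int_induct[of _ 0])
    case base then show ?case using T_zero[OF Min_vertex[OF v]] by simp
  next
    case (step1 i) then show ?case using iff by simp
  next
    case (step2 i) then show ?case using iff[of "i - 1"] by simp
  qed
qed

end

section \<open>The essential characteristic set\<close>

context cat0_translation
begin

section \<open>Projection to the essential characteristic set\<close>

abbreviation proj :: "'a \<Rightarrow> 'a set set" where "proj \<equiv> ess_proj X t"

abbreviation ess_vertices :: "'a set set set" where
  "ess_vertices \<equiv> sageev_vertices (\<Union>X) char_set"

lemma mem_proj: "H \<in> proj v \<longleftrightarrow> H \<in> char_set \<and> v \<in> H"
  using char_halfspace by (auto simp: ess_proj_def)

lemma descending_strict:
  fixes h :: "nat \<Rightarrow> 'b set"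
  assumes "\<And>n. h (Suc n) \<subset> h n" shows "m < n \<Longrightarrow> h n \<subset> h m"
proof (induction n)
  case (Suc n)
  then show ?case using assms[of n] by (cases "m = n") auto
qed simp

text \<open>For the descending chain condition: a vertex outside the first member of a chain is
  separated from \<open>v\<close> by all members, and only finitely many half-spaces separate two
  vertices.\<close>

lemma proj_ess_vertex: assumes v: "v \<in> \<Union>X" shows "proj v \<in> ess_vertices"
proof -
  have "descending_chain_condition (proj v)"
    unfolding descending_chain_condition_def
  proof
    assume "\<exists>h::nat \<Rightarrow> 'a set. \<forall>n. h n \<in> proj v \<and> h (Suc n) \<subset> h n"
    then obtain h :: "nat \<Rightarrow> 'a set" where h: "\<And>n. h n \<in> proj v" "\<And>n. h (Suc n) \<subset> h n" by blast
    note desc = descending_strict[of h, OF h(2)]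
    have H: "h n \<in> halfspaces X" "v \<in> h n" for n
      using h(1)[of n] char_halfspace by (auto simp: mem_proj)
    obtain u where u: "u \<in> \<Union>X" "u \<notin> h 0"
      using halfspace_nonempty[OF halfspace_Diff[OF H(1)[of 0]]] by blast
    have "u \<notin> h n" for n using u desc[of 0 n] by (cases "n = 0") auto
    then have "range h \<subseteq> separators v u" using H by (auto simp: separators_def)
    then have "finite (range h)" using card_separators[OF v u(1)] finite_subset by metis
    moreover have "inj h" using desc by (metis injI linorder_neqE_nat psubset_eq)
    ultimately show False using finite_imageD infinite_UNIV_nat by blast
  qed
  moreover have "(H \<in> proj v) \<noteq> (\<Union>X - H \<in> proj v)" if "H \<in> char_set" for H
    using that char_Diff[OF that] v by (auto simp: mem_proj)
  ultimately show ?thesis unfolding sageev_vertices_def by (auto simp: mem_proj)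
qed

lemma ess_vertex_in_complex: assumes "U \<in> ess_vertices" shows "U \<in> \<Union>(ess_char_set X t)"
proof -
  have "(\<lambda>S. U) ` Pow {..<0::nat} \<in> ess_char_set X t"
    unfolding ess_char_set_def sageev_complex_def
    by (rule CollectI, rule exI[of _ "0::nat"], rule exI[of _ "\<lambda>S. U"]) (use assms in auto)
  then show ?thesis by auto
qed

lemma ess_char_set_vertices: "\<Union>(ess_char_set X t) = ess_vertices"
proof
  show "\<Union>(ess_char_set X t) \<subseteq> ess_vertices"
    unfolding ess_char_set_def sageev_complex_def by blast
qed (use ess_vertex_in_complex in blast)

lemma ess_upward:
  assumes U: "U \<in> ess_vertices" and H: "H \<in> U" "H \<subseteq> K" and K: "K \<in> char_set"
  shows "K \<in> U"
proof (rule ccontr)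
  assume "K \<notin> U"
  then have "\<Union>X - K \<in> U" using U K unfolding sageev_vertices_def by blast
  then have "H \<inter> (\<Union>X - K) \<noteq> {}" using U H unfolding sageev_vertices_def by blast
  then show False using H by blast
qed

lemma min_set_vertices: "c \<in> min_set X t \<longleftrightarrow> c \<in> X \<and> c \<subseteq> Min_vertices"
  by (auto simp: min_set_def Min_vertices_def tlen_def)

lemma Pos_char: "H \<in> Pos \<Longrightarrow> H \<in> char_set"
  by (simp add: char_set_eq)

lemma proj_translate:
  assumes v: "v \<in> Min_vertices" and H: "H \<in> Pos" and tH: "t ` H \<in> proj v"
  shows "H \<in> proj v"
proof -
  note vV = Min_vertex[OF v]
  obtain k where k: "\<And>n. T n v \<in> H \<longleftrightarrow> n > k" using orbit_crossing[OF v H] by blast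
  have "v \<in> t ` H" using tH by (simp add: mem_proj)
  then have "T (- 1) v \<in> H" using mem_T[OF Pos_halfspace[OF H] vV] by blast
  then have "v \<in> H" using k[of "- 1"] k[of 0] T_zero[OF vV] by simp
  then show ?thesis using Pos_char[OF H] by (simp add: mem_proj)
qed

text \<open>The premise empties one of the four quadrants. For complements of positive half-spaces
  the same set of vertices appears as a different quadrant, so one premise serves both
  kinds.\<close>

lemma nontransverse_if:
  assumes *: "\<And>H U. H \<in> Pos \<Longrightarrow> U \<in> ess_vertices \<Longrightarrow> t ` H \<in> U \<Longrightarrow> H \<in> U"
  shows "acts_nontransversely_ess X t"
  unfolding acts_nontransversely_ess_def Let_def ess_char_set_vertices
proof
  fix H assume H: "H \<in> char_set"
  let ?S = "sageev_halfspace (ess_char_set X t)"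
  have S: "U \<in> ?S K \<longleftrightarrow> U \<in> ess_vertices \<and> K \<in> U" for U K
    unfolding sageev_halfspace_def ess_char_set_vertices by blast
  have D: "\<Union>X - K \<in> U \<longleftrightarrow> K \<notin> U" if "U \<in> ess_vertices" "K \<in> char_set" for U K
    using that unfolding sageev_vertices_def by blast
  from H[unfolded char_set_eq] show "\<not> transverse ess_vertices (?S H) (?S (t ` H))"
  proof
    assume "H \<in> Pos"
    then have "(ess_vertices - ?S H) \<inter> ?S (t ` H) = {}" using * S by blast
    then show ?thesis unfolding transverse_def by blast
  next
    assume "H \<in> (\<lambda>H. \<Union>X - H) ` Pos"
    then obtain K where K: "K \<in> Pos" "H = \<Union>X - K" by blast
    have "t ` H = \<Union>X - t ` K" using T_image_Diff[OF halfspace_subset[OF Pos_halfspace]] K by simp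
    have "U \<in> ?S (t ` H)" if "U \<in> ?S H" for U
    proof -
      have U: "U \<in> ess_vertices" "\<Union>X - K \<in> U" using that S K(2) by simp_all
      then have "K \<notin> U" using D Pos_char[OF K(1)] by blast
      then have "t ` K \<notin> U" using *[OF K(1) U(1)] by blast
      then have "\<Union>X - t ` K \<in> U" using D[OF U(1)] Pos_char[OF T_Pos[OF K(1)]] by blast
      then show ?thesis using S U(1) \<open>t ` H = \<Union>X - t ` K\<close> by simp
    qed
    then have "?S H \<inter> (ess_vertices - ?S (t ` H)) = {}" by blast
    then show ?thesis unfolding transverse_def by blast
  qed
qed

text \<open>A minimally displaced orbit enters \<open>H\<close> and its translate one period apart
  and so meets three quadrants; a vertex of the translate outside \<open>H\<close> would occupy the
  fourth.\<close>

lemma nested_if_nontransverse: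
  assumes nt: "acts_nontransversely_ess X t" and H: "H \<in> Pos"
  shows "t ` H \<subseteq> H"
proof (rule ccontr)
  assume "\<not> t ` H \<subseteq> H"
  then obtain y where y: "y \<in> t ` H" "y \<notin> H" by blast
  let ?S = "sageev_halfspace (ess_char_set X t)"
  note tH = T_Pos[OF H, of 1] and HH = Pos_halfspace[OF H]
  have yV: "y \<in> \<Union>X" using y(1) halfspace_subset[OF Pos_halfspace[OF tH]] by blast
  obtain x where x: "x \<in> Min_vertices" "H \<in> crossed x" using H by (auto simp: Pos_def)
  note xV = Min_vertex[OF x(1)]
  have mem: "T n x \<in> H \<longleftrightarrow> n \<ge> 1" "T n x \<in> t ` H \<longleftrightarrow> n \<ge> 2" for n
    using orbit_iff[OF x, of n] orbit_iff[OF x, of "n - 1"] mem_T[OF HH T_vertex[OF xV], of n 1]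
      T_add[OF xV, of "- 1" n] by auto
  have S: "proj u \<in> ?S K \<longleftrightarrow> u \<in> K" if "u \<in> \<Union>X" "K \<in> Pos" for u K
    using proj_ess_vertex[OF that(1)] Pos_char[OF that(2)]
    unfolding sageev_halfspace_def ess_char_set_vertices by (simp add: mem_proj)
  note P = proj_ess_vertex and SH = S[OF _ H] S[OF _ tH]
  have "transverse ess_vertices (?S H) (?S (t ` H))"
    unfolding transverse_def
  proof (intro conjI)
    show "?S H \<inter> ?S (t ` H) \<noteq> {}" using SH[OF T_vertex[OF xV, of 2]] mem[of 2] by auto
    show "?S H \<inter> (ess_vertices - ?S (t ` H)) \<noteq> {}"
      using SH[OF T_vertex[OF xV, of 1]] P[OF T_vertex[OF xV, of 1]] mem[of 1] by auto
    show "(ess_vertices - ?S H) \<inter> ?S (t ` H) \<noteq> {}" using SH[OF yV] P[OF yV] y by auto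
    show "(ess_vertices - ?S H) \<inter> (ess_vertices - ?S (t ` H)) \<noteq> {}"
      using SH[OF T_vertex[OF xV, of 0]] P[OF T_vertex[OF xV, of 0]] mem[of 0] by auto
  qed
  then show False using nt Pos_char[OF H]
    unfolding acts_nontransversely_ess_def Let_def ess_char_set_vertices by blast
qed

text \<open>The directions that survive the projection are those with a characteristic half-space.
  They are collected in \<open>J\<close> and numbered by \<open>e\<close>; the image is a cube of
  dimension \<open>card J\<close>.\<close>

lemma proj_cube:
  assumes c: "c \<in> X" shows "proj ` c \<in> ess_char_set X t"
proof -
  obtain v where v: "v \<in> c" using cube_nonempty[OF cubes c] by blast
  obtain n f where f: "chart X c n f" "f {} = v" using cube_chart[OF cubes c v] .
  have fV: "f S \<in> \<Union>X" if "S \<subseteq> {..<n}" for S using chart_image[OF f(1)] that c by blast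
  have ins: "sym_diff S {i} = insert i S" if "i \<notin> S" for S and i :: nat using that by auto
  have adj: "adjacent X (f (insert i S)) (f S)" if "S \<subseteq> {..<n}" "i < n" "i \<notin> S" for S i
    using chart_adjacent[OF f(1), of S "insert i S"] ins[OF that(3)] that by (auto simp: adjacent_sym)
  define H where "H i = side (f {i}) (f {})" for i
  \<comment> \<open>Edges of the cube in direction \<open>i\<close> are parallel, so the single
    half-space \<open>H i\<close> can serve as the \<open>i\<close>-th coordinate.\<close>
  have par: "side (f (insert i S)) (f S) = H i" if S: "S \<subseteq> {..<n}" "i < n" "i \<notin> S" for S i
    using finite_subset[OF S(1) finite_lessThan] S
  proof (induction S rule: finite_induct)
    case empty then show ?case by (simp add: H_def)
  next
    case (insert j S)
    then have ij: "i \<noteq> j" "j < n" "i \<notin> S" "S \<subseteq> {..<n}" by auto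
    have "sym_diff S {i, j} = insert i (insert j S)" using insert ij by auto
    then have "square X (f S) (f (insert i S)) (f (insert i (insert j S))) (f (insert j S))"
      using chart_square[OF f(1) ij(4) _ ij(2,1)] insert ij ins by simp
    then have "square X (f (insert i S)) (f S) (f (insert j S)) (f (insert i (insert j S)))"
      by (blast intro: square_flip square_rotate)
    from side_square[OF this] show ?case using insert ij by simp
  qed
  have memH: "f S \<in> H i \<longleftrightarrow> i \<in> S" if S: "S \<subseteq> {..<n}" "i < n" for S i
  proof (cases "i \<in> S")
    case True
    then have "insert i (S - {i}) = S" by blast
    moreover have sub: "S - {i} \<subseteq> {..<n}" "i \<notin> S - {i}" using S by auto
    ultimately have "f S \<in> side (f S) (f (S - {i}))" "side (f S) (f (S - {i})) = H i"
      using side_ends(1)[OF adj[OF sub(1) S(2) sub(2)]] par[OF sub(1) S(2) sub(2)] by simp_all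
    then show ?thesis using True by simp
  next
    case False
    then show ?thesis using par[OF S False] side_ends(2)[OF adj[OF S False]] by simp
  qed
  have same: "f (insert i S) \<in> L \<longleftrightarrow> f S \<in> L"
    if S: "S \<subseteq> {..<n}" "i < n" "i \<notin> S" and L: "L \<in> halfspaces X" "L \<noteq> H i" "L \<noteq> \<Union>X - H i" for S i L
    using edge_same_side[OF adj[OF S] L(1)] par[OF S] side_Diff[OF adj[OF S]] L(2,3) by simp
  define J where "J = {i. i < n \<and> H i \<in> char_set}"
  have HJ: "H i \<in> halfspaces X" if "i < n" for i
    using halfspace_side[OF adj[of "{}" i]] that by (simp add: H_def)
  have drop: "proj (f (S \<union> R)) = proj (f S)"
    if R: "S \<subseteq> {..<n}" "R \<subseteq> {..<n} - J" for S R
    using finite_subset[OF R(2) finite_Diff[OF finite_lessThan]] R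
  proof (induction R rule: finite_induct)
    case (insert i R)
    show ?case
    proof (cases "i \<in> S")
      case True then have "S \<union> insert i R = S \<union> R" by blast
      then show ?thesis using insert by simp
    next
      case False
      have i: "i < n" "H i \<notin> char_set" using insert by (auto simp: J_def)
      then have "L \<in> proj (f (insert i (S \<union> R))) \<longleftrightarrow> L \<in> proj (f (S \<union> R))" for L
        using same[of "S \<union> R" i L] insert False char_halfspace char_Diff_iff[OF HJ[OF i(1)]]
        unfolding mem_proj by auto
      then show ?thesis using insert by auto
    qed
  qed auto
  have "finite J" "J \<subseteq> {..<n}" by (auto simp: J_def)
  obtain e where e: "bij_betw e {..<card J} J"
    using ex_bij_betw_nat_finite[OF \<open>finite J\<close>] by (auto simp: atLeast0LessThan)
  let ?m = "card J"
  define F where "F P = proj (f (e ` P))" for P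
  have eJ: "e ` P \<subseteq> {..<n}" "e ` P \<subseteq> J" if "P \<subseteq> {..<?m}" for P
    using e that \<open>J \<subseteq> {..<n}\<close> by (auto simp: bij_betw_def)
  have e_mem: "e i \<in> e ` P \<longleftrightarrow> i \<in> P" if "P \<subseteq> {..<?m}" "i < ?m" for P i
    using inj_on_image_mem_iff[of e "{..<?m}" i P] e that by (simp add: bij_betw_def)
  have ei: "e i < n" "H (e i) \<in> char_set" if "i < ?m" for i
    using e that by (auto simp: bij_betw_def J_def)
  have HF: "H (e i) \<in> F P \<longleftrightarrow> i \<in> P" if "P \<subseteq> {..<?m}" "i < ?m" for P i
    using memH[OF eJ(1)[OF that(1)] ei(1)[OF that(2)]] ei(2)[OF that(2)] e_mem[OF that]
    by (simp add: F_def mem_proj)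
  have "inj_on F (Pow {..<?m})"
  proof
    fix P Q assume PQ: "P \<in> Pow {..<?m}" "Q \<in> Pow {..<?m}" "F P = F Q"
    then have "i \<in> P \<longleftrightarrow> i \<in> Q" if "i < ?m" for i using HF[of P i] HF[of Q i] that by auto
    then show "P = Q" using PQ by blast
  qed
  moreover have "F ` Pow {..<?m} \<subseteq> ess_vertices"
    using proj_ess_vertex[OF fV[OF eJ(1)]] by (auto simp: F_def)
  moreover have "differ_on_one_pair (\<Union>X) (F P) (F (insert i P))"
    if P: "P \<subseteq> {..<?m}" "i \<in> {..<?m} - P" for P i
  proof -
    have i: "i < ?m" "i \<notin> P" "insert i P \<subseteq> {..<?m}" using P by auto
    have ni: "e i \<notin> e ` P" using e_mem[OF P(1) i(1)] i(2) by simp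
    have FH: "H (e i) \<in> F (insert i P)" "H (e i) \<notin> F P"
      using HF[OF i(3,1)] HF[OF P(1) i(1)] i by auto
    have V: "f (e ` P) \<in> \<Union>X" "f (insert (e i) (e ` P)) \<in> \<Union>X"
      using fV eJ(1)[OF P(1)] eJ(1)[OF i(3)] by simp_all
    have *: "L \<in> F (insert i P) \<longleftrightarrow> L \<in> F P"
      if "L \<noteq> H (e i)" "L \<noteq> \<Union>X - H (e i)" for L
      using same[OF eJ(1)[OF P(1)] ei(1)[OF i(1)] ni _ that] char_halfspace
      by (auto simp: F_def mem_proj)
    have c: "\<Union>X - H (e i) \<in> F P" "\<Union>X - H (e i) \<notin> F (insert i P)"
    proof -
      have f: "f (e ` P) \<notin> H (e i)" "f (e ` insert i P) \<in> H (e i)"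
        using FH ei(2)[OF i(1)] by (simp_all add: F_def mem_proj)
      show "\<Union>X - H (e i) \<in> F P" unfolding F_def mem_proj
        by (intro conjI DiffI char_Diff ei(2) i(1) V(1) f(1))
      have "f (e ` insert i P) \<notin> \<Union>X - H (e i)" by (rule notI, erule DiffE, erule notE) (rule f(2))
      then show "\<Union>X - H (e i) \<notin> F (insert i P)" unfolding F_def mem_proj by (rule contrapos_nn) (erule conjunct2)
    qed
    have one: "A - B = {a}" if "a \<in> A" "a \<notin> B" "b \<notin> A" "\<And>L. L \<noteq> a \<Longrightarrow> L \<noteq> b \<Longrightarrow> L \<in> A \<longleftrightarrow> L \<in> B"
      for A B :: "'a set set" and a b using that by blast
    have "F P - F (insert i P) = {\<Union>X - H (e i)}"
      by (rule one[OF c FH(2)]) (use * in simp)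
    moreover have "F (insert i P) - F P = {\<Union>X - (\<Union>X - H (e i))}"
      unfolding halfspace_Diff_Diff[OF HJ[OF ei(1)[OF i(1)]]]
      by (rule one[OF FH c(2)]) (use * in simp)
    ultimately show ?thesis unfolding differ_on_one_pair_def by blast
  qed
  ultimately have "F ` Pow {..<?m} \<in> ess_char_set X t"
    unfolding ess_char_set_def sageev_complex_def
    by (intro CollectI exI[of _ ?m] exI[of _ F] conjI refl allI impI) simp_all
  moreover have "F ` Pow {..<?m} = proj ` c"
  proof
    show "F ` Pow {..<?m} \<subseteq> proj ` c" using chart_image[OF f(1)] eJ(1) by (auto simp: F_def)
    show "proj ` c \<subseteq> F ` Pow {..<?m}"
    proof
      fix U assume "U \<in> proj ` c"
      then obtain S where S: "S \<subseteq> {..<n}" "U = proj (f S)" using chart_image[OF f(1)] by blast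
      have "(S \<inter> J) \<union> (S - J) = S" by blast
      then have U: "U = proj (f (S \<inter> J))" using drop[of "S \<inter> J" "S - J"] S by auto
      obtain P where P: "P \<subseteq> {..<?m}" "e ` P = S \<inter> J"
        using e unfolding bij_betw_def by (metis subset_imageE Int_lower2)
      then have "U = F P" using U by (simp add: F_def)
      moreover have "P \<in> Pow {..<?m}" using P(1) by simp
      ultimately show "U \<in> F ` Pow {..<?m}" by (rule image_eqI)
    qed
  qed
  ultimately show ?thesis by simp
qed

text \<open>The orbit of \<open>v\<close> enters \<open>H\<close> between some times
  \<open>k\<close> and \<open>k + 1\<close>; translating back by \<open>k\<close> moves this entry
  to the first period.\<close>

lemma Pos_translate:
  assumes v: "v \<in> Min_vertices" and H: "H \<in> Pos"
  obtains k K where "K \<in> crossed v" "H = T k ` K"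
proof -
  note vV = Min_vertex[OF v] and HH = Pos_halfspace[OF H]
  obtain k where k: "\<And>n. T n v \<in> H \<longleftrightarrow> n > k" using orbit_crossing[OF v H] by blast
  have "T (- k) ` H \<in> crossed v"
    using mem_T[OF HH vV, of "- k"] mem_T[OF HH T_vertex[OF vV], of 1 "- k"] T_add[OF vV, of k 1]
      k[of k] k[of "k + 1"] T_halfspace[OF HH] by (simp add: crossed_iff)
  moreover have "H = T k ` T (- k) ` H"
    using T_image_image[OF halfspace_subset[OF HH], of k "- k"] T_image_zero[OF halfspace_subset[OF HH]]
    by simp
  ultimately show ?thesis by (rule that)
qed

lemma crossed_Pos: "v \<in> Min_vertices \<Longrightarrow> K \<in> crossed v \<Longrightarrow> K \<in> Pos"
  unfolding Pos_def by blast

end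

text \<open>Nestedness turns every orbit of positive half-spaces into a chain, so that the descending
  chain condition leaves only finitely many of them between a vertex of the essential
  characteristic set and a vertex of the minimal set, even when the complex has infinite dimension.\<close>

locale nested_translation = cat0_translation +
  assumes nested: "H \<in> Pos \<Longrightarrow> t ` H \<subseteq> H"
begin

section \<open>Lifting vertices and cubes into the minimal set\<close>

lemma diff_psubset: "A \<subset> B \<Longrightarrow> B \<subseteq> C \<Longrightarrow> C - B \<subset> C - A"
  by blast

text \<open>Inclusion comes from nestedness. It is strict because the orbit of \<open>v\<close> at
  time \<open>m + 1\<close> has entered the \<open>m\<close>-th translate but not yet the
  \<open>n\<close>-th.\<close>

lemma nested_chain:
  assumes v: "v \<in> Min_vertices" and K: "K \<in> crossed v" and mn: "m < n"
  shows "T n ` K \<subset> T m ` K"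
proof -
  note KP = crossed_Pos[OF v K] and vV = Min_vertex[OF v]
  have step: "T (i + 1) ` K \<subseteq> T i ` K" for i
    using nested[OF T_Pos[OF KP, of i]] T_image_image[OF halfspace_subset[OF Pos_halfspace[OF KP]], of 1 i]
    by (simp add: add.commute)
  have "T n ` K \<subseteq> T m ` K"
    using less_imp_le[OF mn]
  proof (induction n rule: int_ge_induct)
    case (step i)
    then show ?case using \<open>\<And>i. T (i + 1) ` K \<subseteq> T i ` K\<close>[of i] by blast
  qed simp
  moreover have mem: "T j v \<in> T i ` K \<longleftrightarrow> j - i \<ge> 1" for i j
    using mem_T[OF Pos_halfspace[OF KP] T_vertex[OF vV], of j i] T_add[OF vV, of "- i" j]
      orbit_iff[OF v K, of "j - i"] by simp
  moreover have "T (m + 1) v \<in> T m ` K" "T (m + 1) v \<notin> T n ` K" using mem mn by auto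
  ultimately show ?thesis by blast
qed

lemma orbit_mem:
  assumes v: "v \<in> Min_vertices" and K: "K \<in> crossed v"
  shows "v \<in> T n ` K \<longleftrightarrow> n < 0"
  using mem_T[OF Pos_halfspace[OF crossed_Pos[OF v K]] Min_vertex[OF v], of n]
    orbit_iff[OF v K, of "- n"] by simp linarith

lemma ess_vertex_Diff:
  "U \<in> ess_vertices \<Longrightarrow> H \<in> char_set \<Longrightarrow> \<Union>X - H \<in> U \<longleftrightarrow> H \<notin> U"
  unfolding sageev_vertices_def by blast

lemma ess_vertex_dcc:
  "U \<in> ess_vertices \<Longrightarrow> \<not> (\<forall>n. h n \<in> U \<and> h (Suc n) \<subset> h n)"
  unfolding sageev_vertices_def descending_chain_condition_def by blast

text \<open>Upward closure makes the indices of translates in \<open>U\<close> an initial segment of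
  the integers. The descending chain condition bounds it above when applied to the translates, and
  shows it nonempty when applied to the complements of the backward translates.\<close>

lemma ess_vertex_near_orbit:
  assumes U: "U \<in> ess_vertices" and v: "v \<in> Min_vertices" and K: "K \<in> crossed v"
  shows "finite {n. (T n ` K \<in> U) \<noteq> (v \<in> T n ` K)}"
proof -
  note vV = Min_vertex[OF v]
  have KA: "T n ` K \<in> char_set" for n using Pos_char T_Pos crossed_Pos[OF v K] by blast
  have KV: "T n ` K \<subseteq> \<Union>X" for n using halfspace_subset[OF char_halfspace[OF KA]] .
  have mono: "T m ` K \<in> U" if "T n ` K \<in> U" "m \<le> n" for m n
    using ess_upward[OF U that(1) _ KA] nested_chain[OF v K, of m n] that by (cases "m = n") auto
  obtain a where a: "T (int a) ` K \<notin> U"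
    using ess_vertex_dcc[OF U, of "\<lambda>n. T (int n) ` K"] nested_chain[OF v K] by auto
  obtain b where b: "T (- int b) ` K \<in> U"
  proof -
    have "\<Union>X - T (- int (Suc n)) ` K \<subset> \<Union>X - T (- int n) ` K" for n
    proof -
      have "T (- int n) ` K \<subset> T (- int (Suc n)) ` K" using nested_chain[OF v K] by simp
      from diff_psubset[OF this KV] show ?thesis .
    qed
    then have "\<not> (\<forall>n. \<Union>X - T (- int n) ` K \<in> U)"
      using ess_vertex_dcc[OF U, of "\<lambda>n. \<Union>X - T (- int n) ` K"] by simp
    then obtain b where "\<Union>X - T (- int b) ` K \<notin> U" by (simp only: not_all) (elim exE)
    then show ?thesis using that ess_vertex_Diff[OF U KA] by blast
  qed
  have "{n. (T n ` K \<in> U) \<noteq> (v \<in> T n ` K)} \<subseteq> {- int b..int a}"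
  proof
    fix n assume n: "n \<in> {n. (T n ` K \<in> U) \<noteq> (v \<in> T n ` K)}"
    have "\<not> n < - int b" using n mono[OF b, of n] orbit_mem[OF v K, of n] by auto
    moreover have "\<not> n > int a" using n mono[of n "int a"] a orbit_mem[OF v K, of n] by auto
    ultimately show "n \<in> {- int b..int a}" by simp
  qed
  then show ?thesis using finite_subset by blast
qed

text \<open>Up to complementation, every disagreement is a translate of a member of the finite set
  \<open>crossed v\<close>, so finiteness along each orbit suffices.\<close>

lemma ess_vertex_near:
  assumes U: "U \<in> ess_vertices" and v: "v \<in> Min_vertices"
  shows "finite (U - principal v)"
proof -
  note vV = Min_vertex[OF v]
  let ?B = "\<lambda>K. {n. (T n ` K \<in> U) \<noteq> (v \<in> T n ` K)}"
  let ?F = "\<lambda>K. (\<lambda>n. T n ` K) ` ?B K \<union> (\<lambda>n. \<Union>X - T n ` K) ` ?B K"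
  have UA: "U \<subseteq> char_set" using U unfolding sageev_vertices_def by blast
  have "U - principal v \<subseteq> (\<Union>K\<in>crossed v. ?F K)"
  proof
    fix H assume H: "H \<in> U - principal v"
    then have HA: "H \<in> char_set" using UA by blast
    have vH: "v \<notin> H" using H char_halfspace[OF HA] by (simp add: principal_def)
    from HA[unfolded char_set_eq] show "H \<in> (\<Union>K\<in>crossed v. ?F K)"
    proof
      assume "H \<in> Pos"
      then obtain n K where K: "K \<in> crossed v" "H = T n ` K" using Pos_translate[OF v] by blast
      then have "n \<in> ?B K" using H vH by simp
      then show ?thesis using K by blast
    next
      assume "H \<in> (\<lambda>H. \<Union>X - H) ` Pos"
      then obtain L where L: "L \<in> Pos" "H = \<Union>X - L" by blast
      then obtain n K where K: "K \<in> crossed v" "L = T n ` K" using Pos_translate[OF v] by blast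
      have "L \<notin> U" using ess_vertex_Diff[OF U Pos_char[OF L(1)]] H L by blast
      moreover have "v \<in> L" using vH L vV by blast
      ultimately have n: "n \<in> ?B K" using K by simp
      have "H = \<Union>X - T n ` K" using L(2) K(2) by simp
      then have "H \<in> ?F K" using n by (intro UnI2 image_eqI)
      then show ?thesis using K(1) by (rule UN_I[rotated])
    qed
  qed
  moreover have "finite (\<Union>K\<in>crossed v. ?F K)"
    using card_crossed(1)[OF vV] ess_vertex_near_orbit[OF U v] by simp
  ultimately show ?thesis by (rule finite_subset)
qed

lemma orbit_meets_char:
  assumes v: "v \<in> Min_vertices" and H: "H \<in> char_set"
  shows "\<exists>n. T n v \<in> H"
  using H[unfolded char_set_eq]
proof
  assume "H \<in> Pos"
  then obtain k where "\<And>n. T n v \<in> H \<longleftrightarrow> n > k" using orbit_crossing[OF v] by blast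
  then have "T (k + 1) v \<in> H" by simp
  then show ?thesis ..
next
  assume "H \<in> (\<lambda>H. \<Union>X - H) ` Pos"
  then obtain L where L: "L \<in> Pos" "H = \<Union>X - L" by blast
  then obtain k where "\<And>n. T n v \<in> L \<longleftrightarrow> n > k" using orbit_crossing[OF v] by blast
  then have "T k v \<in> H" using L T_vertex[OF Min_vertex[OF v]] by simp
  then show ?thesis ..
qed

text \<open>Choices of \<open>U\<close> and of \<open>v\<close> are compatible: the orbit of
  \<open>v\<close> meets each characteristic half-space and stays inside each of the others that
  contain \<open>v\<close>. Finite difference from \<open>principal v\<close> then yields an actual
  vertex.\<close>

lemma ess_vertex_lift:
  assumes U: "U \<in> ess_vertices" and v: "v \<in> Min_vertices"
  obtains w where "w \<in> \<Union>X" "principal w = U \<union> (principal v - char_set)"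
proof -
  note vV = Min_vertex[OF v]
  let ?W = "U \<union> (principal v - char_set)"
  have UA: "U \<subseteq> char_set" using U unfolding sageev_vertices_def by blast
  have mixed: "H \<inter> K \<noteq> {}" if "H \<in> U" "K \<in> principal v - char_set" for H K
  proof -
    have "H \<in> char_set" using UA that(1) by blast
    then obtain n where "T n v \<in> H" using orbit_meets_char[OF v] by blast
    moreover have "T n v \<in> K" using orbit_avoids_non_char[OF v, of K n] that by (simp add: principal_def)
    ultimately show ?thesis by blast
  qed
  have "ultrafilter ?W"
    unfolding ultrafilter_def
  proof (intro conjI ballI)
    show "?W \<subseteq> halfspaces X" using UA char_halfspace by (auto simp: principal_def)
    show "(H \<in> ?W) \<noteq> (\<Union>X - H \<in> ?W)" if H: "H \<in> halfspaces X" for H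
    proof (cases "H \<in> char_set")
      case True
      then show ?thesis using char_Diff[OF True] ess_vertex_Diff[OF U True] by blast
    next
      case False
      then have "\<Union>X - H \<notin> char_set" using char_Diff_iff[OF H] by blast
      then show ?thesis using False UA H halfspace_Diff[OF H] vV unfolding principal_def by blast
    qed
    show "H \<inter> K \<noteq> {}" if "H \<in> ?W" "K \<in> ?W" for H K
    proof -
      have "H \<inter> K \<noteq> {}" if "H \<in> U" "K \<in> U" using U that unfolding sageev_vertices_def by blast
      moreover have "H \<inter> K \<noteq> {}" if "H \<in> principal v" "K \<in> principal v"
        using that by (auto simp: principal_def)
      moreover have "K \<inter> H = H \<inter> K" by blast
      ultimately show ?thesis using mixed[of H K] mixed[of K H] that by auto
    qed
  qed
  moreover have "finite (?W - principal v)"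
    using ess_vertex_near[OF U v] by (rule finite_subset[rotated]) blast
  ultimately show ?thesis using ultrafilter_principal[OF _ vV] that by blast
qed

lemma lift_Min_vertex:
  assumes U: "U \<in> ess_vertices" and v: "v \<in> Min_vertices"
    and w: "w \<in> \<Union>X" "principal w = U \<union> (principal v - char_set)"
  shows "w \<in> Min_vertices"
proof -
  note vV = Min_vertex[OF v]
  have UA: "U \<subseteq> char_set" using U unfolding sageev_vertices_def by blast
  have memw: "w \<in> H \<longleftrightarrow> (if H \<in> char_set then H \<in> U else v \<in> H)" if "H \<in> halfspaces X" for H
  proof -
    have "w \<in> H \<longleftrightarrow> H \<in> U \<union> (principal v - char_set)" using that w(2) by (auto simp: principal_def)
    then show ?thesis using that UA by (auto simp: principal_def)
  qed
  \<comment> \<open>The index at which the chain of translates of \<open>K\<close> leaves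
    \<open>U\<close>. Its value matters only for those \<open>K\<close> with a translate in
    \<open>crossed w\<close>; that translate must then be the one with this index.\<close>
  define \<nu> where "\<nu> K = (THE n. T n ` K \<notin> U \<and> T (n - 1) ` K \<in> U)" for K
  have \<nu>: "\<nu> K = n" if K: "K \<in> crossed v" and n: "T n ` K \<notin> U" "T (n - 1) ` K \<in> U" for K n
  proof -
    have KA: "T i ` K \<in> char_set" for i using Pos_char T_Pos crossed_Pos[OF v K] by blast
    have mono: "T i ` K \<in> U" if "T j ` K \<in> U" "i \<le> j" for i j
      using ess_upward[OF U that(1) _ KA] nested_chain[OF v K, of i j] that by (cases "i = j") auto
    show ?thesis unfolding \<nu>_def
    proof (rule the_equality)
      fix m assume m: "T m ` K \<notin> U \<and> T (m - 1) ` K \<in> U"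
      have "\<not> m \<le> n - 1" "\<not> n \<le> m - 1" using mono n m by blast+
      then show "m = n" by simp
    qed (use n in blast)
  qed
  have "crossed w \<subseteq> (\<lambda>K. T (\<nu> K) ` K) ` crossed v"
  proof
    fix L assume "L \<in> crossed w"
    then have L: "L \<in> halfspaces X" "w \<notin> L" "t w \<in> L" by (auto simp: crossed_iff)
    \<comment> \<open>Membership of \<open>t w\<close> in \<open>L\<close> becomes membership of
      \<open>w\<close> in \<open>L'\<close>, which \<open>memw\<close> decides.\<close>
    define L' where "L' = T (- 1) ` L"
    have L': "L' \<in> halfspaces X" "w \<in> L'"
      using T_halfspace[OF L(1)] mem_T[OF L(1) w(1), of "- 1"] L(3) by (simp_all add: L'_def)
    have LL': "L = T 1 ` L'"
      using T_image_image[OF halfspace_subset[OF L(1)], of 1 "- 1"]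
        T_image_zero[OF halfspace_subset[OF L(1)]] by (simp add: L'_def)
    \<comment> \<open>Outside the characteristic set \<open>w\<close> imitates \<open>v\<close>,
      whose orbit crosses no such half-space.\<close>
    have "L \<in> char_set"
    proof (rule ccontr)
      assume nL: "L \<notin> char_set"
      then have "L' \<notin> char_set" using T_char LL' by blast
      then have "v \<in> L'" using memw[OF L'(1)] L'(2) by simp
      then have "T 1 v \<in> L" using mem_T[OF L(1) vV, of "- 1"] by (simp add: L'_def)
      then have "v \<in> L" using orbit_avoids_non_char[OF v L(1) nL] by blast
      then show False using memw[OF L(1)] nL L(2) by simp
    qed
    then have LU: "L \<notin> U" "L' \<in> char_set" "L' \<in> U"
      using memw[OF L(1)] memw[OF L'(1)] L(2) L'(2) T_char[of L "- 1"] by (auto simp: L'_def)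
    \<comment> \<open>If \<open>L\<close> were the complement of a positive \<open>K\<close>, then
      \<open>U\<close> would contain \<open>K\<close> but not its larger backward translate, against
      upward closure.\<close>
    have "L \<in> Pos"
    proof (rule ccontr)
      assume "L \<notin> Pos"
      then obtain K where K: "K \<in> Pos" "L = \<Union>X - K" using \<open>L \<in> char_set\<close> unfolding char_set_eq by blast
      have "L' = \<Union>X - T (- 1) ` K"
        using T_image_Diff[OF halfspace_subset[OF Pos_halfspace[OF K(1)]]] K(2) by (simp add: L'_def)
      then have "T (- 1) ` K \<notin> U" using ess_vertex_Diff[OF U Pos_char[OF T_Pos[OF K(1)]]] LU(3) by blast
      moreover have "K \<in> U" using ess_vertex_Diff[OF U Pos_char[OF K(1)]] LU(1) K(2) by blast
      moreover have "K \<subseteq> T (- 1) ` K"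
        using nested[OF T_Pos[OF K(1), of "- 1"]]
          T_image_image[OF halfspace_subset[OF Pos_halfspace[OF K(1)]], of 1 "- 1"]
          T_image_zero[OF halfspace_subset[OF Pos_halfspace[OF K(1)]]] by simp
      ultimately show False using ess_upward[OF U _ _ Pos_char[OF T_Pos[OF K(1)]]] by blast
    qed
    then obtain n K where K: "K \<in> crossed v" "L = T n ` K" using Pos_translate[OF v] by blast
    have "L' = T (n - 1) ` K"
      using T_image_image[OF halfspace_subset[OF Pos_halfspace[OF crossed_Pos[OF v K(1)]]], of "- 1" n]
      by (simp add: L'_def K(2))
    then have "\<nu> K = n" using \<nu>[OF K(1)] LU K(2) by simp
    then show "L \<in> (\<lambda>K. T (\<nu> K) ` K) ` crossed v" using K by blast
  qed
  then have "card (crossed w) \<le> card (crossed v)" using card_crossed(1)[OF vV] surj_card_le by blast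
  also have "\<dots> = tlen" using card_crossed(2)[OF vV] v by (simp add: Min_vertices_def)
  finally have "d w (t w) = tlen" using card_crossed(2)[OF w(1)] tlen_le[OF w(1)] by simp
  then show ?thesis using w(1) unfolding Min_vertices_def by blast
qed

text \<open>Lifts over the same \<open>v\<close> differ exactly as the corners do, so neighbouring
  corners have adjacent lifts and \<open>cube_of_skeleton\<close> fills in the cube.\<close>

lemma ess_cube_lift:
  assumes "c \<in> ess_char_set X t" shows "\<exists>c'\<in>min_set X t. proj ` c' = c"
proof -
  obtain v where v: "v \<in> Min_vertices" using Min_vertices_nonempty by blast
  have "\<exists>(n::nat) f. c = f ` Pow {..<n} \<and> inj_on f (Pow {..<n}) \<and> f ` Pow {..<n} \<subseteq> ess_vertices \<and>
      (\<forall>S i. S \<subseteq> {..<n} \<and> i \<in> {..<n} - S \<longrightarrow> differ_on_one_pair (\<Union>X) (f S) (f (insert i S)))"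
    using assms by (simp only: ess_char_set_def sageev_complex_def mem_Collect_eq)
  then obtain n :: nat and f where c: "c = f ` Pow {..<n}" and inj: "inj_on f (Pow {..<n})"
    and f: "f ` Pow {..<n} \<subseteq> ess_vertices"
    and diff0: "\<forall>S i. S \<subseteq> {..<n} \<and> i \<in> {..<n} - S \<longrightarrow> differ_on_one_pair (\<Union>X) (f S) (f (insert i S))"
    by (elim exE conjE) (rule that)
  note diff = diff0[rule_format, OF conjI]
  have "\<exists>w. w \<in> \<Union>X \<and> principal w = f S \<union> (principal v - char_set)" if "S \<subseteq> {..<n}" for S
  proof -
    have "f S \<in> ess_vertices" using f that by blast
    from ess_vertex_lift[OF this v] obtain w
      where "w \<in> \<Union>X" "principal w = f S \<union> (principal v - char_set)" .
    then show ?thesis by (intro exI conjI)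
  qed
  then obtain w where w: "\<And>S. S \<subseteq> {..<n} \<Longrightarrow>
      w S \<in> \<Union>X \<and> principal (w S) = f S \<union> (principal v - char_set)" by metis
  have fA: "f S \<subseteq> char_set" if "S \<subseteq> {..<n}" for S using f that unfolding sageev_vertices_def by blast
  have proj: "proj (w S) = f S" if S: "S \<subseteq> {..<n}" for S
  proof -
    have "proj (w S) = principal (w S) \<inter> char_set" by (simp add: ess_proj_def principal_def)
    then show ?thesis using w[OF S] fA[OF S] by blast
  qed
  have "w ` Pow {..<n} \<in> X"
  proof (rule cube_of_skeleton)
    show "inj_on w (Pow {..<n})"
    proof
      fix S R assume SR: "S \<in> Pow {..<n}" "R \<in> Pow {..<n}" "w S = w R"
      then have "f S = f R" using proj[of S] proj[of R] by simp
      then show "S = R" using inj SR by (auto dest: inj_onD)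
    qed
    show "w {} \<in> \<Union>X" using w[of "{}"] by blast
    show "adjacent X (w S) (w (insert i S))" if S: "S \<subseteq> {..<n}" "i < n" "i \<notin> S" for S i
    proof -
      have i: "insert i S \<subseteq> {..<n}" "i \<in> {..<n} - S" using S by auto
      obtain H where "f S - f (insert i S) = {H}"
        using diff[OF S(1) i(2)] unfolding differ_on_one_pair_def by blast
      moreover have "separators (w S) (w (insert i S)) = principal (w S) - principal (w (insert i S))"
        by (auto simp: separators_def principal_def)
      moreover have "\<dots> = f S - f (insert i S)" using w[OF S(1)] w[OF i(1)] fA[OF S(1)] by blast
      ultimately show ?thesis using adjacent_if_one_separator w[OF S(1)] w[OF i(1)] by metis
    qed
  qed
  moreover have "w S \<in> Min_vertices" if S: "S \<subseteq> {..<n}" for S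
  proof -
    have "f S \<in> ess_vertices" using f S by blast
    then show ?thesis using lift_Min_vertex[OF _ v] w[OF S] by blast
  qed
  ultimately have "w ` Pow {..<n} \<in> min_set X t" unfolding min_set_vertices by blast
  moreover have "proj ` w ` Pow {..<n} = c"
    unfolding c image_image by (rule image_cong[OF refl]) (use proj in blast)
  ultimately show ?thesis by blast
qed

end

section \<open>Equality of the two complexes\<close>

context cat0_translation
begin

lemma ess_min_set_iff: "ess_min_set X t = ess_char_set X t \<longleftrightarrow> acts_nontransversely_ess X t"
proof
  assume eq: "ess_min_set X t = ess_char_set X t"
  have "H \<in> U" if H: "H \<in> Pos" and U: "U \<in> ess_vertices" "t ` H \<in> U" for H U
  proof -
    have "U \<in> \<Union>(ess_min_set X t)" using ess_vertex_in_complex[OF U(1)] eq by simp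
    then obtain c v where "c \<in> min_set X t" "v \<in> c" "U = proj v" unfolding ess_min_set_def by blast
    moreover from this have "v \<in> Min_vertices" using min_set_vertices by blast
    ultimately show ?thesis using proj_translate[OF _ H] U(2) by blast
  qed
  then show "acts_nontransversely_ess X t" by (rule nontransverse_if)
next
  assume nt: "acts_nontransversely_ess X t"
  interpret nested_translation X T
    by unfold_locales (rule nested_if_nontransverse[OF nt])
  show "ess_min_set X t = ess_char_set X t"
  proof
    show "ess_min_set X t \<subseteq> ess_char_set X t"
      unfolding ess_min_set_def using proj_cube min_set_vertices by blast
    show "ess_char_set X t \<subseteq> ess_min_set X t"
      unfolding ess_min_set_def using ess_cube_lift by blast
  qed
qed

end

theorem proposition3p17:
  fixes G :: "('g, 'm) monoid_scheme"
    and \<phi> :: "'g \<Rightarrow> 'v \<Rightarrow> 'v"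
    and X :: "'v set set"
    and g :: 'g
  assumes "cat0_cube_complex X"
    and "cubical_action G \<phi> X"
    and "without_inversion G \<phi> X"
    and "g \<in> carrier G"
    and "hyperbolic X (\<phi> g)"
  shows "ess_min_set X (\<phi> g) = ess_char_set X (\<phi> g) \<longleftrightarrow> acts_nontransversely_ess X (\<phi> g)"
proof -
  interpret group_action G "\<Union>X" \<phi> using assms(2) by (simp add: cubical_action_def)
  interpret G: group G using group_hom group_hom.axioms(1) by blast
  define T where "T k = \<phi> (g [^]\<^bsub>G\<^esub> k)" for k :: int
  have gk: "g [^]\<^bsub>G\<^esub> k \<in> carrier G" for k :: int using assms(4) by (rule G.int_pow_closed)
  have T1: "T 1 = \<phi> g" using G.int_pow_1[OF assms(4)] by (simp add: T_def)
  interpret cat0_translation X T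
  proof
    show "cat0_cube_complex X" by fact
    show "T 0 x = x" if "x \<in> \<Union>X" for x
    proof -
      have "\<phi> \<one>\<^bsub>G\<^esub> x = (\<lambda>x\<in>\<Union>X. x) x" using id_eq_one by metis
      then show ?thesis using that by (simp only: T_def int_pow_0 restrict_apply' if_True)
    qed
    show "T (j + k) x = T j (T k x)" if "x \<in> \<Union>X" for x j k
      using composition_rule[OF that gk gk] G.int_pow_mult[OF assms(4)] by (simp add: T_def)
    show "T k ` c \<in> X" if "c \<in> X" for c k
      using assms(2) gk that by (simp add: cubical_action_def T_def)
    show "T k ` H \<noteq> \<Union>X - H" if "H \<in> halfspaces X" for H k
      using assms(3) gk that by (simp add: without_inversion_def T_def)
    show "hyperbolic X (T 1)" using assms(5) T1 by simp
  qed
  show ?thesis using ess_min_set_iff unfolding T1 .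
qed

end
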